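(* Let $a\in C^\infty(\mathbb T;\mathbb R)$, let $a_0=\frac1{2\pi}\int_0^{2\pi}a(t)\,dt$, and let $L=\partial_t-a(t)\partial_x$ on $\mathbb T^2$. Let $k_1,k_2\in\mathbb R$, and suppose that $u\in\mathcal D'(\mathbb T^2)$ satisfies $Lu=f\in H_{\mathrm{mix}}^{(k_1,k_2)}(\mathbb T^2)$. Assume that $a_0\in\mathbb R\setminus\mathbb Q$ has finite irrationality measure $\mu(a_0)$. Then, for every $r>\mu(a_0)$, every $q\le k_1$, and every $0\le\theta\le1$, $$u\in H_{\mathrm{mix}}^{(q+\theta,\;k_2+1-r-|q|-\theta)}(\mathbb T^2).$$ More precisely, $$\|u-\widehat u(0,0)\|_{H_{\mathrm{mix}}^{(q+\theta,\;k_2+1-r-|q|-\theta)}(\mathbb T^2)}\le C\,\|f\|_{H_{\mathrm{mix}}^{(k_1,k_2)}(\mathbb T^2)},$$ where $C>0$ depends only on $a,k_1,q,r,\theta$. If $k_1\ge0$, then, for every $r>\mu(a_0)$ and every $0\le\sigma\le k_1+1$, $$u\in H_{\mathrm{mix}}^{(\sigma,\;k_2+1-r-\sigma)}(\mathbb T^2).$$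
   Context: $\mathbb T=\mathbb R/2\pi\mathbb Z$, with variables $(t,x)\in\mathbb T^2$ and dual frequencies $(\tau,\xi)\in\mathbb Z^2$. $\mathcal D'(\mathbb T^2)$ is the space of distributions on $\mathbb T^2$. Fourier coefficients are $\widehat f(\tau,\xi)=\frac1{(2\pi)^2}\int_{\mathbb T^2}f(t,x)e^{-i(t\tau+x\xi)}\,dt\,dx$ (by duality for distributions); the number $\widehat u(0,0)$ is identified with a constant function. $\langle w\rangle=(1+|w|^2)^{1/2}$. For $s_1,s_2\in\mathbb R$, $H_{\mathrm{mix}}^{(s_1,s_2)}(\mathbb T^2)$ is the space of $f\in\mathcal D'(\mathbb T^2)$ with $\|f\|_{H_{\mathrm{mix}}^{(s_1,s_2)}(\mathbb T^2)}^2=\sum_{(\tau,\xi)\in\mathbb Z^2}\langle\tau\rangle^{2s_1}\langle\xi\rangle^{2s_2}|\widehat f(\tau,\xi)|^2<\infty$. The irrationality measure of $\alpha\in\mathbb R\setminus\mathbb Q$ is $\mu(\alpha)=\sup\{\nu>0:\ |\alpha-p/q|<q^{-\nu}\text{ for infinitely many }(p,q)\in\mathbb Z\times\mathbb N\}\in[2,\infty]$. *)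

theory Defs
  imports "HOL-Analysis.Analysis"
begin

text \<open>
  Functions on \<open>\<T> = \<real> / 2\<pi>\<int>\<close> and on \<open>\<T>\<^sup>2\<close> are represented by functions on \<open>\<real>\<close> and \<open>\<real> \<times> \<real>\<close>
  that are \<open>2\<pi>\<close>-periodic in each variable; points of \<open>\<T>\<^sup>2\<close> are written \<open>(t, x)\<close>.
\<close>

definition smooth_on_circle :: "(real \<Rightarrow> real) \<Rightarrow> bool" where
  "smooth_on_circle a \<longleftrightarrow>
     (\<forall>n t. (deriv ^^ n) a differentiable (at t)) \<and> (\<forall>t. a (t + 2 * pi) = a t)"

definition circle_mean :: "(real \<Rightarrow> real) \<Rightarrow> real" where
  "circle_mean a = 1 / (2 * pi) * integral {0..2 * pi} a"

definition partial_t :: "(real \<times> real \<Rightarrow> complex) \<Rightarrow> real \<times> real \<Rightarrow> complex" where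
  "partial_t \<phi> = (\<lambda>(t, x). vector_derivative (\<lambda>s. \<phi> (s, x)) (at t))"

definition partial_x :: "(real \<times> real \<Rightarrow> complex) \<Rightarrow> real \<times> real \<Rightarrow> complex" where
  "partial_x \<phi> = (\<lambda>(t, x). vector_derivative (\<lambda>y. \<phi> (t, y)) (at x))"

fun C_k :: "nat \<Rightarrow> (real \<times> real \<Rightarrow> complex) \<Rightarrow> bool" where
  "C_k 0 \<phi> \<longleftrightarrow> continuous_on UNIV \<phi>"
| "C_k (Suc k) \<phi> \<longleftrightarrow>
     (\<forall>z. \<phi> differentiable (at z)) \<and> C_k k (partial_t \<phi>) \<and> C_k k (partial_x \<phi>)"

definition test_functions :: "(real \<times> real \<Rightarrow> complex) set" where
  "test_functions = {\<phi>. (\<forall>k. C_k k \<phi>) \<and>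
     (\<forall>t x. \<phi> (t + 2 * pi, x) = \<phi> (t, x) \<and> \<phi> (t, x + 2 * pi) = \<phi> (t, x))}"

definition C_k_norm :: "nat \<Rightarrow> (real \<times> real \<Rightarrow> complex) \<Rightarrow> real" where
  "C_k_norm N \<phi> =
     (\<Sum>j\<le>N. \<Sum>k\<le>N - j. SUP z. norm ((partial_t ^^ j) ((partial_x ^^ k) \<phi>) z))"

text \<open>
  A distribution is a linear functional on the test functions that is continuous for the topology
  of the norms \<open>C_k_norm N\<close>. Its values outside \<open>test_functions\<close> carry no meaning, so
  equality of distributions is equality on \<open>test_functions\<close>.
\<close>

type_synonym functional = "(real \<times> real \<Rightarrow> complex) \<Rightarrow> complex"

definition distributions :: "functional set" where
  "distributions = {u.
     (\<forall>\<phi>\<in>test_functions. \<forall>\<psi>\<in>test_functions. u (\<lambda>z. \<phi> z + \<psi> z) = u \<phi> + u \<psi>) \<and>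
     (\<forall>c. \<forall>\<phi>\<in>test_functions. u (\<lambda>z. c * \<phi> z) = c * u \<phi>) \<and>
     (\<exists>C N. \<forall>\<phi>\<in>test_functions. norm (u \<phi>) \<le> C * C_k_norm N \<phi>)}"

definition dist_eq :: "functional \<Rightarrow> functional \<Rightarrow> bool" where
  "dist_eq u v \<longleftrightarrow> (\<forall>\<phi>\<in>test_functions. u \<phi> = v \<phi>)"

text \<open>
  The pairing is bilinear, without complex conjugation: a function \<open>g\<close> acts by
  \<open>\<phi> \<mapsto> \<integral> g \<phi> dt dx\<close>. Derivatives, products and Fourier coefficients of
  distributions are the transposes of the classical operations under this pairing.
\<close>

definition dist_of_fun :: "(real \<times> real \<Rightarrow> complex) \<Rightarrow> functional" where
  "dist_of_fun g \<phi> = integral (cbox (0, 0) (2 * pi, 2 * pi)) (\<lambda>z. g z * \<phi> z)"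

definition dist_dt :: "functional \<Rightarrow> functional" where
  "dist_dt u \<phi> = - u (partial_t \<phi>)"

definition dist_dx :: "functional \<Rightarrow> functional" where
  "dist_dx u \<phi> = - u (partial_x \<phi>)"

definition dist_mult :: "(real \<times> real \<Rightarrow> complex) \<Rightarrow> functional \<Rightarrow> functional" where
  "dist_mult g u \<phi> = u (\<lambda>z. g z * \<phi> z)"

definition dist_diff :: "functional \<Rightarrow> functional \<Rightarrow> functional" where
  "dist_diff u v \<phi> = u \<phi> - v \<phi>"

definition transport_op :: "(real \<Rightarrow> real) \<Rightarrow> functional \<Rightarrow> functional" where
  "transport_op a u =
     dist_diff (dist_dt u) (dist_mult (\<lambda>(t, x). complex_of_real (a t)) (dist_dx u))"

definition fourier_coeff :: "functional \<Rightarrow> int \<Rightarrow> int \<Rightarrow> complex" where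
  "fourier_coeff u \<tau> \<xi> =
     u (\<lambda>(t, x). exp (- \<i> * complex_of_real (t * of_int \<tau> + x * of_int \<xi>))) / complex_of_real ((2 * pi)\<^sup>2)"

definition minus_mean :: "functional \<Rightarrow> functional" where
  "minus_mean u = dist_diff u (dist_of_fun (\<lambda>_. fourier_coeff u 0 0))"

definition japanese_bracket :: "real \<Rightarrow> real" where
  "japanese_bracket w = sqrt (1 + \<bar>w\<bar>\<^sup>2)"

definition Hmix_term :: "real \<Rightarrow> real \<Rightarrow> functional \<Rightarrow> int \<times> int \<Rightarrow> real" where
  "Hmix_term s1 s2 f = (\<lambda>(\<tau>, \<xi>).
     japanese_bracket (of_int \<tau>) powr (2 * s1) * japanese_bracket (of_int \<xi>) powr (2 * s2) *
     (norm (fourier_coeff f \<tau> \<xi>))\<^sup>2)"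

definition Hmix :: "real \<Rightarrow> real \<Rightarrow> functional set" where
  "Hmix s1 s2 = {f \<in> distributions. Hmix_term s1 s2 f summable_on UNIV}"

text \<open>Meaningful on \<open>Hmix s1 s2\<close> only: \<open>infsum\<close> of a non-summable family is \<open>0\<close>.\<close>

definition Hmix_norm :: "real \<Rightarrow> real \<Rightarrow> functional \<Rightarrow> real" where
  "Hmix_norm s1 s2 f = sqrt (\<Sum>\<^sub>\<infinity>z\<in>UNIV. Hmix_term s1 s2 f z)"

definition irrationality_measure :: "real \<Rightarrow> ereal" where
  "irrationality_measure \<alpha> =
     Sup (ereal ` {\<nu>. \<nu> > 0 \<and>
       infinite {(p :: int, q :: nat). q > 0 \<and> \<bar>\<alpha> - of_int p / of_nat q\<bar> < of_nat q powr (- \<nu>)}})"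

end

theory Submission
  imports Defs
begin

text \<open>
  Let \<open>A\<close> be a periodic primitive of \<open>a - a\<^sub>0\<close>. The transpose of \<open>L\<close> maps the wave
  \<open>exp (i n A(t)) exp (i (m t + n x))\<close> to \<open>-i (m - n a\<^sub>0)\<close> times itself, so pairing \<open>L u = f\<close> with the
  waves turns the equation into a division by the small divisors \<open>m - n a\<^sub>0\<close>, whose size is controlled
  by the irrationality measure. It remains to compare pairings with waves and with exponentials.

  Each passage between the two is multiplication by \<open>exp (\<plusminus>i n A)\<close> in the variable \<open>t\<close>. With the joint
  weight \<open>(1 + n\<^sup>2 + m\<^sup>2) powr s\<close> it is bounded uniformly in \<open>n\<close>: for integer \<open>s \<ge> 0\<close> by the Leibniz rule, as
  each derivative of the exponential costs a factor \<open>n\<close>; for real \<open>s \<ge> 0\<close> by interpolation; for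
  \<open>s < 0\<close> by duality. Hence \<open>n\<close>-weights are lost only once, in exchanging the joint weight for a product
  weight, which costs \<open>\<bar>q\<bar>\<close> rather than \<open>2 \<bar>q\<bar>\<close>. The gain of \<open>\<theta>\<close> derivatives in \<open>t\<close> comes from
  \<open>\<bar>m\<bar> \<le> \<bar>m - n a\<^sub>0\<bar> + \<bar>n a\<^sub>0\<bar>\<close>, before returning from waves to exponentials.
\<close>

section \<open>Interpolation and duality for weighted matrix bounds\<close>

text \<open>Everything is estimated on one row, that is for a fixed x-frequency \<open>n\<close>,
  with constants independent of \<open>n\<close>. Weights in \<open>n\<close> are constant along a
  row, so the final constant does not see \<open>k2\<close>. Two elementary facts price the exchange
  of weights: the joint weight is at most the product of the brackets and at least the bracket in
  \<open>m\<close>. For either sign of \<open>q\<close>, therefore, one direction is free, and the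
  costs \<open>max q 0\<close> and \<open>max (-q) 0\<close> add up to \<open>\<bar>q\<bar>\<close>.
  Together with \<open>r - 1\<close> from the divisor bound and \<theta> from the gain this gives
  the row exponent \<open>r - 1 + \<theta> + \<bar>q\<bar>\<close>. The row \<open>n = 0\<close>
  carries no phase and its divisor is \<open>m\<close>; the mode \<open>(0, 0)\<close> has divisor
  zero and is invisible to the equation, hence \<open>minus_mean\<close>. Since \<open>u\<close> is
  an arbitrary distribution, no summability of its pairings with waves is known beforehand. The row
  estimates are therefore stated for finite sets of frequencies with an arbitrary bound
  \<open>S\<close>, and a change of basis is only a limit of symmetric partial sums, available
  because a distribution is continuous.\<close>

text \<open>\<open>C\<close> bounds the squared operator norm of \<open>M\<close> on the sequence
  space with weight \<open>w\<close>. Testing on finite \<open>K\<close> and \<open>L\<close> avoids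
  convergence questions: \<open>M\<close> need not be known to act on whole sequences.\<close>

definition weighted_bound :: "(int \<Rightarrow> int \<Rightarrow> complex) \<Rightarrow> (int \<Rightarrow> real) \<Rightarrow> real \<Rightarrow> bool" where
  "weighted_bound M w C \<longleftrightarrow> (\<forall>K L p. finite K \<longrightarrow> finite L \<longrightarrow>
     (\<Sum>k\<in>K. w k * (norm (\<Sum>m\<in>L. M k m * p m))\<^sup>2) \<le> C * (\<Sum>m\<in>L. w m * (norm (p m))\<^sup>2))"

lemma weighted_boundD:
  assumes "weighted_bound M w C" "finite K" "finite L"
  shows "(\<Sum>k\<in>K. w k * (norm (\<Sum>m\<in>L. M k m * p m))\<^sup>2) \<le> C * (\<Sum>m\<in>L. w m * (norm (p m))\<^sup>2)"
  using assms unfolding weighted_bound_def by blast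

lemma weighted_bound_mono:
  assumes "weighted_bound M w C" "C \<le> D" "\<And>k. w k \<ge> 0"
  shows "weighted_bound M w D"
  unfolding weighted_bound_def
proof (intro allI impI)
  fix K L :: "int set" and p :: "int \<Rightarrow> complex"
  assume fin: "finite K" "finite L"
  have "C * (\<Sum>m\<in>L. w m * (norm (p m))\<^sup>2) \<le> D * (\<Sum>m\<in>L. w m * (norm (p m))\<^sup>2)"
    using assms by (intro mult_right_mono sum_nonneg) auto
  with weighted_boundD[OF assms(1) fin, of p]
  show "(\<Sum>k\<in>K. w k * (norm (\<Sum>m\<in>L. M k m * p m))\<^sup>2) \<le> D * (\<Sum>m\<in>L. w m * (norm (p m))\<^sup>2)" by linarith
qed

lemma weighted_bound_cnj:
  assumes "weighted_bound M w C"
  shows "weighted_bound (\<lambda>k m. cnj (M k m)) w C"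
  unfolding weighted_bound_def
proof (intro allI impI)
  fix K L :: "int set" and p :: "int \<Rightarrow> complex"
  assume fin: "finite K" "finite L"
  have "norm (\<Sum>m\<in>L. cnj (M k m) * p m) = norm (\<Sum>m\<in>L. M k m * cnj (p m))" for k
    by (subst complex_mod_cnj[symmetric]) simp
  then show "(\<Sum>k\<in>K. w k * (norm (\<Sum>m\<in>L. cnj (M k m) * p m))\<^sup>2) \<le> C * (\<Sum>m\<in>L. w m * (norm (p m))\<^sup>2)"
    using weighted_boundD[OF assms fin, of "\<lambda>m. cnj (p m)"] by simp
qed

text \<open>The dual of the space with weight \<open>w\<close> is the space with weight
  \<open>1 / w\<close>, and a matrix and its transpose have the same norm. The transpose rather than
  the adjoint appears because the pairing with distributions is bilinear.\<close>

lemma weighted_bound_transpose: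
  assumes M: "weighted_bound M w C" and w: "\<And>k. w k > 0" and C: "C \<ge> 0"
  shows "weighted_bound (\<lambda>k m. M m k) (\<lambda>k. 1 / w k) C"
  unfolding weighted_bound_def
proof (intro allI impI)
  fix K L :: "int set" and p :: "int \<Rightarrow> complex"
  assume fin: "finite K" "finite L"
  define y where "y k = (\<Sum>m\<in>L. M m k * p m)" for k
  \<comment> \<open>The extremal dual vector: \<open>r k * y k\<close> and
    \<open>w k * (norm (r k))\<^sup>2\<close> both equal the \<open>k\<close>-th term of
    \<open>S\<close>, so \<open>S\<close> occurs on both sides of the estimate and one factor
    cancels.\<close>
  define r where "r k = cnj (y k) / complex_of_real (w k)" for k
  define z where "z m = (\<Sum>k\<in>K. M m k * r k)" for m
  define S where "S = (\<Sum>k\<in>K. 1 / w k * (norm (y k))\<^sup>2)"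
  define P where "P = (\<Sum>m\<in>L. 1 / w m * (norm (p m))\<^sup>2)"
  have S0: "S \<ge> 0" unfolding S_def using w by (intro sum_nonneg) (simp add: less_imp_le)
  have P0: "P \<ge> 0" unfolding P_def using w by (intro sum_nonneg) (simp add: less_imp_le)
  have "complex_of_real S = (\<Sum>k\<in>K. r k * y k)"
    unfolding S_def r_def of_real_sum
    by (intro sum.cong refl) (simp add: complex_norm_square[symmetric] mult.commute)
  also have "\<dots> = (\<Sum>k\<in>K. \<Sum>m\<in>L. p m * (M m k * r k))"
    unfolding y_def sum_distrib_left by (simp add: mult_ac)
  also have "\<dots> = (\<Sum>m\<in>L. p m * z m)"
    unfolding z_def sum_distrib_left by (rule sum.swap)
  finally have "S = norm (\<Sum>m\<in>L. p m * z m)"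
    using S0 by (metis abs_of_nonneg norm_of_real)
  also have "\<dots> \<le> (\<Sum>m\<in>L. norm (p m) * norm (z m))"
    by (rule order_trans[OF norm_sum]) (simp add: norm_mult)
  also have "\<dots> = (\<Sum>m\<in>L. (norm (p m) / sqrt (w m)) * (sqrt (w m) * norm (z m)))"
    using w by (intro sum.cong refl) (simp add: less_imp_neq[OF w, symmetric])
  finally have "S\<^sup>2 \<le> (\<Sum>m\<in>L. (norm (p m) / sqrt (w m)) * (sqrt (w m) * norm (z m)))\<^sup>2"
    using S0 by (intro power_mono) auto
  also have "\<dots> \<le> (\<Sum>m\<in>L. (norm (p m) / sqrt (w m))\<^sup>2) * (\<Sum>m\<in>L. (sqrt (w m) * norm (z m))\<^sup>2)"
    by (rule Cauchy_Schwarz_ineq_sum)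
  also have "\<dots> = P * (\<Sum>m\<in>L. w m * (norm (z m))\<^sup>2)"
    unfolding P_def using w by (simp add: power_divide power_mult_distrib less_imp_le)
  also have "\<dots> \<le> P * (C * (\<Sum>k\<in>K. w k * (norm (r k))\<^sup>2))"
    unfolding z_def using weighted_boundD[OF M fin(2,1), of r] P0 by (rule mult_left_mono)
  also have "(\<Sum>k\<in>K. w k * (norm (r k))\<^sup>2) = S"
    unfolding S_def r_def using w
    by (intro sum.cong refl) (simp add: norm_divide power_divide power2_eq_square less_imp_neq[OF w, symmetric] abs_of_pos)
  finally have "S * S \<le> (C * P) * S" by (simp add: power2_eq_square mult_ac)
  then have "S \<le> C * P"
    using S0 C P0 by (cases "S = 0") (auto simp: mult_le_cancel_right)
  then show "(\<Sum>k\<in>K. 1 / w k * (norm (\<Sum>m\<in>L. M m k * p m))\<^sup>2) \<le> C * (\<Sum>m\<in>L. 1 / w m * (norm (p m))\<^sup>2)"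
    by (simp add: S_def P_def y_def)
qed

text \<open>
  Integrating \<open>s powr (-\<theta>) * x / (1 + s * x)\<close> over \<open>s > 0\<close> gives a constant multiple of \<open>x powr \<theta>\<close>, by the
  substitution \<open>s \<mapsto> s / x\<close>.
\<close>

definition heinz_kernel :: "real \<Rightarrow> real \<Rightarrow> real \<Rightarrow> real" where
  "heinz_kernel \<theta> x s = indicator {0<..} s * (s powr (-\<theta>) * (x / (1 + s * x)))"

lemma heinz_kernel_measurable [measurable]: "heinz_kernel \<theta> x \<in> borel_measurable borel"
  unfolding heinz_kernel_def by measurable

text \<open>Domination by \<open>s powr (-\<theta>)\<close> near zero, integrable as \<theta> < 1,
  and by \<open>s powr (-\<theta>-1)\<close> at infinity, integrable as \<theta> > 0.\<close>

lemma integrable_heinz_kernel_1: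
  assumes "0 < \<theta>" "\<theta> < 1"
  shows "integrable lborel (heinz_kernel \<theta> 1)"
proof -
  have 1: "integrable lborel (\<lambda>s::real. indicator {0..1} s *\<^sub>R s powr (-\<theta>))"
  proof -
    have "(\<lambda>s. s powr (-\<theta>)) integrable_on {0..1::real}"
      using has_integral_powr_from_0[of "-\<theta>" 1] assms by (auto simp: integrable_on_def)
    then have "(\<lambda>s. s powr (-\<theta>)) absolutely_integrable_on {0..1::real}"
      by (subst absolutely_integrable_on_iff_nonneg) auto
    then show ?thesis unfolding set_integrable_def by (subst (asm) integrable_completion) auto
  qed
  have 2: "integrable lborel (\<lambda>s::real. indicator {1..} s *\<^sub>R s powr (-\<theta>-1))"
  proof -
    have "(\<lambda>s. s powr (-\<theta>-1)) integrable_on {1::real..}"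
      using has_integral_powr_to_inf[of "-\<theta>-1" 1] assms by (auto simp: integrable_on_def)
    then have "(\<lambda>s. s powr (-\<theta>-1)) absolutely_integrable_on {1::real..}"
      by (subst absolutely_integrable_on_iff_nonneg) auto
    then show ?thesis unfolding set_integrable_def by (subst (asm) integrable_completion) auto
  qed
  show ?thesis
  proof (rule Bochner_Integration.integrable_bound[OF Bochner_Integration.integrable_add[OF 1 2]])
    show "AE s in lborel. norm (heinz_kernel \<theta> 1 s) \<le> norm (indicator {0..1} s *\<^sub>R s powr (-\<theta>) + indicator {1..} s *\<^sub>R s powr (-\<theta>-1))"
    proof (rule AE_I2)
      fix s :: real
      consider "s \<le> 0" | "0 < s" "s \<le> 1" | "1 < s" by linarith
      then show "norm (heinz_kernel \<theta> 1 s) \<le> norm (indicator {0..1} s *\<^sub>R s powr (-\<theta>) + indicator {1..} s *\<^sub>R s powr (-\<theta>-1))"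
      proof cases
        case 1 then show ?thesis by (simp add: heinz_kernel_def)
      next
        case 2
        then have "s powr (-\<theta>) / (1 + s) \<le> s powr (-\<theta>)" by (simp add: field_simps)
        with 2 show ?thesis by (simp add: heinz_kernel_def indicator_def)
      next
        case 3
        then have "s powr (-\<theta>) / (1 + s) \<le> s powr (-\<theta>) / s" by (intro divide_left_mono) auto
        also have "\<dots> = s powr (-\<theta>-1)" using 3 by (simp add: powr_diff)
        finally show ?thesis using 3 by (simp add: heinz_kernel_def indicator_def)
      qed
    qed
  qed simp
qed

lemma heinz_kernel_integral:
  assumes "0 < \<theta>" "\<theta> < 1" "x > 0"
  shows "has_bochner_integral lborel (heinz_kernel \<theta> x) (x powr \<theta> * integral\<^sup>L lborel (heinz_kernel \<theta> 1))"
proof -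
  \<comment> \<open>The summand 0 is the translation part of the affine substitution rule applied
    below.\<close>
  have eq: "heinz_kernel \<theta> 1 (0 + x * s) = heinz_kernel \<theta> x s * x powr (-\<theta>-1)" for s
    using assms by (auto simp: heinz_kernel_def indicator_def zero_less_mult_iff powr_mult powr_diff mult_ac)
  have "has_bochner_integral lborel (heinz_kernel \<theta> 1) (integral\<^sup>L lborel (heinz_kernel \<theta> 1))"
    using integrable_heinz_kernel_1[OF assms(1,2)] by (rule has_bochner_integral_integrable)
  then have "has_bochner_integral lborel (\<lambda>s. heinz_kernel \<theta> x s * x powr (-\<theta>-1)) (integral\<^sup>L lborel (heinz_kernel \<theta> 1) /\<^sub>R \<bar>x\<bar>)"
    using lborel_has_bochner_integral_real_affine_iff[of x "heinz_kernel \<theta> 1" _ 0] assms eq by simp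
  then have "has_bochner_integral lborel (\<lambda>s. (heinz_kernel \<theta> x s * x powr (-\<theta>-1)) * x powr (\<theta>+1)) ((integral\<^sup>L lborel (heinz_kernel \<theta> 1) /\<^sub>R \<bar>x\<bar>) * x powr (\<theta>+1))"
    by (intro has_bochner_integral_mult_left)
  moreover have "(heinz_kernel \<theta> x s * x powr (-\<theta>-1)) * x powr (\<theta>+1) = heinz_kernel \<theta> x s" for s
    using assms by (simp add: mult.assoc powr_add[symmetric])
  moreover have "(integral\<^sup>L lborel (heinz_kernel \<theta> 1) /\<^sub>R \<bar>x\<bar>) * x powr (\<theta>+1) = x powr \<theta> * integral\<^sup>L lborel (heinz_kernel \<theta> 1)"
    using assms by (simp add: powr_add field_simps)
  ultimately show ?thesis by (simp only:)
qed

text \<open>Permits cancelling the constant of the integral representation at the end of the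
  interpolation. The integrand is at least 1/2 on (0, 1].\<close>

lemma heinz_kernel_integral_pos:
  assumes "0 < \<theta>" "\<theta> < 1"
  shows "integral\<^sup>L lborel (heinz_kernel \<theta> 1) > 0"
proof -
  have "(\<integral>s. indicator {0<..1::real} s * (1/2) \<partial>lborel) \<le> integral\<^sup>L lborel (heinz_kernel \<theta> 1)"
  proof (rule integral_mono_AE)
    show "integrable lborel (\<lambda>s::real. indicator {0<..1} s * (1/2::real))"
      by (intro integrable_mult_left integrable_real_indicator) auto
    show "AE s in lborel. indicator {0<..1} s * (1/2) \<le> heinz_kernel \<theta> 1 s"
    proof (rule AE_I2)
      fix s :: real
      show "indicator {0<..1} s * (1/2) \<le> heinz_kernel \<theta> 1 s"
      proof (cases "0 < s \<and> s \<le> 1")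
        case True
        have "1 \<le> s powr (-\<theta>)" using True assms powr_mono'[of "-\<theta>" 0 s] by simp
        then have "1/2 \<le> s powr (-\<theta>) / (1 + s)" using True by (simp add: field_simps)
        then show ?thesis using True by (simp add: heinz_kernel_def)
      next
        case False then show ?thesis by (auto simp: heinz_kernel_def indicator_def)
      qed
    qed
  qed (rule integrable_heinz_kernel_1[OF assms])
  then show ?thesis by simp
qed

text \<open>
  For each \<open>s > 0\<close> the weight \<open>w / (1 + s * w)\<close> is the infimum of \<open>\<bar>a\<bar>\<^sup>2 / s + w * \<bar>b\<bar>\<^sup>2\<close> over \<open>a + b = 1\<close>.
  Splitting a vector optimally therefore transfers the two endpoint bounds to this weight with the
  same constant, and the integral representation of \<open>w powr \<theta>\<close> does the rest.
\<close>

lemma weighted_bound_interpolate: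
  assumes M0: "weighted_bound M (\<lambda>_. 1) C" and M1: "weighted_bound M w C"
    and w: "\<And>k. w k > 0" and \<theta>: "0 < \<theta>" "\<theta> < 1"
  shows "weighted_bound M (\<lambda>k. w k powr \<theta>) C"
  unfolding weighted_bound_def
proof (intro allI impI)
  fix K L :: "int set" and p :: "int \<Rightarrow> complex"
  assume fin: "finite K" "finite L"
  define y where "y p k = (\<Sum>m\<in>L. M k m * p m)" for p k
  let ?J = "integral\<^sup>L lborel (heinz_kernel \<theta> 1)"
  have *: "(\<Sum>k\<in>K. w k / (1 + s * w k) * (norm (y p k))\<^sup>2) \<le> C * (\<Sum>m\<in>L. w m / (1 + s * w m) * (norm (p m))\<^sup>2)"
    if s: "s > 0" for s
  proof -
    define a where "a m = complex_of_real (s * w m / (1 + s * w m)) * p m" for m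
    define b where "b m = complex_of_real (1 / (1 + s * w m)) * p m" for m
    have pos: "1 + s * w k > 0" for k using s w[of k] by (simp add: add_pos_pos)
    have ab: "p m = a m + b m" for m
    proof -
      have "s * w m / (1 + s * w m) + 1 / (1 + s * w m) = 1" using pos[of m] by (simp add: field_simps)
      then show ?thesis unfolding a_def b_def by (metis mult_1 of_real_1 of_real_add distrib_right)
    qed
    have yab: "y p k = y a k + y b k" for k
      unfolding y_def by (simp add: ab sum.distrib distrib_left)
    \<comment> \<open>For the image only the easy half of the infimum is used, since
      \<open>y a + y b\<close> need not be an optimal splitting of \<open>y p\<close>; equality is
      needed for \<open>p\<close> alone.\<close>
    have pt: "w k / (1 + s * w k) * (norm (y p k))\<^sup>2 \<le> (1 / s) * (norm (y a k))\<^sup>2 + w k * (norm (y b k))\<^sup>2" for k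
    proof -
      let ?A = "norm (y a k)" and ?B = "norm (y b k)"
      have "(norm (y p k))\<^sup>2 \<le> (?A + ?B)\<^sup>2"
        unfolding yab by (intro power_mono norm_triangle_ineq) auto
      also have "\<dots> \<le> (1 + s * w k) * (?A\<^sup>2 / (s * w k) + ?B\<^sup>2)"
      proof -
        have "(1 + s * w k) * (?A\<^sup>2 / (s * w k) + ?B\<^sup>2) - (?A + ?B)\<^sup>2 = (?A - s * w k * ?B)\<^sup>2 / (s * w k)"
          using s w[of k] by (simp add: field_simps power2_eq_square)
        moreover have "\<dots> \<ge> 0" using s w[of k] by simp
        ultimately show ?thesis by linarith
      qed
      finally have "w k / (1 + s * w k) * (norm (y p k))\<^sup>2 \<le> w k / (1 + s * w k) * ((1 + s * w k) * (?A\<^sup>2 / (s * w k) + ?B\<^sup>2))"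
        using w[of k] pos[of k] by (intro mult_left_mono) auto
      also have "\<dots> = w k * (?A\<^sup>2 / (s * w k) + ?B\<^sup>2)" using pos[of k] by simp
      also have "\<dots> = (1 / s) * ?A\<^sup>2 + w k * ?B\<^sup>2" using w[of k] s by (simp add: field_simps)
      finally show ?thesis .
    qed
    have "(\<Sum>k\<in>K. w k / (1 + s * w k) * (norm (y p k))\<^sup>2) \<le> (1 / s) * (\<Sum>k\<in>K. 1 * (norm (y a k))\<^sup>2) + (\<Sum>k\<in>K. w k * (norm (y b k))\<^sup>2)"
      unfolding sum_distrib_left sum.distrib[symmetric] using pt by (intro sum_mono) simp
    also have "\<dots> \<le> (1 / s) * (C * (\<Sum>m\<in>L. 1 * (norm (a m))\<^sup>2)) + C * (\<Sum>m\<in>L. w m * (norm (b m))\<^sup>2)"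
      unfolding y_def using weighted_boundD[OF M0 fin, of a] weighted_boundD[OF M1 fin, of b] s
      by (intro add_mono mult_left_mono) auto
    also have "\<dots> = C * (\<Sum>m\<in>L. (1 / s) * (norm (a m))\<^sup>2 + w m * (norm (b m))\<^sup>2)"
      by (simp add: sum.distrib sum_distrib_left algebra_simps)
    also have "(\<Sum>m\<in>L. (1 / s) * (norm (a m))\<^sup>2 + w m * (norm (b m))\<^sup>2) = (\<Sum>m\<in>L. w m / (1 + s * w m) * (norm (p m))\<^sup>2)"
    proof (intro sum.cong refl)
      fix m
      define d where "d = 1 + s * w m"
      have d: "d > 0" "s * w m = d - 1" using pos[of m] by (simp_all add: d_def)
      have na: "norm (a m) = s * w m / d * norm (p m)" and nb: "norm (b m) = 1 / d * norm (p m)"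
        unfolding a_def b_def norm_mult norm_of_real d_def[symmetric] using d(1) s w[of m] by simp_all
      have "(1 / s) * (norm (a m))\<^sup>2 + w m * (norm (b m))\<^sup>2 = w m * (s * w m + 1) / d\<^sup>2 * (norm (p m))\<^sup>2"
        unfolding na nb using s d(1) by (simp add: field_simps power2_eq_square)
      also have "\<dots> = w m / d * (norm (p m))\<^sup>2" using d by (simp add: power2_eq_square)
      finally show "(1 / s) * (norm (a m))\<^sup>2 + w m * (norm (b m))\<^sup>2 = w m / (1 + s * w m) * (norm (p m))\<^sup>2"
        unfolding d_def .
    qed
    finally show ?thesis .
  qed
  have I: "has_bochner_integral lborel (\<lambda>s. \<Sum>k\<in>K. heinz_kernel \<theta> (w k) s * (norm (f k :: complex))\<^sup>2)
       (\<Sum>k\<in>K. w k powr \<theta> * ?J * (norm (f k))\<^sup>2)" for f K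
    by (intro has_bochner_integral_sum has_bochner_integral_mult_left heinz_kernel_integral \<theta> w)
  have "(\<Sum>k\<in>K. w k powr \<theta> * ?J * (norm (y p k))\<^sup>2) \<le> C * (\<Sum>m\<in>L. w m powr \<theta> * ?J * (norm (p m))\<^sup>2)"
    (is "?a \<le> C * ?b")
  proof -
    let ?f = "\<lambda>s. \<Sum>k\<in>K. heinz_kernel \<theta> (w k) s * (norm (y p k))\<^sup>2"
    let ?g = "\<lambda>s. C * (\<Sum>m\<in>L. heinz_kernel \<theta> (w m) s * (norm (p m))\<^sup>2)"
    have F: "has_bochner_integral lborel ?f ?a" by (rule I)
    have phase_factor: "has_bochner_integral lborel ?g (C * ?b)" by (intro has_bochner_integral_mult_right I)
    have "integral\<^sup>L lborel ?f \<le> integral\<^sup>L lborel ?g"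
    proof (rule integral_mono_AE)
      show "integrable lborel ?f" "integrable lborel ?g" by (rule integrable.intros[OF F], rule integrable.intros[OF phase_factor])
      show "AE s in lborel. ?f s \<le> ?g s"
      proof (rule AE_I2)
        fix s :: real
        show "(\<Sum>k\<in>K. heinz_kernel \<theta> (w k) s * (norm (y p k))\<^sup>2) \<le> C * (\<Sum>m\<in>L. heinz_kernel \<theta> (w m) s * (norm (p m))\<^sup>2)"
        proof (cases "s > 0")
          case True
          from mult_left_mono[OF *[OF True], of "s powr (-\<theta>)"] show ?thesis
            using True by (simp add: heinz_kernel_def sum_distrib_left mult_ac)
        qed (simp add: heinz_kernel_def)
      qed
    qed
    then show ?thesis
      unfolding has_bochner_integral_integral_eq[OF F] has_bochner_integral_integral_eq[OF phase_factor] .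
  qed
  then have "?J * (\<Sum>k\<in>K. w k powr \<theta> * (norm (y p k))\<^sup>2) \<le> ?J * (C * (\<Sum>m\<in>L. w m powr \<theta> * (norm (p m))\<^sup>2))"
    by (simp add: sum_distrib_left mult_ac)
  then show "(\<Sum>k\<in>K. w k powr \<theta> * (norm (\<Sum>m\<in>L. M k m * p m))\<^sup>2) \<le> C * (\<Sum>m\<in>L. w m powr \<theta> * (norm (p m))\<^sup>2)"
    unfolding y_def using heinz_kernel_integral_pos[OF \<theta>] by (simp add: mult_le_cancel_left)
qed

section \<open>Fourier series of smooth periodic functions\<close>

abbreviation character :: "int \<Rightarrow> real \<Rightarrow> complex" where
  "character m \<equiv> \<lambda>t. cis (of_int m * t)"

text \<open>Cut the interval from 0 to \<open>s + 2 * pi\<close> once at \<open>s\<close> and once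
  at \<open>2 * pi\<close>; the two end pieces of length \<open>s\<close> agree by periodicity and
  cancel.\<close>

lemma integral_periodic_shift_nonneg:
  fixes f :: "real \<Rightarrow> complex"
  assumes c: "continuous_on UNIV f" and p: "\<And>t. f (t + 2 * pi) = f t" and s: "0 \<le> s" 
  shows "integral {0..2 * pi} (\<lambda>t. f (t + s)) = integral {0..2 * pi} f"
proof -
  have int: "f integrable_on {a..b}" for a b
    using c by (intro integrable_continuous_interval) (auto intro: continuous_on_subset)
  have "integral {0..s} f + integral {s..s + 2 * pi} f = integral {0..s + 2 * pi} f"
    using s int by (intro Henstock_Kurzweil_Integration.integral_combine) auto
  moreover have "integral {0..2 * pi} f + integral {2 * pi..s + 2 * pi} f = integral {0..s + 2 * pi} f"
    using s int by (intro Henstock_Kurzweil_Integration.integral_combine) auto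
  moreover have "integral {2 * pi..s + 2 * pi} f = integral {0..s} f"
    using integral_shift_real_ivl[of "2 * pi" "2 * pi" "s + 2 * pi" f] p by simp
  moreover have "integral {s..s + 2 * pi} f = integral {0..2 * pi} (\<lambda>t. f (t + s))"
    using integral_shift_real_ivl[of s s "s + 2 * pi" f] by simp
  ultimately show ?thesis by (metis add.commute add_left_imp_eq)
qed

lemma integral_periodic_shift:
  fixes f :: "real \<Rightarrow> complex"
  assumes c: "continuous_on UNIV f" and p: "\<And>t. f (t + 2 * pi) = f t"
  shows "integral {0..2 * pi} (\<lambda>t. f (t + s)) = integral {0..2 * pi} f"
proof (cases "s \<ge> 0")
  case True then show ?thesis using integral_periodic_shift_nonneg[OF c p] by blast
next
  case False
  have "continuous_on UNIV (\<lambda>t. f (t + s))"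
    by (intro continuous_intros continuous_on_compose2[OF c]) auto
  moreover have "f (t + 2 * pi + s) = f (t + s)" for t using p[of "t + s"] by (simp add: add_ac)
  ultimately show ?thesis
    using integral_periodic_shift_nonneg[of "\<lambda>t. f (t + s)" "-s"] False by simp
qed

lemma has_vector_derivative_shift:
  fixes h :: "real \<Rightarrow> complex"
  assumes "(h has_vector_derivative D) (at (t + c))"
  shows "((\<lambda>t. h (t + c)) has_vector_derivative D) (at t)"
  using vector_diff_chain_at[OF has_vector_derivative_add[OF has_vector_derivative_id has_vector_derivative_const], of h D t c] assms
  by (simp add: o_def)

text \<open>In this form the difference quotients of two functions can be divided by each other,
  which evaluates a limit of type 0/0 below.\<close>

lemma has_vector_derivative_at_iff_tendsto_slope:
  "(f has_vector_derivative D) (at x) \<longleftrightarrow> ((\<lambda>t. (f t - f x) /\<^sub>R (t - x)) \<longlongrightarrow> D) (at x)"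
proof -
  have "(f has_vector_derivative D) (at x) \<longleftrightarrow> ((\<lambda>t. norm ((f t - f x) - (t - x) *\<^sub>R D) / norm (t - x)) \<longlongrightarrow> 0) (at x)"
    by (simp add: has_vector_derivative_def has_derivative_iff_norm bounded_linear_scaleR_left)
  also have "\<dots> \<longleftrightarrow> ((\<lambda>t. norm ((f t - f x) /\<^sub>R (t - x) - D)) \<longlongrightarrow> 0) (at x)"
  proof (rule filterlim_cong[OF refl refl])
    show "\<forall>\<^sub>F t in at x. norm ((f t - f x) - (t - x) *\<^sub>R D) / norm (t - x) = norm ((f t - f x) /\<^sub>R (t - x) - D)"
      unfolding eventually_at_filter
    proof (intro always_eventually allI impI)
      fix t assume t: "t \<noteq> x"
      then have "(f t - f x) /\<^sub>R (t - x) - D = ((f t - f x) - (t - x) *\<^sub>R D) /\<^sub>R (t - x)"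
        by (simp add: scaleR_diff_right)
      then show "norm ((f t - f x) - (t - x) *\<^sub>R D) / norm (t - x) = norm ((f t - f x) /\<^sub>R (t - x) - D)"
        by (simp add: divide_inverse_commute)
    qed
  qed
  also have "\<dots> \<longleftrightarrow> ((\<lambda>t. (f t - f x) /\<^sub>R (t - x)) \<longlongrightarrow> D) (at x)"
    by (simp add: tendsto_norm_zero_iff LIM_zero_iff)
  finally show ?thesis .
qed

section \<open>Fourier coefficients of continuous functions and Bessel's inequality\<close>

definition circle_coeff :: "(real \<Rightarrow> complex) \<Rightarrow> int \<Rightarrow> complex" where
  "circle_coeff h m = integral {0..2 * pi} (\<lambda>t. h t * character (-m) t) / (2 * pi)"

lemma integral_character: "integral {0..2 * pi} (character m) = (if m = 0 then 2 * pi else 0)"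
proof (cases "m = 0")
  case False
  have "((\<lambda>t. character m t) has_integral (character m (2 * pi) / (\<i> * of_int m) - character m 0 / (\<i> * of_int m))) {0..2 * pi}"
  proof (rule fundamental_theorem_of_calculus)
    fix t :: real
    show "((\<lambda>t. character m t / (\<i> * of_int m)) has_vector_derivative character m t) (at t within {0..2 * pi})"
      unfolding cis_conv_exp using False
      by (auto intro!: derivative_eq_intros has_vector_derivative_real_field simp: field_simps)
  qed simp
  moreover have "character m (2 * pi) = 1"
    using cis_multiple_2pi[of "of_int m"] by (simp add: mult_ac)
  ultimately show ?thesis using False by (simp add: integral_unique)
qed (simp add: scaleR_conv_of_real)

lemma integrable_circle_coeff:
  assumes "continuous_on {0..2 * pi} h"
  shows "(\<lambda>t. h t * character m t) integrable_on {0..2 * pi}"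
  using assms by (intro integrable_continuous_interval continuous_intros)

lemma circle_coeff_add:
  assumes "continuous_on {0..2 * pi} g" "continuous_on {0..2 * pi} h"
  shows "circle_coeff (\<lambda>t. g t + h t) m = circle_coeff g m + circle_coeff h m"
  unfolding circle_coeff_def using Henstock_Kurzweil_Integration.integral_add[OF integrable_circle_coeff[OF assms(1)] integrable_circle_coeff[OF assms(2)], of "-m" "-m"]
  by (simp add: distrib_right add_divide_distrib)

lemma circle_coeff_scale: "circle_coeff (\<lambda>t. c * h t) m = c * circle_coeff h m"
  unfolding circle_coeff_def by (simp add: mult.assoc)

lemma circle_coeff_sum:
  assumes "finite I" "\<And>i. i \<in> I \<Longrightarrow> continuous_on {0..2 * pi} (g i)"
  shows "circle_coeff (\<lambda>t. \<Sum>i\<in>I. g i t) m = (\<Sum>i\<in>I. circle_coeff (g i) m)"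
  using assms
proof (induction I rule: finite_induct)
  case empty then show ?case by (simp add: circle_coeff_def)
next
  case (insert i I)
  then show ?case by (simp add: circle_coeff_add continuous_on_sum)
qed

lemma circle_coeff_mult_character: "circle_coeff (\<lambda>t. h t * character k t) m = circle_coeff h (m - k)"
  unfolding circle_coeff_def by (simp add: mult.assoc cis_mult algebra_simps)

lemma circle_coeff_character: "circle_coeff (character k) m = (if k = m then 1 else 0)"
  unfolding circle_coeff_def using integral_character[of "k - m"] by (simp add: cis_mult left_diff_distrib)

text \<open>Kept as an identity for the mean square error, because it serves twice: nonnegativity of
  the left side is Bessel's inequality, and its vanishing in the limit is Parseval's
  identity.\<close>

lemma bessel_identity:
  assumes h: "continuous_on {0..2 * pi} h" and I: "finite I"
  shows "((\<lambda>t. (norm (h t - (\<Sum>m\<in>I. circle_coeff h m * character m t)))\<^sup>2) has_integral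
    integral {0..2 * pi} (\<lambda>t. (norm (h t))\<^sup>2) - 2 * pi * (\<Sum>m\<in>I. (norm (circle_coeff h m))\<^sup>2)) {0..2 * pi}"
proof -
  define p where "p t = (\<Sum>m\<in>I. circle_coeff h m * character m t)" for t
  have pc: "continuous_on {0..2 * pi} p" unfolding p_def by (intro continuous_intros)
  have fp: "circle_coeff p m = (if m \<in> I then circle_coeff h m else 0)" for m
    unfolding p_def using I by (simp add: circle_coeff_sum circle_coeff_scale circle_coeff_character continuous_intros if_distrib sum.delta cong: if_cong)
  \<comment> \<open>Applied with \<open>g = h\<close> and \<open>g = p\<close>. Both give the same
    value, so the cross term, counted with factor -2, and the square of \<open>p\<close> leave a
    single negative copy.\<close>
  have key: "integral {0..2 * pi} (\<lambda>t. g t * cnj (p t)) = 2 * pi * (\<Sum>m\<in>I. circle_coeff g m * cnj (circle_coeff h m))"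
    if "continuous_on {0..2 * pi} g" for g
  proof -
    have "(\<lambda>t. g t * cnj (p t)) = (\<lambda>t. \<Sum>m\<in>I. cnj (circle_coeff h m) * (g t * character (-m) t))"
      unfolding p_def by (simp add: sum_distrib_left cis_cnj mult_ac)
    then have "integral {0..2 * pi} (\<lambda>t. g t * cnj (p t)) = integral {0..2 * pi} (\<lambda>t. \<Sum>m\<in>I. cnj (circle_coeff h m) * (g t * character (-m) t))"
      by simp
    also have "\<dots> = (\<Sum>m\<in>I. integral {0..2 * pi} (\<lambda>t. cnj (circle_coeff h m) * (g t * character (-m) t)))"
      by (intro Henstock_Kurzweil_Integration.integral_sum I integrable_on_mult_right integrable_circle_coeff that)
    also have "\<dots> = (\<Sum>m\<in>I. 2 * pi * (circle_coeff g m * cnj (circle_coeff h m)))"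
    proof (intro sum.cong refl)
      fix m
      have "integral {0..2 * pi} (\<lambda>t. g t * character (-m) t) = 2 * pi * circle_coeff g m" by (simp add: circle_coeff_def)
      then show "integral {0..2 * pi} (\<lambda>t. cnj (circle_coeff h m) * (g t * character (-m) t)) = 2 * pi * (circle_coeff g m * cnj (circle_coeff h m))"
        by (simp only: integral_mult_right) (simp add: mult_ac)
    qed
    finally show ?thesis by (simp add: sum_distrib_left)
  qed
  have nsq: "(norm z)\<^sup>2 = Re (z * cnj z)" for z by (simp add: complex_norm_square[symmetric])
  define S where "S = (\<Sum>m\<in>I. (norm (circle_coeff h m))\<^sup>2)"
  have S: "(\<Sum>m\<in>I. circle_coeff h m * cnj (circle_coeff h m)) = complex_of_real S"
    unfolding S_def by (simp add: complex_norm_square[symmetric])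
  have i: "(\<lambda>t. f t * cnj (g t)) integrable_on {0..2 * pi}" if "continuous_on {0..2 * pi} f" "continuous_on {0..2 * pi} g" for f g :: "real \<Rightarrow> complex"
    using that by (intro integrable_continuous_interval continuous_intros)
  have "((\<lambda>t. (norm (h t))\<^sup>2 - 2 * Re (h t * cnj (p t)) + Re (p t * cnj (p t))) has_integral
      integral {0..2 * pi} (\<lambda>t. (norm (h t))\<^sup>2) - 2 * Re (integral {0..2 * pi} (\<lambda>t. h t * cnj (p t)))
        + Re (integral {0..2 * pi} (\<lambda>t. p t * cnj (p t)))) {0..2 * pi}"
    by (intro has_integral_add has_integral_diff has_integral_mult_right has_integral_Re integrable_integral
          i[OF h pc] i[OF pc pc] integrable_continuous_interval continuous_intros h)
  moreover have "(norm (h t - p t))\<^sup>2 = (norm (h t))\<^sup>2 - 2 * Re (h t * cnj (p t)) + Re (p t * cnj (p t))" for t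
    unfolding nsq by (simp add: algebra_simps)
  ultimately have "((\<lambda>t. (norm (h t - p t))\<^sup>2) has_integral
      integral {0..2 * pi} (\<lambda>t. (norm (h t))\<^sup>2) - 2 * Re (integral {0..2 * pi} (\<lambda>t. h t * cnj (p t)))
        + Re (integral {0..2 * pi} (\<lambda>t. p t * cnj (p t)))) {0..2 * pi}" by simp
  moreover have "integral {0..2 * pi} (\<lambda>t. (norm (h t))\<^sup>2) - 2 * Re (integral {0..2 * pi} (\<lambda>t. h t * cnj (p t)))
        + Re (integral {0..2 * pi} (\<lambda>t. p t * cnj (p t))) = integral {0..2 * pi} (\<lambda>t. (norm (h t))\<^sup>2) - 2 * pi * S"
    unfolding key[OF h] key[OF pc] fp using S by simp
  ultimately show ?thesis unfolding S_def p_def by (simp only:)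
qed

lemma bessel:
  assumes h: "continuous_on {0..2 * pi} h" and I: "finite I"
  shows "(\<Sum>m\<in>I. (norm (circle_coeff h m))\<^sup>2) \<le> integral {0..2 * pi} (\<lambda>t. (norm (h t))\<^sup>2) / (2 * pi)"
  using has_integral_nonneg[OF bessel_identity[OF assms]] by (simp add: field_simps)

text \<open>The Riemann-Lebesgue lemma from Bessel's inequality. Injectivity of the frequency
  sequence turns its partial sums into sums over finite sets of frequencies.\<close>

lemma circle_coeff_tendsto_0:
  assumes h: "continuous_on {0..2 * pi} h" and inj: "inj (\<phi> :: nat \<Rightarrow> int)"
  shows "(\<lambda>M. circle_coeff h (\<phi> M)) \<longlonglongrightarrow> 0"
proof -
  have "summable (\<lambda>M. (norm (circle_coeff h (\<phi> M)))\<^sup>2)"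
  proof (rule summableI_nonneg_bounded)
    fix n
    have "(\<Sum>M<n. (norm (circle_coeff h (\<phi> M)))\<^sup>2) = (\<Sum>m\<in>\<phi> ` {..<n}. (norm (circle_coeff h m))\<^sup>2)"
      using inj by (subst sum.reindex) (auto intro: inj_on_subset)
    also have "\<dots> \<le> integral {0..2 * pi} (\<lambda>t. (norm (h t))\<^sup>2) / (2 * pi)"
      by (intro bessel h) auto
    finally show "(\<Sum>M<n. (norm (circle_coeff h (\<phi> M)))\<^sup>2) \<le> integral {0..2 * pi} (\<lambda>t. (norm (h t))\<^sup>2) / (2 * pi)" .
  qed simp
  from summable_LIMSEQ_zero[OF this] have "(\<lambda>M. sqrt ((norm (circle_coeff h (\<phi> M)))\<^sup>2)) \<longlonglongrightarrow> sqrt 0"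
    by (rule tendsto_real_sqrt)
  then show ?thesis by (simp add: tendsto_norm_zero_iff)
qed

section \<open>Pointwise convergence of symmetric partial sums\<close>

definition fourier_sum :: "(real \<Rightarrow> complex) \<Rightarrow> nat \<Rightarrow> real \<Rightarrow> complex" where
  "fourier_sum h M t = (\<Sum>m\<in>{-int M..int M}. circle_coeff h m * character m t)"

lemma sum_int_telescope:
  fixes c :: "int \<Rightarrow> complex"
  shows "(\<Sum>m\<in>{-int M..int M}. c (m - 1) - c m) = c (-int M - 1) - c (int M)"
proof (induction M)
  case (Suc M)
  have "{-int (Suc M)..int (Suc M)} = insert (-int (Suc M)) (insert (int (Suc M)) {-int M..int M})" by auto
  then show ?case using Suc by (simp add: algebra_simps minus_diff_commute)
qed simp

lemma character_has_vderiv: "(character m has_vector_derivative \<i> * of_int m * character m t) (at t)"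
  unfolding cis_conv_exp by (auto intro!: derivative_eq_intros has_vector_derivative_real_field simp: mult_ac)

text \<open>
  Writing \<open>h t - h 0 = (cis t - 1) * g t\<close> with \<open>g\<close> continuous makes the symmetric partial sums
  telescope into two coefficients of \<open>g\<close>, which vanish in the limit by Bessel's inequality.
\<close>

lemma fourier_sum_tendsto_at_0:
  assumes h: "\<And>t. (h has_vector_derivative h' t) (at t)" and p: "\<And>t. h (t + 2 * pi) = h t"
  shows "(\<lambda>M. fourier_sum h M 0) \<longlonglongrightarrow> h 0"
proof -
  \<comment> \<open>Both endpoints are zeros of \<open>cis t - 1\<close>. There \<open>cis\<close>
    has derivative \<i> and \<open>h\<close> has derivative \<open>h' 0\<close>, so the values
    prescribed are the limits of the quotient.\<close>
  define g where "g t = (if t = 0 \<or> t = 2 * pi then h' 0 / \<i> else (h t - h 0) / (cis t - 1))" for t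
  have h2: "h (2 * pi) = h 0" using p[of 0] by simp
  have cis1: "cis t = 1 \<longleftrightarrow> t = 0 \<or> t = 2 * pi" if "t \<in> {0..2*pi}" for t
  proof
    assume "cis t = 1"
    then have "cos t = 1" by (metis cis.sel(1) one_complex.sel(1))
    then obtain n :: int where n: "t = of_int n * (2 * pi)" unfolding cos_one_2pi_int by auto
    then have "0 \<le> real_of_int n" "real_of_int n \<le> 1" using that pi_gt_zero by (auto simp: zero_le_mult_iff mult_le_cancel_right2 simp del: pi_gt_zero)
    then have "n = 0 \<or> n = 1" by linarith
    with n show "t = 0 \<or> t = 2 * pi" by auto
  qed auto
  have hc: "continuous_on A h" for A
    using h by (meson continuous_at_imp_continuous_on has_vector_derivative_continuous)
  \<comment> \<open>Both difference quotients at \<open>t0\<close> converge, and the common factor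
    \<open>t - t0\<close> cancels in their ratio.\<close>
  have quot: "((\<lambda>t. (h t - h 0) / (cis t - 1)) \<longlongrightarrow> D / \<i>) (at t0)"
    if "h t0 = h 0" "cis t0 = 1" "(h has_vector_derivative D) (at t0)" for t0 D
  proof -
    have "((\<lambda>t. (h t - h 0) /\<^sub>R (t - t0)) \<longlongrightarrow> D) (at t0)"
      using that by (simp add: has_vector_derivative_at_iff_tendsto_slope that(1))
    moreover have "((\<lambda>t. cis t) has_vector_derivative \<i> * cis t0) (at t0)"
      unfolding cis_conv_exp by (auto intro!: derivative_eq_intros has_vector_derivative_real_field)
    then have "((\<lambda>t. (cis t - 1) /\<^sub>R (t - t0)) \<longlongrightarrow> \<i>) (at t0)"
      using that by (simp add: has_vector_derivative_at_iff_tendsto_slope that(2))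
    ultimately have "((\<lambda>t. ((h t - h 0) /\<^sub>R (t - t0)) / ((cis t - 1) /\<^sub>R (t - t0))) \<longlongrightarrow> D / \<i>) (at t0)"
      by (rule tendsto_divide) simp
    then show ?thesis
      by (rule Lim_transform_eventually) (auto simp: eventually_at_filter scaleR_conv_of_real)
  qed

  have D2: "(h has_vector_derivative h' 0) (at (2 * pi))"
  proof -
    have "((\<lambda>t. h (t - 2 * pi)) has_vector_derivative h' 0) (at (2 * pi))"
      using has_vector_derivative_shift[of h "h' 0" "2 * pi" "- 2 * pi"] h[of 0] by simp
    moreover have "h (t - 2 * pi) = h t" for t using p[of "t - 2 * pi"] by simp
    ultimately show ?thesis by simp
  qed
  have gc: "continuous_on {0..2 * pi} g"
    unfolding continuous_on_eq_continuous_within continuous_within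
  proof
    fix t0 assume t0: "t0 \<in> {0..2 * pi}"
    have "((\<lambda>t. (h t - h 0) / (cis t - 1)) \<longlongrightarrow> g t0) (at t0)"
    proof (cases "t0 = 0 \<or> t0 = 2 * pi")
      case True
      then show ?thesis using quot[of t0 "h' 0"] h[of 0] D2 h2 by (auto simp: g_def)
    next
      case False
      then have "cis t0 - 1 \<noteq> 0" using cis1[OF t0] by auto
      moreover have "isCont h t0" using h has_vector_derivative_continuous by blast
      moreover have "isCont cis t0"
        using has_vector_derivative_continuous[of "character 1"] character_has_vderiv[of 1 t0] by auto
      ultimately have "isCont (\<lambda>t. (h t - h 0) / (cis t - 1)) t0" by (intro continuous_intros) auto
      then show ?thesis using False by (simp add: isCont_def g_def)
    qed
    then have "((\<lambda>t. (h t - h 0) / (cis t - 1)) \<longlongrightarrow> g t0) (at t0 within {0..2 * pi})"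
      by (rule tendsto_within_subset) simp
    moreover have "\<forall>\<^sub>F t in at t0 within {0..2 * pi}. (h t - h 0) / (cis t - 1) = g t"
      using eventually_neq_at_within[of 0 t0 "{0..2 * pi}"] eventually_neq_at_within[of "2 * pi" t0 "{0..2 * pi}"]
      by eventually_elim (simp add: g_def)
    ultimately show "(g \<longlongrightarrow> g t0) (at t0 within {0..2 * pi})" by (rule Lim_transform_eventually)
  qed
  have hg: "h t = h 0 * character 0 t + (g t * character 1 t + (-1) * g t)" if "t \<in> {0..2 * pi}" for t
  proof (cases "t = 0 \<or> t = 2 * pi")
    case True then show ?thesis using h2 cis1[OF that] by auto
  next
    case False
    then have "cis t - 1 \<noteq> 0" using cis1[OF that] by auto
    then have "g t * (cis t - 1) = h t - h 0" using False by (simp add: g_def)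
    then show ?thesis by (simp add: algebra_simps)
  qed
  have fch: "circle_coeff h m = (if m = 0 then h 0 else 0) + (circle_coeff g (m - 1) - circle_coeff g m)" for m
  proof -
    have "circle_coeff h m = circle_coeff (\<lambda>t. h 0 * character 0 t + (g t * character 1 t + (-1) * g t)) m"
    proof -
      have "integral {0..2 * pi} (\<lambda>t. h t * character (-m) t) = integral {0..2 * pi} (\<lambda>t. (h 0 * character 0 t + (g t * character 1 t + (-1) * g t)) * character (-m) t)"
        by (rule integral_cong) (simp only: hg)
      then show ?thesis unfolding circle_coeff_def by (rule arg_cong)
    qed
    also have "\<dots> = h 0 * circle_coeff (character 0) m + (circle_coeff (\<lambda>t. g t * character 1 t) m + (-1) * circle_coeff g m)"
    proof -
      have c: "continuous_on {0..2 * pi} (\<lambda>t. h 0 * character 0 t)" "continuous_on {0..2 * pi} (\<lambda>t. g t * character 1 t)"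
        "continuous_on {0..2 * pi} (\<lambda>t. (-1) * g t)" "continuous_on {0..2 * pi} (\<lambda>t. g t * character 1 t + (-1) * g t)"
        by (intro continuous_intros gc)+
      show ?thesis unfolding circle_coeff_add[OF c(1,4)] circle_coeff_add[OF c(2,3)] circle_coeff_scale ..
    qed
    finally show ?thesis unfolding circle_coeff_mult_character circle_coeff_character by auto
  qed
  have "fourier_sum h M 0 = h 0 + (circle_coeff g (-int M - 1) - circle_coeff g (int M))" for M
    by (simp add: fourier_sum_def fch sum.distrib sum_int_telescope[of "circle_coeff g" M])
  moreover have "(\<lambda>M. circle_coeff g (-int M - 1)) \<longlonglongrightarrow> 0" "(\<lambda>M. circle_coeff g (int M)) \<longlonglongrightarrow> 0"
    by (intro circle_coeff_tendsto_0 gc injI; simp)+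
  then have "(\<lambda>M. h 0 + (circle_coeff g (-int M - 1) - circle_coeff g (int M))) \<longlonglongrightarrow> h 0 + (0 - 0)"
    by (intro tendsto_intros)
  ultimately show ?thesis by simp
qed

text \<open>Translation moves the point to 0: shifting \<open>h\<close> by \<open>s\<close>
  multiplies its \<open>m\<close>-th coefficient by \<open>character m s\<close>, so the partial sum
  of the shifted function at 0 is that of \<open>h\<close> at \<open>s\<close>.\<close>

lemma fourier_sum_tendsto:
  assumes h: "\<And>t. (h has_vector_derivative h' t) (at t)" and p: "\<And>t. h (t + 2 * pi) = h t"
  shows "(\<lambda>M. fourier_sum h M s) \<longlonglongrightarrow> h s"
proof -
  have hc: "continuous_on A h" for A
    using h by (meson continuous_at_imp_continuous_on has_vector_derivative_continuous)
  have character_per: "character k (t + 2 * pi) = character k t" for k t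
    using cis_multiple_2pi[of "of_int k"] by (simp add: distrib_left cis_mult[symmetric] mult_ac)
  have "circle_coeff (\<lambda>t. h (t + s)) m = character m s * circle_coeff h m" for m
  proof -
    have "(\<lambda>t. h (t + s) * character (-m) t) = (\<lambda>t. character m s * (h (t + s) * character (-m) (t + s)))"
      by (auto simp: cis_mult algebra_simps)
    then have "integral {0..2 * pi} (\<lambda>t. h (t + s) * character (-m) t) = character m s * integral {0..2 * pi} (\<lambda>t. h (t + s) * character (-m) (t + s))"
      by simp
    also have "\<dots> = character m s * integral {0..2 * pi} (\<lambda>t. h t * character (-m) t)"
      using p character_per[of "-m"] by (subst integral_periodic_shift[of "\<lambda>t. h t * character (-m) t"]) (auto intro!: continuous_intros hc)
    finally show ?thesis unfolding circle_coeff_def by simp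
  qed
  then have "fourier_sum (\<lambda>t. h (t + s)) M 0 = fourier_sum h M s" for M
    unfolding fourier_sum_def by (simp add: mult.commute)
  moreover have "((\<lambda>t. h (t + s)) has_vector_derivative h' (t + s)) (at t)" for t
    by (rule has_vector_derivative_shift[OF h])
  moreover have "h (t + 2 * pi + s) = h (t + s)" for t using p[of "t + s"] by (simp add: add_ac)
  ultimately show ?thesis
    using fourier_sum_tendsto_at_0[of "\<lambda>t. h (t + s)" "\<lambda>t. h' (t + s)"] by simp
qed

section \<open>Smooth periodic functions and their derivatives\<close>

text \<open>The derivative is existentially quantified, so closure properties are proved by
  exhibiting one instead of computing a chosen derivative.\<close>

fun C_order :: "nat \<Rightarrow> (real \<Rightarrow> complex) \<Rightarrow> bool" where
  "C_order 0 h \<longleftrightarrow> continuous_on UNIV h"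
| "C_order (Suc k) h \<longleftrightarrow> (\<exists>h'. (\<forall>t. (h has_vector_derivative h' t) (at t)) \<and> C_order k h')"

definition vderiv :: "(real \<Rightarrow> complex) \<Rightarrow> real \<Rightarrow> complex" where
  "vderiv h t = vector_derivative h (at t)"

lemma vderiv_eq: "(\<And>t. (h has_vector_derivative h' t) (at t)) \<Longrightarrow> vderiv h = h'"
  unfolding vderiv_def by (auto intro: vector_derivative_at)

lemma C_order_SucI: "(\<And>t. (h has_vector_derivative h' t) (at t)) \<Longrightarrow> C_order k h' \<Longrightarrow> C_order (Suc k) h"
  by auto

lemma C_order_Suc_vderiv:
  assumes "C_order (Suc k) h"
  shows "(h has_vector_derivative vderiv h t) (at t)" "C_order k (vderiv h)"
proof -
  obtain h' where h': "\<And>t. (h has_vector_derivative h' t) (at t)" "C_order k h'" using assms by auto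
  from vderiv_eq[OF h'(1)] h' show "(h has_vector_derivative vderiv h t) (at t)" "C_order k (vderiv h)" by auto
qed

lemma C_order_mono: "C_order (Suc k) h \<Longrightarrow> C_order k h"
proof (induction k arbitrary: h)
  case 0
  then have "(h has_vector_derivative vderiv h t) (at t)" for t by (rule C_order_Suc_vderiv)
  then show ?case
    by (auto intro!: continuous_at_imp_continuous_on has_vector_derivative_continuous)
next
  case (Suc k)
  from C_order_Suc_vderiv[OF Suc.prems] Suc.IH show ?case by (intro C_order_SucI[of h "vderiv h"]) auto
qed

lemma C_order_const: "C_order k (\<lambda>_. c)"
proof (induction k arbitrary: c)
  case (Suc k)
  show ?case by (rule C_order_SucI[OF _ Suc.IH[of 0]]) simp
qed simp

lemma C_order_add: "C_order k g \<Longrightarrow> C_order k h \<Longrightarrow> C_order k (\<lambda>t. g t + h t)"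
proof (induction k arbitrary: g h)
  case (Suc k)
  show ?case
    by (rule C_order_SucI[of _ "\<lambda>t. vderiv g t + vderiv h t"])
       (use C_order_Suc_vderiv[OF Suc.prems(1)] C_order_Suc_vderiv[OF Suc.prems(2)] Suc.IH in \<open>auto intro: has_vector_derivative_add\<close>)
qed (auto intro: continuous_intros)

lemma C_order_mult: "C_order k g \<Longrightarrow> C_order k h \<Longrightarrow> C_order k (\<lambda>t. g t * h t)"
proof (induction k arbitrary: g h)
  case (Suc k)
  note g = C_order_Suc_vderiv[OF Suc.prems(1)] and h = C_order_Suc_vderiv[OF Suc.prems(2)]
  show ?case
    by (rule C_order_SucI[of _ "\<lambda>t. g t * vderiv h t + vderiv g t * h t", OF has_vector_derivative_mult[OF g(1) h(1)]])
       (rule C_order_add[OF Suc.IH[OF C_order_mono[OF Suc.prems(1)] h(2)] Suc.IH[OF g(2) C_order_mono[OF Suc.prems(2)]]])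
qed (auto intro: continuous_intros)

text \<open>Bootstrapping: regularity of \<open>h\<close> passes to \<open>b * h\<close>, hence to
  the derivative of \<open>h\<close>. Characters and phase factors are both obtained as solutions of
  such an equation.\<close>

lemma C_order_ode:
  assumes "\<And>t. (h has_vector_derivative b t * h t) (at t)" "\<And>k. C_order k b"
  shows "C_order k h"
proof (induction k)
  case 0
  show ?case using assms(1)
    by (auto intro!: continuous_at_imp_continuous_on has_vector_derivative_continuous)
next
  case (Suc k)
  show ?case by (rule C_order_SucI[OF assms(1) C_order_mult[OF assms(2) Suc]])
qed

definition smooth_periodic :: "(real \<Rightarrow> complex) \<Rightarrow> bool" where
  "smooth_periodic h \<longleftrightarrow> (\<forall>k. C_order k h) \<and> (\<forall>t. h (t + 2 * pi) = h t)"

lemma smooth_periodic_has_vderiv: "smooth_periodic h \<Longrightarrow> (h has_vector_derivative vderiv h t) (at t)"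
  unfolding smooth_periodic_def using C_order_Suc_vderiv(1) by blast

lemma smooth_periodic_continuous: "smooth_periodic h \<Longrightarrow> continuous_on A h"
  unfolding smooth_periodic_def using continuous_on_subset by (metis C_order.simps(1) subset_UNIV)

lemma smooth_periodic_periodic: "smooth_periodic h \<Longrightarrow> h (t + 2 * pi) = h t" unfolding smooth_periodic_def by blast

lemma smooth_periodic_vderiv: 
  assumes h: "smooth_periodic h" shows "smooth_periodic (vderiv h)"
proof -
  have "C_order k (vderiv h)" for k using h C_order_Suc_vderiv(2) unfolding smooth_periodic_def by blast
  moreover have "vderiv h (t + 2 * pi) = vderiv h t" for t
  proof -
    have "((\<lambda>t. h (t + 2 * pi)) has_vector_derivative vderiv h (t + 2 * pi)) (at t)"
      by (rule has_vector_derivative_shift[OF smooth_periodic_has_vderiv[OF h]])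
    then show ?thesis using smooth_periodic_periodic[OF h] smooth_periodic_has_vderiv[OF h, of t] by (simp add: vector_derivative_unique_at)
  qed
  ultimately show ?thesis unfolding smooth_periodic_def by blast
qed

lemma smooth_periodic_const: "smooth_periodic (\<lambda>_. c)" unfolding smooth_periodic_def by (auto intro: C_order_const)

lemma smooth_periodic_add: "smooth_periodic g \<Longrightarrow> smooth_periodic h \<Longrightarrow> smooth_periodic (\<lambda>t. g t + h t)"
  unfolding smooth_periodic_def by (auto intro: C_order_add)

lemma smooth_periodic_mult: "smooth_periodic g \<Longrightarrow> smooth_periodic h \<Longrightarrow> smooth_periodic (\<lambda>t. g t * h t)"
  unfolding smooth_periodic_def by (auto intro: C_order_mult)

lemma smooth_periodic_sum: "(\<And>i. i \<in> I \<Longrightarrow> smooth_periodic (g i)) \<Longrightarrow> smooth_periodic (\<lambda>t. \<Sum>i\<in>I. g i t)"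
  by (induction I rule: infinite_finite_induct) (auto intro: smooth_periodic_add smooth_periodic_const)

lemma smooth_periodic_character: "smooth_periodic (character m)"
  unfolding smooth_periodic_def using C_order_ode[OF character_has_vderiv C_order_const] cis_multiple_2pi[of "of_int m"]
  by (simp add: distrib_left cis_mult[symmetric] mult_ac)

lemma vderiv_add: "smooth_periodic g \<Longrightarrow> smooth_periodic h \<Longrightarrow> vderiv (\<lambda>t. g t + h t) = (\<lambda>t. vderiv g t + vderiv h t)"
  by (intro vderiv_eq has_vector_derivative_add smooth_periodic_has_vderiv)

lemma vderiv_mult: "smooth_periodic g \<Longrightarrow> smooth_periodic h \<Longrightarrow> vderiv (\<lambda>t. g t * h t) = (\<lambda>t. g t * vderiv h t + vderiv g t * h t)"
  by (intro vderiv_eq has_vector_derivative_mult smooth_periodic_has_vderiv)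

lemma vderiv_const: "vderiv (\<lambda>_. c) = (\<lambda>_. 0)" by (intro vderiv_eq) simp

lemma vderiv_cmult: "smooth_periodic h \<Longrightarrow> vderiv (\<lambda>t. c * h t) = (\<lambda>t. c * vderiv h t)"
  by (simp add: vderiv_mult smooth_periodic_const vderiv_const)

lemma vderiv_character: "vderiv (character m) = (\<lambda>t. \<i> * of_int m * character m t)"
  by (intro vderiv_eq character_has_vderiv)

lemma vderiv_sum: "(\<And>i. i \<in> I \<Longrightarrow> smooth_periodic (g i)) \<Longrightarrow> vderiv (\<lambda>t. \<Sum>i\<in>I. g i t) = (\<lambda>t. \<Sum>i\<in>I. vderiv (g i) t)"
  by (induction I rule: infinite_finite_induct) (auto simp: vderiv_const vderiv_add smooth_periodic_sum)

text \<open>Integration by parts; the boundary terms cancel by periodicity.\<close>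

lemma circle_coeff_vderiv:
  assumes h: "smooth_periodic h"
  shows "circle_coeff (vderiv h) m = \<i> * of_int m * circle_coeff h m"
proof -
  let ?g = "\<lambda>t. h t * character (-m) t"
  have "((\<lambda>t. h t * (\<i> * of_int (-m) * character (-m) t) + vderiv h t * character (-m) t) has_integral ?g (2 * pi) - ?g 0) {0..2 * pi}"
    by (intro fundamental_theorem_of_calculus has_vector_derivative_at_within[OF has_vector_derivative_mult] smooth_periodic_has_vderiv h character_has_vderiv) auto
  moreover have "?g (2 * pi) = ?g 0"
    using smooth_periodic_periodic[OF smooth_periodic_mult[OF h smooth_periodic_character[of "-m"]], of 0] by simp
  ultimately have "((\<lambda>t. h t * (\<i> * of_int (-m) * character (-m) t) + vderiv h t * character (-m) t) has_integral 0) {0..2 * pi}" by simp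
  moreover have "((\<lambda>t. h t * character (-m) t) has_integral (2 * pi * circle_coeff h m)) {0..2 * pi}"
    unfolding circle_coeff_def using integrable_integral[OF integrable_circle_coeff[OF smooth_periodic_continuous[OF h], of "-m"]] by simp
  then have "((\<lambda>t. (\<i> * of_int m) * (h t * character (-m) t)) has_integral ((\<i> * of_int m) * (2 * pi * circle_coeff h m))) {0..2 * pi}"
    by (rule has_integral_mult_right)
  ultimately have "((\<lambda>t. h t * (\<i> * of_int (-m) * character (-m) t) + vderiv h t * character (-m) t + (\<i> * of_int m) * (h t * character (-m) t)) has_integral (0 + \<i> * of_int m * (2 * pi * circle_coeff h m))) {0..2 * pi}"
    by (rule has_integral_add)
  moreover have "h t * (\<i> * of_int (-m) * character (-m) t) + vderiv h t * character (-m) t + (\<i> * of_int m) * (h t * character (-m) t) = vderiv h t * character (-m) t" for t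
    by simp
  ultimately have "((\<lambda>t. vderiv h t * character (-m) t) has_integral (\<i> * of_int m * (2 * pi * circle_coeff h m))) {0..2 * pi}"
    by (simp only: add_0)
  then show ?thesis unfolding circle_coeff_def by (simp add: integral_unique field_simps)
qed

section \<open>Uniform convergence of Fourier series\<close>

lemma periodic_int:
  assumes "\<And>t. f (t + 2 * pi) = f t"
  shows "f (t + of_int k * (2 * pi)) = f t"
proof (induction k rule: int_induct[where k=0])
  case (step1 i) then show ?case using assms[of "t + of_int i * (2 * pi)"] by (simp add: algebra_simps)
next
  case (step2 i) then show ?case using assms[of "t + of_int (i - 1) * (2 * pi)"] by (simp add: algebra_simps)
qed simp

lemma exists_period_shift: "\<exists>k::int. t + of_int k * (2 * pi) \<in> {0..2 * pi}"
proof -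
  define k where "k = \<lfloor>t / (2 * pi)\<rfloor>"
  have "of_int k \<le> t / (2 * pi)" "t / (2 * pi) \<le> of_int k + 1" unfolding k_def by linarith+
  then have "t + of_int (-k) * (2 * pi) \<in> {0..2 * pi}" by (simp add: field_simps)
  then show ?thesis by blast
qed

lemma smooth_periodic_bounded: 
  assumes h: "smooth_periodic h" obtains B where "B > 0" "\<And>t. norm (h t) \<le> B"
proof -
  have "compact (h ` {0..2 * pi})" by (intro compact_continuous_image smooth_periodic_continuous h) auto
  then obtain B where B: "B > 0" "\<And>t. t \<in> {0..2 * pi} \<Longrightarrow> norm (h t) \<le> B"
    by (metis bounded_pos compact_imp_bounded imageI)
  have "norm (h t) \<le> B" for t
  proof -
    obtain k :: int where "t + of_int k * (2 * pi) \<in> {0..2 * pi}" using exists_period_shift by blast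
    then show ?thesis using B(2) periodic_int[of h t k, OF smooth_periodic_periodic[OF h]] by metis
  qed
  with B(1) show ?thesis using that by blast
qed

lemma norm_circle_coeff_le:
  assumes "continuous_on {0..2 * pi} h" "\<And>t. norm (h t) \<le> B"
  shows "norm (circle_coeff h m) \<le> B"
proof -
  have "norm (integral {0..2 * pi} (\<lambda>t. h t * character (-m) t)) \<le> B * (2 * pi - 0)"
    using assms by (intro integral_bound continuous_intros) (auto simp: norm_mult)
  then show ?thesis unfolding circle_coeff_def by (simp add: norm_divide field_simps)
qed

text \<open>Two derivatives give coefficients of size \<open>B / (of_int m)\<^sup>2\<close>. Pairing
  the frequencies \<open>k\<close> and \<open>-k\<close> makes the symmetric sums ordinary partial
  sums, to which the Weierstrass test applies; the limit is identified by pointwise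
  convergence.\<close>

lemma fourier_sum_uniform:
  assumes h: "smooth_periodic h"
  shows "uniform_limit UNIV (fourier_sum h) h sequentially"
proof -
  obtain B where B: "B > 0" "\<And>t. norm (vderiv (vderiv h) t) \<le> B" using smooth_periodic_bounded[OF smooth_periodic_vderiv[OF smooth_periodic_vderiv[OF h]]] by blast
  have dec: "norm (circle_coeff h m) \<le> B / (of_int m)\<^sup>2" if "m \<noteq> 0" for m
  proof -
    have "norm (circle_coeff (vderiv (vderiv h)) m) \<le> B" by (intro norm_circle_coeff_le B smooth_periodic_continuous smooth_periodic_vderiv h)
    moreover have "norm (circle_coeff (vderiv (vderiv h)) m) = (of_int m)\<^sup>2 * norm (circle_coeff h m)"
      by (simp add: circle_coeff_vderiv h smooth_periodic_vderiv norm_mult power2_eq_square)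
    ultimately show ?thesis using that by (simp add: field_simps)
  qed
  define c where "c k t = (if k = 0 then circle_coeff h 0 else circle_coeff h (int k) * character (int k) t + circle_coeff h (-int k) * character (-int k) t)" for k :: nat and t
  have Sc: "fourier_sum h M t = (\<Sum>k<Suc M. c k t)" for M t
  proof (induction M)
    case 0 show ?case by (simp add: fourier_sum_def c_def)
  next
    case (Suc M)
    have "{-int (Suc M)..int (Suc M)} = insert (-int (Suc M)) (insert (int (Suc M)) {-int M..int M})" by auto
    then have "fourier_sum h (Suc M) t = fourier_sum h M t + c (Suc M) t"
      unfolding fourier_sum_def c_def by (simp add: algebra_simps)
    then show ?case using Suc by simp
  qed
  define b where "b k = (if k = 0 then norm (circle_coeff h 0) else 2 * B * (1 / (real k)\<^sup>2))" for k :: nat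
  have "norm (c k t) \<le> b k" for k t
  proof (cases "k = 0")
    case False
    have "norm (c k t) \<le> norm (circle_coeff h (int k)) + norm (circle_coeff h (-int k))"
      using False norm_triangle_ineq[of "circle_coeff h (int k) * character (int k) t" "circle_coeff h (-int k) * character (-int k) t"] by (simp add: c_def norm_mult)
    also have "\<dots> \<le> b k" using dec[of "int k"] dec[of "-int k"] False by (simp add: b_def)
    finally show ?thesis .
  qed (simp add: c_def b_def)
  moreover have "summable b"
  proof -
    have "summable (\<lambda>k. 2 * B * (1 / (real k)\<^sup>2))" using inverse_power_summable[of 2, where ?'a=real] by (intro summable_mult) (simp add: inverse_eq_divide)
    moreover have "\<forall>\<^sub>F k in sequentially. b k = 2 * B * (1 / (real k)\<^sup>2)"
      using eventually_gt_at_top[of "0::nat"] by eventually_elim (simp add: b_def)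
    ultimately show ?thesis by (simp add: summable_cong)
  qed
  ultimately have "uniform_limit UNIV (\<lambda>n t. \<Sum>k<n. c k t) (\<lambda>t. \<Sum>k. c k t) sequentially"
    by (intro Weierstrass_m_test) auto
  then have "uniform_limit UNIV (\<lambda>n t. \<Sum>k<Suc n. c k t) (\<lambda>t. \<Sum>k. c k t) sequentially"
    by (rule filterlim_compose[OF _ filterlim_Suc])
  then have U: "uniform_limit UNIV (fourier_sum h) (\<lambda>t. \<Sum>k. c k t) sequentially"
    unfolding Sc[abs_def, symmetric] by simp
  have "(\<Sum>k. c k t) = h t" for t
    using tendsto_uniform_limitI[OF U, of t] fourier_sum_tendsto[OF smooth_periodic_has_vderiv[OF h] smooth_periodic_periodic[OF h], of t]
    by (auto intro: LIMSEQ_unique)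
  with U show ?thesis by simp
qed

section \<open>Weighted bounds for multiplication by phase factors\<close>

text \<open>Every finite set of integers lies in a symmetric interval, so for nonnegative terms the
  symmetric limit is the unordered sum.\<close>

lemma has_sum_int_nonneg:
  fixes c :: "int \<Rightarrow> real"
  assumes c: "\<And>m. c m \<ge> 0" and L: "(\<lambda>M. \<Sum>m\<in>{-int M..int M}. c m) \<longlonglongrightarrow> L"
  shows "(c has_sum L) UNIV"
proof -
  have inc: "incseq (\<lambda>M. \<Sum>m\<in>{-int M..int M}. c m)"
    by (intro monoI sum_mono2) (auto simp: c)
  have sub: "\<exists>M0. \<forall>M\<ge>M0. F \<subseteq> {-int M..int M}" if "finite F" for F
  proof (cases "F = {}")
    case False
    have "F \<subseteq> {-int M..int M}" if "nat (Max (abs ` F)) \<le> M" for M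
    proof
      fix x assume "x \<in> F"
      then have "\<bar>x\<bar> \<le> Max (abs ` F)" using \<open>finite F\<close> by auto
      then have "\<bar>x\<bar> \<le> int M" using that by linarith
      then show "x \<in> {-int M..int M}" by auto
    qed
    then show ?thesis by blast
  qed auto
  have flim: "filterlim (\<lambda>M. {-int M..int M}) (finite_subsets_at_top UNIV) sequentially"
    unfolding filterlim_finite_subsets_at_top using sub by (auto simp: eventually_sequentially)
  have "sum c F \<le> L" if "finite F" for F
  proof -
    obtain M where "F \<subseteq> {-int M..int M}" using sub[OF \<open>finite F\<close>] by blast
    then have "sum c F \<le> sum c {-int M..int M}" by (intro sum_mono2) (auto simp: c)
    also have "\<dots> \<le> L" using incseq_le[OF inc L] .
    finally show ?thesis .
  qed
  then have "c summable_on UNIV"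
    by (intro nonneg_bdd_above_summable_on bdd_aboveI[of _ L]) (auto simp: c)
  then have S: "(c has_sum infsum c UNIV) UNIV" by (rule has_sum_infsum)
  then have "(\<lambda>M. sum c {-int M..int M}) \<longlonglongrightarrow> infsum c UNIV"
    unfolding has_sum_def by (rule filterlim_compose[OF _ flim])
  with L have "infsum c UNIV = L" by (rule LIMSEQ_unique[symmetric])
  with S show ?thesis by simp
qed

text \<open>Uniform convergence forces the error in \<open>bessel_identity\<close> to zero. The
  tolerance \<open>sqrt (e / 2)\<close> makes the mean square error at most \<open>e / 2\<close>,
  which leaves room for a strict inequality.\<close>

lemma parseval:
  assumes h: "smooth_periodic h"
  shows "((\<lambda>m. (norm (circle_coeff h m))\<^sup>2) has_sum integral {0..2 * pi} (\<lambda>t. (norm (h t))\<^sup>2) / (2 * pi)) UNIV"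
proof (rule has_sum_int_nonneg)
  let ?I = "integral {0..2 * pi} (\<lambda>t. (norm (h t))\<^sup>2)"
  let ?S = "\<lambda>M. \<Sum>m\<in>{-int M..int M}. (norm (circle_coeff h m))\<^sup>2"
  have id: "((\<lambda>t. (norm (h t - fourier_sum h M t))\<^sup>2) has_integral ?I - 2 * pi * ?S M) {0..2 * pi}" for M
    unfolding fourier_sum_def by (intro bessel_identity smooth_periodic_continuous h) auto
  show "?S \<longlonglongrightarrow> ?I / (2 * pi)"
  proof (rule LIMSEQ_I)
    fix e :: real assume e: "e > 0"
    have "\<forall>\<^sub>F M in sequentially. \<forall>t\<in>UNIV. dist (fourier_sum h M t) (h t) < sqrt (e / 2)"
      using fourier_sum_uniform[OF h] e by (intro uniform_limitD) auto
    then obtain M0 where M0: "\<And>M t. M \<ge> M0 \<Longrightarrow> dist (fourier_sum h M t) (h t) < sqrt (e / 2)"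
      by (auto simp: eventually_sequentially)
    have "norm (?S M - ?I / (2 * pi)) < e" if M: "M \<ge> M0" for M
    proof -
      have "((\<lambda>t::real. e / 2) has_integral (2 * pi - 0) *\<^sub>R (e / 2)) {0..2 * pi}"
        using has_integral_const_real[of "e / 2" 0 "2 * pi"] by simp
      moreover have "(norm (h t - fourier_sum h M t))\<^sup>2 \<le> e / 2" for t
      proof -
        have "(norm (h t - fourier_sum h M t))\<^sup>2 \<le> (sqrt (e / 2))\<^sup>2"
          using M0[OF M, of t] by (intro power_mono) (auto simp: dist_norm norm_minus_commute)
        then show ?thesis using e by simp
      qed
      ultimately have "?I - 2 * pi * ?S M \<le> 2 * pi * (e / 2)"
        using has_integral_le[OF id] by fastforce
      moreover have "?I - 2 * pi * ?S M \<ge> 0" using has_integral_nonneg[OF id] by simp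
      ultimately have "0 \<le> ?I / (2 * pi) - ?S M" "?I / (2 * pi) - ?S M \<le> e / 2"
        by (simp_all add: field_simps)
      then show ?thesis using e by simp
    qed
    then show "\<exists>M0. \<forall>M\<ge>M0. norm (?S M - ?I / (2 * pi)) < e" by blast
  qed
qed simp

text \<open>
  The squared norm with weights \<open>(1 + n\<^sup>2 + m\<^sup>2) ^ N\<close> on the Fourier coefficients. The recursion makes it
  accessible to the Leibniz rule.
\<close>

fun sobolev_sq :: "nat \<Rightarrow> int \<Rightarrow> (real \<Rightarrow> complex) \<Rightarrow> real" where
  "sobolev_sq 0 n h = integral {0..2 * pi} (\<lambda>t. (norm (h t))\<^sup>2) / (2 * pi)"
| "sobolev_sq (Suc N) n h = (1 + (of_int n)\<^sup>2) * sobolev_sq N n h + sobolev_sq N n (vderiv h)"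

text \<open>Differentiation multiplies the squared coefficient by the square of \<open>m\<close>, so
  one step of the recursion multiplies each term by the full joint weight.\<close>

lemma sobolev_sq_has_sum:
  assumes "smooth_periodic h"
  shows "((\<lambda>m. (1 + (of_int n)\<^sup>2 + (of_int m)\<^sup>2) ^ N * (norm (circle_coeff h m))\<^sup>2) has_sum sobolev_sq N n h) UNIV"
  using assms
proof (induction N arbitrary: h)
  case 0 then show ?case using parseval by simp
next
  case (Suc N)
  let ?w = "\<lambda>m::int. 1 + (of_int n)\<^sup>2 + (of_int m)\<^sup>2 :: real"
  have "((\<lambda>m. (1 + (of_int n)\<^sup>2) * (?w m ^ N * (norm (circle_coeff h m))\<^sup>2) + ?w m ^ N * (norm (circle_coeff (vderiv h) m))\<^sup>2) has_sum
     (1 + (of_int n)\<^sup>2) * sobolev_sq N n h + sobolev_sq N n (vderiv h)) UNIV"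
    by (intro has_sum_add has_sum_cmult_right Suc.IH Suc.prems smooth_periodic_vderiv)
  moreover have "(1 + (of_int n)\<^sup>2) * (?w m ^ N * (norm (circle_coeff h m))\<^sup>2) + ?w m ^ N * (norm (circle_coeff (vderiv h) m))\<^sup>2 = ?w m ^ Suc N * (norm (circle_coeff h m))\<^sup>2" for m
    by (simp add: circle_coeff_vderiv Suc.prems norm_mult power_mult_distrib algebra_simps)
  ultimately show ?case by simp
qed

lemma sobolev_sq_nonneg: "smooth_periodic h \<Longrightarrow> sobolev_sq N n h \<ge> 0"
  by (rule has_sum_nonneg[OF sobolev_sq_has_sum]) (auto intro!: mult_nonneg_nonneg)

lemma norm_add_sq_le: "(norm (a + b))\<^sup>2 \<le> 2 * (norm a)\<^sup>2 + 2 * (norm b)\<^sup>2"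
proof -
  have "(norm (a + b))\<^sup>2 \<le> (norm a + norm b)\<^sup>2" by (intro power_mono norm_triangle_ineq) auto
  also have "\<dots> \<le> 2 * (norm a)\<^sup>2 + 2 * (norm b)\<^sup>2"
    using zero_le_power2[of "norm a - norm b"] by (simp add: power2_eq_square algebra_simps)
  finally show ?thesis .
qed

lemma sobolev_sq_add_le:
  assumes "smooth_periodic g" "smooth_periodic h"
  shows "sobolev_sq N n (\<lambda>t. g t + h t) \<le> 2 * sobolev_sq N n g + 2 * sobolev_sq N n h"
proof (rule has_sum_mono[OF sobolev_sq_has_sum[OF smooth_periodic_add[OF assms]] has_sum_add[OF has_sum_cmult_right[OF sobolev_sq_has_sum[OF assms(1)]] has_sum_cmult_right[OF sobolev_sq_has_sum[OF assms(2)]]]])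
  fix m
  let ?w = "(1 + (of_int n)\<^sup>2 + (of_int m)\<^sup>2) ^ N :: real"
  have "?w \<ge> 0" by simp
  then have "?w * (norm (circle_coeff (\<lambda>t. g t + h t) m))\<^sup>2 \<le> ?w * (2 * (norm (circle_coeff g m))\<^sup>2 + 2 * (norm (circle_coeff h m))\<^sup>2)"
    unfolding circle_coeff_add[OF smooth_periodic_continuous[OF assms(1)] smooth_periodic_continuous[OF assms(2)]]
    by (intro mult_left_mono norm_add_sq_le)
  then show "?w * (norm (circle_coeff (\<lambda>t. g t + h t) m))\<^sup>2 \<le> 2 * (?w * (norm (circle_coeff g m))\<^sup>2) + 2 * (?w * (norm (circle_coeff h m))\<^sup>2)"
    by (simp add: algebra_simps)
qed

lemma sobolev_sq_cmult: 
  assumes "smooth_periodic h" 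
  shows "sobolev_sq N n (\<lambda>t. c * h t) = (norm c)\<^sup>2 * sobolev_sq N n h"
proof (rule has_sum_unique[OF sobolev_sq_has_sum[OF smooth_periodic_mult[OF smooth_periodic_const assms]]])
  have "((\<lambda>m. (norm c)\<^sup>2 * ((1 + (of_int n)\<^sup>2 + (of_int m)\<^sup>2) ^ N * (norm (circle_coeff h m))\<^sup>2)) has_sum (norm c)\<^sup>2 * sobolev_sq N n h) UNIV"
    by (intro has_sum_cmult_right sobolev_sq_has_sum assms)
  then show "((\<lambda>m. (1 + (of_int n)\<^sup>2 + (of_int m)\<^sup>2) ^ N * (norm (circle_coeff (\<lambda>t. c * h t) m))\<^sup>2) has_sum (norm c)\<^sup>2 * sobolev_sq N n h) UNIV"
    by (simp add: circle_coeff_scale norm_mult power_mult_distrib mult_ac)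
qed

lemma sobolev_sq_0_mult_le:
  assumes "smooth_periodic b" "smooth_periodic h" "\<And>t. norm (b t) \<le> B"
  shows "sobolev_sq 0 n (\<lambda>t. b t * h t) \<le> B\<^sup>2 * sobolev_sq 0 n h"
proof -
  have "integral {0..2 * pi} (\<lambda>t. (norm (b t * h t))\<^sup>2) \<le> integral {0..2 * pi} (\<lambda>t. B\<^sup>2 * (norm (h t))\<^sup>2)"
  proof (rule integral_le)
    show "(\<lambda>t. (norm (b t * h t))\<^sup>2) integrable_on {0..2 * pi}" "(\<lambda>t. B\<^sup>2 * (norm (h t))\<^sup>2) integrable_on {0..2 * pi}"
      by (intro integrable_continuous_interval continuous_intros smooth_periodic_continuous assms)+
    show "(norm (b t * h t))\<^sup>2 \<le> B\<^sup>2 * (norm (h t))\<^sup>2" for t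
      unfolding norm_mult power_mult_distrib using assms(3) by (intro mult_right_mono power_mono) auto
  qed
  then show ?thesis by (simp add: divide_right_mono)
qed

text \<open>The constant must not depend on \<open>n\<close>. Differentiating the product also
  yields \<open>vderiv b t * h t\<close>, hence the induction over all \<open>b\<close>; this term
  has no derivative on \<open>h\<close> and is absorbed because the bracket of \<open>n\<close> is
  at least 1.\<close>

lemma sobolev_sq_mult_le:
  assumes "smooth_periodic b"
  shows "\<exists>C\<ge>0. \<forall>n h. smooth_periodic h \<longrightarrow> sobolev_sq N n (\<lambda>t. b t * h t) \<le> C * sobolev_sq N n h"
  using assms
proof (induction N arbitrary: b)
  case 0
  obtain B where "\<And>t. norm (b t) \<le> B" using smooth_periodic_bounded[OF 0] by blast
  then have "\<forall>n h. smooth_periodic h \<longrightarrow> sobolev_sq 0 n (\<lambda>t. b t * h t) \<le> B\<^sup>2 * sobolev_sq 0 n h"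
    using sobolev_sq_0_mult_le[OF 0] by blast
  then show ?case using zero_le_power2 by blast
next
  case (Suc N)
  note b = Suc.prems
  obtain C1 where C1: "C1 \<ge> 0" "\<And>n h. smooth_periodic h \<Longrightarrow> sobolev_sq N n (\<lambda>t. b t * h t) \<le> C1 * sobolev_sq N n h"
    using Suc.IH[OF b] by blast
  obtain C2 where C2: "C2 \<ge> 0" "\<And>n h. smooth_periodic h \<Longrightarrow> sobolev_sq N n (\<lambda>t. vderiv b t * h t) \<le> C2 * sobolev_sq N n h"
    using Suc.IH[OF smooth_periodic_vderiv[OF b]] by blast
  have "sobolev_sq (Suc N) n (\<lambda>t. b t * h t) \<le> (2 * C1 + 2 * C2) * sobolev_sq (Suc N) n h" if h: "smooth_periodic h" for n h
  proof -
    let ?N = "1 + (of_int n)\<^sup>2 :: real"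
    have N1: "?N \<ge> 1" by simp
    have "sobolev_sq (Suc N) n (\<lambda>t. b t * h t) = ?N * sobolev_sq N n (\<lambda>t. b t * h t) + sobolev_sq N n (\<lambda>t. b t * vderiv h t + vderiv b t * h t)"
      by (simp add: vderiv_mult b h)
    also have "\<dots> \<le> ?N * (C1 * sobolev_sq N n h) + (2 * (C1 * sobolev_sq N n (vderiv h)) + 2 * (C2 * sobolev_sq N n h))"
      using sobolev_sq_add_le[OF smooth_periodic_mult[OF b smooth_periodic_vderiv[OF h]] smooth_periodic_mult[OF smooth_periodic_vderiv[OF b] h], of N n] C1(2)[OF smooth_periodic_vderiv[OF h], of n] C2(2)[OF h, of n]
        mult_left_mono[OF C1(2)[OF h, of n], of ?N] N1 by linarith
    also have "\<dots> \<le> (2 * C1 + 2 * C2) * (?N * sobolev_sq N n h + sobolev_sq N n (vderiv h))"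
    proof -
      have "C2 * sobolev_sq N n h \<le> C2 * (?N * sobolev_sq N n h)"
        using C2(1) sobolev_sq_nonneg[OF h, of N n] mult_right_mono[OF N1 sobolev_sq_nonneg[OF h, of N n]] by (intro mult_left_mono) auto
      moreover have "0 \<le> C1 * (?N * sobolev_sq N n h)" "0 \<le> C2 * sobolev_sq N n (vderiv h)"
        using C1(1) C2(1) sobolev_sq_nonneg[OF h, of N n] sobolev_sq_nonneg[OF smooth_periodic_vderiv[OF h], of N n] N1 by auto
      ultimately show ?thesis by (simp add: algebra_simps)
    qed
    finally show ?thesis by simp
  qed
  then show ?case using C1(1) C2(1) by (intro exI[of _ "2 * C1 + 2 * C2"]) auto
qed

lemma sobolev_sq_trig_poly:
  assumes "finite L"
  shows "sobolev_sq N n (\<lambda>t. \<Sum>m\<in>L. p m * character m t) = (\<Sum>m\<in>L. (1 + (of_int n)\<^sup>2 + (of_int m)\<^sup>2) ^ N * (norm (p m))\<^sup>2)"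
proof -
  let ?P = "\<lambda>t. \<Sum>m\<in>L. p m * character m t"
  have fP: "circle_coeff ?P m = (if m \<in> L then p m else 0)" for m
    using assms by (simp add: circle_coeff_sum circle_coeff_scale circle_coeff_character continuous_intros if_distrib sum.delta cong: if_cong)
  have "((\<lambda>m. (1 + (of_int n)\<^sup>2 + (of_int m)\<^sup>2) ^ N * (norm (circle_coeff ?P m))\<^sup>2) has_sum sobolev_sq N n ?P) UNIV"
    by (intro sobolev_sq_has_sum smooth_periodic_sum smooth_periodic_mult smooth_periodic_const smooth_periodic_character)
  moreover have "((\<lambda>m. (1 + (of_int n)\<^sup>2 + (of_int m)\<^sup>2) ^ N * (norm (circle_coeff ?P m))\<^sup>2) has_sum (\<Sum>m\<in>L. (1 + (of_int n)\<^sup>2 + (of_int m)\<^sup>2) ^ N * (norm (circle_coeff ?P m))\<^sup>2)) UNIV"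
    using assms by (intro has_sum_finite_neutralI) (auto simp: fP)
  ultimately have "sobolev_sq N n ?P = (\<Sum>m\<in>L. (1 + (of_int n)\<^sup>2 + (of_int m)\<^sup>2) ^ N * (norm (circle_coeff ?P m))\<^sup>2)"
    by (rule has_sum_unique)
  then show ?thesis by (simp add: fP)
qed

section \<open>Phase factors and the joint weight\<close>

abbreviation joint_weight :: "int \<Rightarrow> int \<Rightarrow> real" where
  "joint_weight n m \<equiv> 1 + (of_int n)\<^sup>2 + (of_int m)\<^sup>2"

lemma joint_weight_pos: "joint_weight n m > 0" by (smt (verit) zero_le_power2)

text \<open>To be used with \<open>b\<close> equal to the coefficient minus its mean; mean zero is
  exactly what makes the primitive \<open>A\<close> periodic.\<close>

locale phase =
  fixes A b :: "real \<Rightarrow> real"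
  assumes A_deriv: "\<And>t. (A has_real_derivative b t) (at t)"
    and A_periodic: "\<And>t. A (t + 2 * pi) = A t"
    and b_smooth: "smooth_periodic (\<lambda>t. complex_of_real (b t))"
begin

definition phase_factor :: "int \<Rightarrow> real \<Rightarrow> complex" where
  "phase_factor n t = cis (of_int n * A t)"

lemma phase_factor_has_vderiv: "(phase_factor n has_vector_derivative \<i> * of_int n * of_real (b t) * phase_factor n t) (at t)"
proof -
  have "((\<lambda>t. of_int n * A t) has_vector_derivative of_int n * b t) (at t)"
    using DERIV_cmult[OF A_deriv] by (simp add: has_real_derivative_iff_has_vector_derivative)
  from vector_diff_chain_at[OF this, of cis "\<i> * cis (of_int n * A t)"] character_has_vderiv[of 1 "of_int n * A t"]
  show ?thesis by (simp add: o_def phase_factor_def[abs_def] scaleR_conv_of_real mult_ac)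
qed

lemma smooth_periodic_phase_factor: "smooth_periodic (phase_factor n)"
proof -
  have "C_order k (\<lambda>t. \<i> * of_int n * of_real (b t))" for k
    using smooth_periodic_mult[OF smooth_periodic_const[of "\<i> * of_int n"] b_smooth] by (simp add: smooth_periodic_def)
  from C_order_ode[OF _ this, of "phase_factor n"] phase_factor_has_vderiv show ?thesis
    unfolding smooth_periodic_def by (simp add: phase_factor_def A_periodic)
qed

lemma vderiv_phase_factor: "vderiv (phase_factor n) = (\<lambda>t. \<i> * of_int n * of_real (b t) * phase_factor n t)"
  by (intro vderiv_eq phase_factor_has_vderiv)

lemma norm_phase_factor [simp]: "norm (phase_factor n t) = 1" by (simp add: phase_factor_def)

lemma cnj_phase_factor: "cnj (phase_factor n t) = phase_factor (-n) t" by (simp add: phase_factor_def cis_cnj)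

lemma phase_factor_mult_inverse: "phase_factor (-n) t * phase_factor n t = 1" by (simp add: phase_factor_def cis_mult)

text \<open>The derivative of the product is again the phase factor times a function, namely
  \<open>vderiv h t + \<i> * of_int n * of_real (b t) * h t\<close>, so the induction hypothesis
  applies to it. The square of \<open>n\<close> from the second summand is absorbed by the bracket
  of \<open>n\<close> in the recursion of \<open>sobolev_sq\<close>; multiplication by
  \<open>b\<close> costs \<open>C2\<close>.\<close>

lemma sobolev_sq_phase_factor_le: "\<exists>C\<ge>0. \<forall>n h. smooth_periodic h \<longrightarrow> sobolev_sq N n (\<lambda>t. phase_factor n t * h t) \<le> C * sobolev_sq N n h"
proof (induction N)
  case 0
  show ?case using sobolev_sq_0_mult_le[OF smooth_periodic_phase_factor, of _ _ 1] by (intro exI[of _ 1]) auto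
next
  case (Suc N)
  obtain C1 where C1: "C1 \<ge> 0" "\<And>n h. smooth_periodic h \<Longrightarrow> sobolev_sq N n (\<lambda>t. phase_factor n t * h t) \<le> C1 * sobolev_sq N n h"
    using Suc.IH by blast
  obtain C2 where C2: "C2 \<ge> 0" "\<And>n h. smooth_periodic h \<Longrightarrow> sobolev_sq N n (\<lambda>t. of_real (b t) * h t) \<le> C2 * sobolev_sq N n h"
    using sobolev_sq_mult_le[OF b_smooth] by blast
  have "sobolev_sq (Suc N) n (\<lambda>t. phase_factor n t * h t) \<le> (2 * C1 + 2 * C1 * C2) * sobolev_sq (Suc N) n h" if h: "smooth_periodic h" for n h
  proof -
    let ?N = "1 + (of_int n)\<^sup>2 :: real"
    let ?k = "\<lambda>t. (\<i> * of_int n) * (of_real (b t) * h t)"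
    have bh: "smooth_periodic (\<lambda>t. of_real (b t) * h t)" by (intro smooth_periodic_mult b_smooth h)
    have k: "smooth_periodic ?k" by (intro smooth_periodic_mult smooth_periodic_const bh)
    have "sobolev_sq (Suc N) n (\<lambda>t. phase_factor n t * h t) = ?N * sobolev_sq N n (\<lambda>t. phase_factor n t * h t) + sobolev_sq N n (\<lambda>t. phase_factor n t * (vderiv h t + ?k t))"
    proof -
      have "vderiv (\<lambda>t. phase_factor n t * h t) = (\<lambda>t. phase_factor n t * (vderiv h t + ?k t))"
        unfolding vderiv_mult[OF smooth_periodic_phase_factor h] vderiv_phase_factor by (simp add: algebra_simps)
      then show ?thesis by (simp only: sobolev_sq.simps)
    qed
    also have "\<dots> \<le> ?N * (C1 * sobolev_sq N n h) + C1 * (2 * sobolev_sq N n (vderiv h) + 2 * ((of_int n)\<^sup>2 * (C2 * sobolev_sq N n h)))"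
    proof (intro add_mono mult_left_mono C1 h)
      have "sobolev_sq N n ?k = (of_int n)\<^sup>2 * sobolev_sq N n (\<lambda>t. of_real (b t) * h t)"
        using sobolev_sq_cmult[OF bh, of N n "\<i> * of_int n"] by (simp add: norm_mult)
      also have "\<dots> \<le> (of_int n)\<^sup>2 * (C2 * sobolev_sq N n h)" by (intro mult_left_mono C2 h) auto
      finally have "2 * sobolev_sq N n (vderiv h) + 2 * sobolev_sq N n ?k \<le> 2 * sobolev_sq N n (vderiv h) + 2 * ((of_int n)\<^sup>2 * (C2 * sobolev_sq N n h))" by simp
      then have "C1 * sobolev_sq N n (\<lambda>t. vderiv h t + ?k t) \<le> C1 * (2 * sobolev_sq N n (vderiv h) + 2 * ((of_int n)\<^sup>2 * (C2 * sobolev_sq N n h)))"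
        using sobolev_sq_add_le[OF smooth_periodic_vderiv[OF h] k, of N n] C1(1) by (intro mult_left_mono) auto
      then show "sobolev_sq N n (\<lambda>t. phase_factor n t * (vderiv h t + ?k t)) \<le> C1 * (2 * sobolev_sq N n (vderiv h) + 2 * ((of_int n)\<^sup>2 * (C2 * sobolev_sq N n h)))"
        using C1(2)[OF smooth_periodic_add[OF smooth_periodic_vderiv[OF h] k], of n] by linarith
    qed auto
    also have "\<dots> \<le> (2 * C1 + 2 * C1 * C2) * (?N * sobolev_sq N n h + sobolev_sq N n (vderiv h))"
    proof -
      have "0 \<le> C1 * sobolev_sq N n h" "0 \<le> C1 * (C2 * sobolev_sq N n (vderiv h))" "0 \<le> C1 * (C2 * sobolev_sq N n h)" "0 \<le> C1 * ((of_int n)\<^sup>2 * sobolev_sq N n h)"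
        using C1(1) C2(1) sobolev_sq_nonneg[OF h, of N n] sobolev_sq_nonneg[OF smooth_periodic_vderiv[OF h], of N n] by auto
      then show ?thesis by (simp add: algebra_simps)
    qed
    finally show ?thesis by simp
  qed
  then show ?case using C1(1) C2(1) by (intro exI[of _ "2 * C1 + 2 * C1 * C2"]) auto
qed

text \<open>The matrix is convolution with the coefficients of the phase factor. Reading
  \<open>p\<close> as a trigonometric polynomial, its image consists of the coefficients of the
  product.\<close>

lemma weighted_bound_phase_factor_nat: "\<exists>C\<ge>0. \<forall>n. weighted_bound (\<lambda>k m. circle_coeff (phase_factor n) (k - m)) (\<lambda>k. joint_weight n k ^ N) C"
proof -
  obtain C where C: "C \<ge> 0" "\<And>n h. smooth_periodic h \<Longrightarrow> sobolev_sq N n (\<lambda>t. phase_factor n t * h t) \<le> C * sobolev_sq N n h" using sobolev_sq_phase_factor_le by blast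
  have "weighted_bound (\<lambda>k m. circle_coeff (phase_factor n) (k - m)) (\<lambda>k. joint_weight n k ^ N) C" for n
    unfolding weighted_bound_def
  proof (intro allI impI)
    fix K L :: "int set" and p :: "int \<Rightarrow> complex"
    assume fin: "finite K" "finite L"
    let ?P = "\<lambda>t. \<Sum>m\<in>L. p m * character m t"
    have P: "smooth_periodic ?P" by (intro smooth_periodic_sum smooth_periodic_mult smooth_periodic_const smooth_periodic_character)
    have "circle_coeff (\<lambda>t. phase_factor n t * ?P t) k = (\<Sum>m\<in>L. circle_coeff (phase_factor n) (k - m) * p m)" for k
    proof -
      have "circle_coeff (\<lambda>t. phase_factor n t * ?P t) k = circle_coeff (\<lambda>t. \<Sum>m\<in>L. p m * (phase_factor n t * character m t)) k"
        by (simp add: sum_distrib_left mult_ac)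
      also have "\<dots> = (\<Sum>m\<in>L. circle_coeff (\<lambda>t. p m * (phase_factor n t * character m t)) k)"
        by (intro circle_coeff_sum fin continuous_intros smooth_periodic_continuous smooth_periodic_phase_factor)
      also have "\<dots> = (\<Sum>m\<in>L. circle_coeff (phase_factor n) (k - m) * p m)"
        unfolding circle_coeff_scale circle_coeff_mult_character by (simp add: mult.commute)
      finally show ?thesis .
    qed
    then have "(\<Sum>k\<in>K. joint_weight n k ^ N * (norm (\<Sum>m\<in>L. circle_coeff (phase_factor n) (k - m) * p m))\<^sup>2) = (\<Sum>k\<in>K. joint_weight n k ^ N * (norm (circle_coeff (\<lambda>t. phase_factor n t * ?P t) k))\<^sup>2)"
      by simp
    also have "\<dots> \<le> sobolev_sq N n (\<lambda>t. phase_factor n t * ?P t)"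
      by (intro has_sum_mono2[OF has_sum_finite[OF fin(1)] sobolev_sq_has_sum] smooth_periodic_mult smooth_periodic_phase_factor P) auto
    also have "\<dots> \<le> C * sobolev_sq N n ?P" by (rule C(2)[OF P])
    finally show "(\<Sum>k\<in>K. joint_weight n k ^ N * (norm (\<Sum>m\<in>L. circle_coeff (phase_factor n) (k - m) * p m))\<^sup>2) \<le> C * (\<Sum>m\<in>L. joint_weight n m ^ N * (norm (p m))\<^sup>2)"
      unfolding sobolev_sq_trig_poly[OF fin(2)] .
  qed
  with C(1) show ?thesis by blast
qed

lemma weighted_bound_phase_factor_nonneg:
  assumes "s \<ge> 0"
  shows "\<exists>C\<ge>0. \<forall>n. weighted_bound (\<lambda>k m. circle_coeff (phase_factor n) (k - m)) (\<lambda>k. joint_weight n k powr s) C"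
proof -
  obtain C0 where C0: "C0 \<ge> 0" "\<And>n. weighted_bound (\<lambda>k m. circle_coeff (phase_factor n) (k - m)) (\<lambda>k. joint_weight n k ^ 0) C0"
    using weighted_bound_phase_factor_nat by blast
  show ?thesis
  proof (cases "s = 0")
    case True
    with C0 show ?thesis using joint_weight_pos by (intro exI[of _ C0]) (auto simp: less_imp_neq[OF joint_weight_pos, symmetric])
  next
    case False
    \<comment> \<open>The extra 1 makes \<open>s / N\<close> strictly less than 1, as interpolation
      requires.\<close>
    define N where "N = nat \<lceil>s\<rceil> + 1"
    have N: "real N > s" "s > 0" using assms False unfolding N_def by linarith+
    obtain C1 where C1: "C1 \<ge> 0" "\<And>n. weighted_bound (\<lambda>k m. circle_coeff (phase_factor n) (k - m)) (\<lambda>k. joint_weight n k ^ N) C1"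
      using weighted_bound_phase_factor_nat by blast
    have "weighted_bound (\<lambda>k m. circle_coeff (phase_factor n) (k - m)) (\<lambda>k. (joint_weight n k ^ N) powr (s / N)) (max C0 C1)" for n
    proof (rule weighted_bound_interpolate)
      show "weighted_bound (\<lambda>k m. circle_coeff (phase_factor n) (k - m)) (\<lambda>_. 1) (max C0 C1)"
        using weighted_bound_mono[OF C0(2), of "max C0 C1" n] by simp
      show "weighted_bound (\<lambda>k m. circle_coeff (phase_factor n) (k - m)) (\<lambda>k. joint_weight n k ^ N) (max C0 C1)"
        by (rule weighted_bound_mono[OF C1(2)]) (auto intro: less_imp_le[OF joint_weight_pos])
    qed (use N joint_weight_pos in auto)
    moreover have "(joint_weight n k ^ N) powr (s / N) = joint_weight n k powr s" for n k
      using N joint_weight_pos[of n k] by (simp add: powr_realpow[symmetric] powr_powr)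
    ultimately show ?thesis using C0(1) by (intro exI[of _ "max C0 C1"]) auto
  qed
qed

text \<open>Pairings with a distribution transform by the transpose, because the multiplication acts
  on the test function. For \<open>s \<ge> 0\<close> the transpose is the complex conjugate of the
  matrix for \<open>-n\<close>, and the weight is even in \<open>n\<close>; for \<open>s < 0\<close>
  it is bounded by duality from the exponent \<open>-s\<close>.\<close>

lemma weighted_bound_phase_factor_transpose:
  "\<exists>C\<ge>0. \<forall>n. weighted_bound (\<lambda>k m. circle_coeff (phase_factor n) (m - k)) (\<lambda>k. joint_weight n k powr s) C"
proof (cases "s \<ge> 0")
  case True
  then obtain C where C: "C \<ge> 0" "\<And>n. weighted_bound (\<lambda>k m. circle_coeff (phase_factor n) (k - m)) (\<lambda>k. joint_weight n k powr s) C"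
    using weighted_bound_phase_factor_nonneg by blast
  have "cnj (circle_coeff (phase_factor (-n)) j) = circle_coeff (phase_factor n) (-j)" for n j
  proof -
    have "(\<lambda>t. cnj (phase_factor (-n) t * character (-j) t)) = (\<lambda>t. phase_factor n t * character (-(-j)) t)"
      by (simp add: cnj_phase_factor cis_cnj)
    then show ?thesis unfolding circle_coeff_def by (simp add: integral_cnj)
  qed
  then have "weighted_bound (\<lambda>k m. circle_coeff (phase_factor n) (m - k)) (\<lambda>k. joint_weight n k powr s) C" for n
    using weighted_bound_cnj[OF C(2)[of "-n"]] by simp
  with C(1) show ?thesis by blast
next
  case False
  then obtain C where C: "C \<ge> 0" "\<And>n. weighted_bound (\<lambda>k m. circle_coeff (phase_factor n) (k - m)) (\<lambda>k. joint_weight n k powr (-s)) C"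
    using weighted_bound_phase_factor_nonneg[of "-s"] by auto
  have "weighted_bound (\<lambda>k m. circle_coeff (phase_factor n) (m - k)) (\<lambda>k. 1 / (joint_weight n k powr (-s))) C" for n
    by (rule weighted_bound_transpose[OF C(2) _ C(1)]) (simp add: less_imp_neq[OF joint_weight_pos, symmetric])
  then show ?thesis using C(1) by (auto simp: powr_minus_divide)
qed

text \<open>\<open>V\<close> is known only as a limit of symmetric sums. A sum over a finite
  \<open>K\<close> passes to that limit, so uniform bounds on the finite sums of \<open>U\<close>
  are enough, and the constant serves all rows \<open>n\<close> at once.\<close>

lemma conjugation_bound:
  obtains C where "C \<ge> 0"
    "\<And>n U V S K. (\<And>m. (\<lambda>M. \<Sum>k\<in>{-int M..int M}. circle_coeff (phase_factor n) (k - m) * U k) \<longlonglongrightarrow> V m) \<Longrightarrow>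
       (\<And>L. finite L \<Longrightarrow> (\<Sum>k\<in>L. joint_weight n k powr s * (norm (U k))\<^sup>2) \<le> S) \<Longrightarrow> finite K \<Longrightarrow>
       (\<Sum>m\<in>K. joint_weight n m powr s * (norm (V m))\<^sup>2) \<le> C * S"
proof -
  obtain C where C: "C \<ge> 0" "\<And>n. weighted_bound (\<lambda>k m. circle_coeff (phase_factor n) (m - k)) (\<lambda>k. joint_weight n k powr s) C"
    using weighted_bound_phase_factor_transpose by blast
  show thesis
  proof (rule that[OF C(1)], rule LIMSEQ_le_const2)
    fix n U V S and K :: "int set"
    assume V: "\<And>m. (\<lambda>M. \<Sum>k\<in>{-int M..int M}. circle_coeff (phase_factor n) (k - m) * U k) \<longlonglongrightarrow> V m"
      and S: "\<And>L. finite L \<Longrightarrow> (\<Sum>k\<in>L. joint_weight n k powr s * (norm (U k))\<^sup>2) \<le> S" and K: "finite K"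
    show "(\<lambda>M. \<Sum>m\<in>K. joint_weight n m powr s * (norm (\<Sum>k\<in>{-int M..int M}. circle_coeff (phase_factor n) (k - m) * U k))\<^sup>2) \<longlonglongrightarrow> (\<Sum>m\<in>K. joint_weight n m powr s * (norm (V m))\<^sup>2)"
      by (intro tendsto_intros V)
    have "(\<Sum>m\<in>K. joint_weight n m powr s * (norm (\<Sum>k\<in>{-int M..int M}. circle_coeff (phase_factor n) (k - m) * U k))\<^sup>2) \<le> C * S" for M
      using weighted_boundD[OF C(2) K, of "{-int M..int M}" n U] mult_left_mono[OF S C(1), of "{-int M..int M}"] by simp
    then show "\<exists>N. \<forall>M\<ge>N. (\<Sum>m\<in>K. joint_weight n m powr s * (norm (\<Sum>k\<in>{-int M..int M}. circle_coeff (phase_factor n) (k - m) * U k))\<^sup>2) \<le> C * S" by blast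
  qed
qed

end

section \<open>Distributions tested against separated functions\<close>

definition tensor :: "(real \<Rightarrow> complex) \<Rightarrow> int \<Rightarrow> real \<times> real \<Rightarrow> complex" where
  "tensor h n = (\<lambda>(t, x). h t * character n x)"

lemma partial_t_tensor: "smooth_periodic h \<Longrightarrow> partial_t (tensor h n) = tensor (vderiv h) n"
  unfolding partial_t_def tensor_def
  by (auto intro!: vector_derivative_at has_vector_derivative_mult_left smooth_periodic_has_vderiv)

lemma partial_x_tensor: "partial_x (tensor h n) = tensor (\<lambda>t. \<i> * of_int n * h t) n"
proof -
  have "vector_derivative (\<lambda>y. h t * character n y) (at x) = \<i> * of_int n * h t * character n x" for t x
    using vector_derivative_at[OF has_vector_derivative_mult_right[OF character_has_vderiv], of "h t" n x] by (simp only: mult_ac)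
  then show ?thesis unfolding partial_x_def tensor_def by simp
qed

lemma smooth_periodic_cmult: "smooth_periodic h \<Longrightarrow> smooth_periodic (\<lambda>t. c * h t)"
  by (rule smooth_periodic_mult[OF smooth_periodic_const])

lemma C_k_tensor: "smooth_periodic h \<Longrightarrow> C_k k (tensor h n)"
proof (induction k arbitrary: h)
  case 0
  then show ?case unfolding tensor_def
    by (auto simp: case_prod_unfold intro!: continuous_intros continuous_on_compose2[OF smooth_periodic_continuous[OF 0]])
next
  case (Suc k)
  have "tensor h n differentiable (at z)" for z
  proof -
    have d: "(\<lambda>z. g (\<pi> z)) differentiable (at z)" if "smooth_periodic g" "bounded_linear \<pi>" for g and \<pi> :: "real \<times> real \<Rightarrow> real"
    proof -
      have "(g has_derivative (\<lambda>s. s *\<^sub>R vderiv g (\<pi> z))) (at (\<pi> z))"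
        using smooth_periodic_has_vderiv[OF that(1)] by (simp add: has_vector_derivative_def)
      then have "((\<lambda>z. g (\<pi> z)) has_derivative (\<lambda>w. \<pi> w *\<^sub>R vderiv g (\<pi> z))) (at z)"
        by (rule has_derivative_compose[OF bounded_linear_imp_has_derivative[OF that(2)]])
      then show ?thesis by (rule differentiableI)
    qed
    have "(\<lambda>z. h (fst z) * character n (snd z)) differentiable (at z)"
      by (intro differentiable_mult d Suc.prems smooth_periodic_character bounded_linear_fst bounded_linear_snd)
    then show ?thesis by (simp add: tensor_def case_prod_unfold)
  qed
  then show ?case
    using Suc by (simp add: partial_t_tensor partial_x_tensor smooth_periodic_vderiv smooth_periodic_cmult)
qed

lemma character_periodic: "character n (x + 2 * pi) = character n x"
  using smooth_periodic_periodic[OF smooth_periodic_character] .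

lemma tensor_test: "smooth_periodic h \<Longrightarrow> tensor h n \<in> test_functions"
  unfolding test_functions_def using C_k_tensor character_periodic[of n] smooth_periodic_periodic[of h]
  by (auto simp: tensor_def)

lemma tensor_partials:
  assumes "smooth_periodic h"
  shows "(partial_t ^^ j) ((partial_x ^^ k) (tensor h n)) = tensor (\<lambda>t. (\<i> * of_int n) ^ k * (vderiv ^^ j) h t) n"
proof -
  have "(partial_x ^^ k) (tensor h n) = tensor (\<lambda>t. (\<i> * of_int n) ^ k * h t) n"
    by (induction k) (simp_all add: partial_x_tensor mult_ac)
  moreover have "smooth_periodic ((vderiv ^^ j) h) \<and> (partial_t ^^ j) (tensor (\<lambda>t. c * h t) n) = tensor (\<lambda>t. c * (vderiv ^^ j) h t) n" for c
    using assms by (induction j) (simp_all add: partial_t_tensor vderiv_cmult smooth_periodic_vderiv smooth_periodic_cmult)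
  ultimately show ?thesis by simp
qed

text \<open>On a fixed row the seminorms of the test space reduce to uniform bounds on derivatives
  in \<open>t\<close> alone, with a factor depending on \<open>n\<close> and \<open>N\<close>
  only.\<close>

lemma C_k_norm_tensor_le:
  assumes h: "smooth_periodic h" and e: "\<And>j t. j \<le> N \<Longrightarrow> norm ((vderiv ^^ j) h t) \<le> e"
  shows "\<bar>C_k_norm N (tensor h n)\<bar> \<le> (\<Sum>j\<le>N. \<Sum>k\<le>N - j. \<bar>of_int n\<bar> ^ k) * e"
proof -
  have "\<bar>SUP z. norm ((partial_t ^^ j) ((partial_x ^^ k) (tensor h n)) z)\<bar> \<le> \<bar>of_int n\<bar> ^ k * e" if "j \<le> N" for j k
  proof (rule cSup_abs_le)
    fix y assume "y \<in> range (\<lambda>z. norm ((partial_t ^^ j) ((partial_x ^^ k) (tensor h n)) z))"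
    then obtain z where "y = norm (tensor (\<lambda>t. (\<i> * of_int n) ^ k * (vderiv ^^ j) h t) n z)"
      unfolding tensor_partials[OF h] by blast
    then show "\<bar>y\<bar> \<le> \<bar>of_int n\<bar> ^ k * e"
      using e[OF that, of "fst z"]
      by (simp add: tensor_def case_prod_unfold norm_mult norm_power mult_left_mono)
  qed auto
  then have "(\<Sum>j\<le>N. \<Sum>k\<le>N - j. \<bar>SUP z. norm ((partial_t ^^ j) ((partial_x ^^ k) (tensor h n)) z)\<bar>) \<le> (\<Sum>j\<le>N. \<Sum>k\<le>N - j. \<bar>of_int n\<bar> ^ k * e)"
    by (intro sum_mono) auto
  moreover have "\<bar>C_k_norm N (tensor h n)\<bar> \<le> (\<Sum>j\<le>N. \<Sum>k\<le>N - j. \<bar>SUP z. norm ((partial_t ^^ j) ((partial_x ^^ k) (tensor h n)) z)\<bar>)"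
    unfolding C_k_norm_def by (intro order_trans[OF sum_abs] sum_mono) auto
  ultimately show ?thesis by (simp add: sum_distrib_right)
qed

definition fourier_rem :: "(real \<Rightarrow> complex) \<Rightarrow> nat \<Rightarrow> real \<Rightarrow> complex" where
  "fourier_rem h M t = h t - fourier_sum h M t"

lemma smooth_periodic_fourier_sum: "smooth_periodic (fourier_sum h M)"
  unfolding fourier_sum_def[abs_def] by (intro smooth_periodic_sum smooth_periodic_mult smooth_periodic_const smooth_periodic_character)

lemma fourier_rem_alt: "fourier_rem h M = (\<lambda>t. h t + (-1) * fourier_sum h M t)"
  by (auto simp: fourier_rem_def)

lemma smooth_periodic_fourier_rem: "smooth_periodic h \<Longrightarrow> smooth_periodic (fourier_rem h M)"
  unfolding fourier_rem_alt by (intro smooth_periodic_add smooth_periodic_cmult smooth_periodic_fourier_sum)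

lemma vderiv_fourier_sum: "smooth_periodic h \<Longrightarrow> vderiv (fourier_sum h M) = fourier_sum (vderiv h) M"
proof -
  assume h: "smooth_periodic h"
  have "vderiv (fourier_sum h M) = (\<lambda>t. \<Sum>m\<in>{-int M..int M}. vderiv (\<lambda>t. circle_coeff h m * character m t) t)"
    unfolding fourier_sum_def[abs_def] by (intro vderiv_sum smooth_periodic_cmult smooth_periodic_character)
  then show ?thesis
    unfolding fourier_sum_def[abs_def] vderiv_cmult[OF smooth_periodic_character] vderiv_character circle_coeff_vderiv[OF h] by (simp only: mult_ac)
qed

lemma vderiv_fourier_rem: "smooth_periodic h \<Longrightarrow> vderiv (fourier_rem h M) = fourier_rem (vderiv h) M"
  unfolding fourier_rem_alt
  by (simp only: vderiv_add[OF _ smooth_periodic_cmult[OF smooth_periodic_fourier_sum]] vderiv_cmult[OF smooth_periodic_fourier_sum] vderiv_fourier_sum)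

lemma vderiv_funpow_add: "smooth_periodic g \<Longrightarrow> smooth_periodic h \<Longrightarrow> (vderiv ^^ j) (\<lambda>t. g t + h t) = (\<lambda>t. (vderiv ^^ j) g t + (vderiv ^^ j) h t)"
proof (induction j arbitrary: g h)
  case (Suc j) then show ?case by (simp add: funpow_swap1 vderiv_add smooth_periodic_vderiv del: funpow.simps(2) add: funpow_Suc_right)
qed simp

text \<open>Partial sums commute with differentiation, so both terms of the Leibniz rule are
  products of the same kind, with \<open>H\<close> or \<open>h\<close> replaced by its derivative;
  hence the induction over all \<open>H\<close> and \<open>h\<close>.\<close>

lemma fourier_rem_mult_uniform:
  assumes "smooth_periodic H" "smooth_periodic h"
  shows "uniform_limit UNIV (\<lambda>M. (vderiv ^^ j) (\<lambda>t. H t * fourier_rem h M t)) (\<lambda>_. 0) sequentially"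
  using assms
proof (induction j arbitrary: H h)
  case 0
  obtain B where B: "B > 0" "\<And>t. norm (H t) \<le> B" using smooth_periodic_bounded[OF 0(1)] by blast
  show ?case
  proof (rule uniform_limitI)
    fix e :: real assume "e > 0"
    then have "\<forall>\<^sub>F M in sequentially. \<forall>t\<in>UNIV. dist (fourier_sum h M t) (h t) < e / B"
      using fourier_sum_uniform[OF 0(2)] B by (intro uniform_limitD) auto
    then show "\<forall>\<^sub>F M in sequentially. \<forall>t\<in>UNIV. dist ((vderiv ^^ 0) (\<lambda>t. H t * fourier_rem h M t) t) 0 < e"
    proof eventually_elim
      case (elim M)
      show ?case
      proof
        fix t
        have "norm (H t) * norm (fourier_rem h M t) \<le> B * norm (fourier_rem h M t)"
          using B by (intro mult_right_mono) auto
        also have "\<dots> < B * (e / B)"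
          using elim B by (intro mult_strict_left_mono) (auto simp: fourier_rem_def dist_norm norm_minus_commute)
        finally show "dist ((vderiv ^^ 0) (\<lambda>t. H t * fourier_rem h M t) t) 0 < e"
          using B by (simp add: norm_mult)
      qed
    qed
  qed
next
  case (Suc j)
  have eq: "(vderiv ^^ Suc j) (\<lambda>t. H t * fourier_rem h M t) =
     (\<lambda>t. (vderiv ^^ j) (\<lambda>t. H t * fourier_rem (vderiv h) M t) t + (vderiv ^^ j) (\<lambda>t. vderiv H t * fourier_rem h M t) t)" for M
    using Suc.prems
    by (simp add: funpow_Suc_right vderiv_mult smooth_periodic_fourier_rem vderiv_fourier_rem vderiv_funpow_add smooth_periodic_mult smooth_periodic_vderiv del: funpow.simps(2))
  have "uniform_limit UNIV (\<lambda>M t. (vderiv ^^ j) (\<lambda>t. H t * fourier_rem (vderiv h) M t) t + (vderiv ^^ j) (\<lambda>t. vderiv H t * fourier_rem h M t) t) (\<lambda>_. 0 + 0) sequentially"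
    using Suc by (intro uniform_limit_add) (auto intro: smooth_periodic_vderiv)
  then show ?case unfolding eq by simp
qed

section \<open>Expanding a pairing in a Fourier series\<close>

lemma dist_tensor_scale:
  assumes "u \<in> distributions" "smooth_periodic h"
  shows "u (tensor (\<lambda>t. c * h t) n) = c * u (tensor h n)"
proof -
  have "tensor (\<lambda>t. c * h t) n = (\<lambda>z. c * tensor h n z)" by (auto simp: tensor_def mult_ac)
  then show ?thesis using assms tensor_test[OF assms(2)] unfolding distributions_def by auto
qed

lemma dist_tensor_add:
  assumes "u \<in> distributions" "smooth_periodic g" "smooth_periodic h"
  shows "u (tensor (\<lambda>t. g t + h t) n) = u (tensor g n) + u (tensor h n)"
proof -
  have "tensor (\<lambda>t. g t + h t) n = (\<lambda>z. tensor g n z + tensor h n z)" by (auto simp: tensor_def algebra_simps)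
  then show ?thesis using assms tensor_test unfolding distributions_def by auto
qed

lemma dist_tensor_sum:
  assumes "u \<in> distributions" "\<And>i. i \<in> I \<Longrightarrow> smooth_periodic (g i)"
  shows "u (tensor (\<lambda>t. \<Sum>i\<in>I. c i * g i t) n) = (\<Sum>i\<in>I. c i * u (tensor (g i) n))"
proof -
  have 0: "u (tensor (\<lambda>_. 0) n) = 0" using dist_tensor_scale[OF assms(1) smooth_periodic_const, of 0 0 n] by simp
  show ?thesis using assms(2)
  proof (induction I rule: infinite_finite_induct)
    case (insert i I)
    have "u (tensor (\<lambda>t. c i * g i t + (\<Sum>j\<in>I. c j * g j t)) n) = u (tensor (\<lambda>t. c i * g i t) n) + u (tensor (\<lambda>t. \<Sum>j\<in>I. c j * g j t) n)"
      by (intro dist_tensor_add assms(1) smooth_periodic_sum smooth_periodic_cmult insert.prems) auto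
    then show ?case using insert by (simp add: dist_tensor_scale assms(1))
  qed (simp_all add: 0)
qed

text \<open>Only \<open>h\<close> is expanded, while \<open>H\<close> stays inside the pairing. With
  \<open>H\<close> constant the terms are exponentials, with \<open>H\<close> a phase factor they
  are waves, so both changes of basis are instances.\<close>

lemma dist_tensor_fourier:
  assumes u: "u \<in> distributions" and H: "smooth_periodic H" and h: "smooth_periodic h"
  shows "(\<lambda>M. \<Sum>k\<in>{-int M..int M}. circle_coeff h k * u (tensor (\<lambda>t. H t * character k t) n)) \<longlonglongrightarrow> u (tensor (\<lambda>t. H t * h t) n)"
proof -
  obtain C N where CN: "\<And>\<phi>. \<phi> \<in> test_functions \<Longrightarrow> norm (u \<phi>) \<le> C * C_k_norm N \<phi>"
    using u unfolding distributions_def by blast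
  define K where "K = (\<Sum>j\<le>N. \<Sum>k\<le>N - j. \<bar>of_int n :: real\<bar> ^ k)"
  have K: "K \<ge> 0" unfolding K_def by (intro sum_nonneg) auto
  have split: "u (tensor (\<lambda>t. H t * h t) n) = (\<Sum>k\<in>{-int M..int M}. circle_coeff h k * u (tensor (\<lambda>t. H t * character k t) n)) + u (tensor (\<lambda>t. H t * fourier_rem h M t) n)" for M
  proof -
    have "(\<lambda>t. H t * h t) = (\<lambda>t. (\<Sum>k\<in>{-int M..int M}. circle_coeff h k * (H t * character k t)) + H t * fourier_rem h M t)"
      by (simp add: fourier_rem_def fourier_sum_def sum_distrib_left algebra_simps)
    then have "u (tensor (\<lambda>t. H t * h t) n) = u (tensor (\<lambda>t. (\<Sum>k\<in>{-int M..int M}. circle_coeff h k * (H t * character k t)) + H t * fourier_rem h M t) n)"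
      by simp
    also have "\<dots> = u (tensor (\<lambda>t. \<Sum>k\<in>{-int M..int M}. circle_coeff h k * (H t * character k t)) n) + u (tensor (\<lambda>t. H t * fourier_rem h M t) n)"
      by (intro dist_tensor_add u smooth_periodic_sum smooth_periodic_cmult smooth_periodic_mult[OF H] smooth_periodic_character smooth_periodic_fourier_rem h)
    also have "u (tensor (\<lambda>t. \<Sum>k\<in>{-int M..int M}. circle_coeff h k * (H t * character k t)) n) = (\<Sum>k\<in>{-int M..int M}. circle_coeff h k * u (tensor (\<lambda>t. H t * character k t) n))"
      by (intro dist_tensor_sum u smooth_periodic_mult H smooth_periodic_character)
    finally show ?thesis .
  qed
  have "(\<lambda>M. u (tensor (\<lambda>t. H t * fourier_rem h M t) n)) \<longlonglongrightarrow> 0"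
  proof (rule LIMSEQ_I)
    fix e :: real assume e: "e > 0"
    \<comment> \<open>The summand 1 keeps the denominator positive when the product vanishes and
      makes the final inequality strict.\<close>
    define d where "d = e / (\<bar>C\<bar> * K + 1)"
    have CK: "\<bar>C\<bar> * K + 1 > 0" using K by (simp add: add_nonneg_pos)
    then have d: "d > 0" unfolding d_def using e by simp
    have "\<forall>\<^sub>F M in sequentially. \<forall>t\<in>UNIV. dist ((vderiv ^^ j) (\<lambda>t. H t * fourier_rem h M t) t) 0 < d" for j
      by (rule uniform_limitD[OF fourier_rem_mult_uniform[OF H h] d])
    then have "\<forall>\<^sub>F M in sequentially. \<forall>j\<in>{..N}. \<forall>t\<in>UNIV. dist ((vderiv ^^ j) (\<lambda>t. H t * fourier_rem h M t) t) 0 < d"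
      by (intro eventually_ball_finite) auto
    then obtain M0 where M0: "\<And>M j t. M \<ge> M0 \<Longrightarrow> j \<le> N \<Longrightarrow> norm ((vderiv ^^ j) (\<lambda>t. H t * fourier_rem h M t) t) < d"
      by (auto simp: eventually_sequentially)
    have "norm (u (tensor (\<lambda>t. H t * fourier_rem h M t) n) - 0) < e" if M: "M \<ge> M0" for M
    proof -
      have s: "smooth_periodic (\<lambda>t. H t * fourier_rem h M t)" by (intro smooth_periodic_mult H smooth_periodic_fourier_rem h)
      have "norm (u (tensor (\<lambda>t. H t * fourier_rem h M t) n)) \<le> C * C_k_norm N (tensor (\<lambda>t. H t * fourier_rem h M t) n)"
        by (intro CN tensor_test s)
      \<comment> \<open>Continuity of \<open>u\<close> provides a constant \<open>C\<close> of
        unknown sign, hence the absolute values.\<close>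
      also have "\<dots> \<le> \<bar>C\<bar> * \<bar>C_k_norm N (tensor (\<lambda>t. H t * fourier_rem h M t) n)\<bar>"
        by (metis abs_ge_self abs_mult)
      also have "\<dots> \<le> \<bar>C\<bar> * (K * d)"
        unfolding K_def by (intro mult_left_mono C_k_norm_tensor_le s less_imp_le[OF M0[OF M]]) auto
      also have "\<dots> < (\<bar>C\<bar> * K + 1) * d" using d by (simp add: algebra_simps)
      also have "\<dots> = e" unfolding d_def using CK by simp
      finally show ?thesis by simp
    qed
    then show "\<exists>M0. \<forall>M\<ge>M0. norm (u (tensor (\<lambda>t. H t * fourier_rem h M t) n) - 0) < e" by blast
  qed
  then have "(\<lambda>M. u (tensor (\<lambda>t. H t * h t) n) - u (tensor (\<lambda>t. H t * fourier_rem h M t) n)) \<longlonglongrightarrow> u (tensor (\<lambda>t. H t * h t) n) - 0"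
    by (intro tendsto_intros)
  moreover have "u (tensor (\<lambda>t. H t * h t) n) - u (tensor (\<lambda>t. H t * fourier_rem h M t) n) = (\<Sum>k\<in>{-int M..int M}. circle_coeff h k * u (tensor (\<lambda>t. H t * character k t) n))" for M
    using split[of M] by simp
  ultimately show ?thesis by simp
qed

text \<open>The signs come from the bilinear pairing: the coefficient at a frequency is tested
  against the exponential of the opposite frequency.\<close>

lemma fourier_coeff_tensor: "fourier_coeff u \<tau> \<xi> = u (tensor (character (-\<tau>)) (-\<xi>)) / complex_of_real ((2 * pi)\<^sup>2)"
proof -
  have "(\<lambda>(t, x). exp (- \<i> * complex_of_real (t * of_int \<tau> + x * of_int \<xi>))) = tensor (character (-\<tau>)) (-\<xi>)"
    by (auto simp: tensor_def cis_conv_exp exp_add[symmetric] algebra_simps)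
  then show ?thesis by (simp add: fourier_coeff_def)
qed

section \<open>The periodic primitive\<close>

lemma smooth_on_circle_smooth_periodic:
  assumes "smooth_on_circle a"
  shows "smooth_periodic (\<lambda>t. complex_of_real (a t))"
proof -
  have d: "((deriv ^^ n) a has_real_derivative (deriv ^^ Suc n) a t) (at t)" for n t
    using assms unfolding smooth_on_circle_def
    by (simp add: DERIV_deriv_iff_real_differentiable)
  have "C_order k (\<lambda>t. complex_of_real ((deriv ^^ n) a t))" for k n
  proof (induction k arbitrary: n)
    case 0
    have "isCont ((deriv ^^ n) a) t" for t using d DERIV_isCont by blast
    then show ?case by (auto intro!: continuous_intros continuous_at_imp_continuous_on)
  next
    case (Suc k)
    have "((\<lambda>t. complex_of_real ((deriv ^^ n) a t)) has_vector_derivative complex_of_real ((deriv ^^ Suc n) a t)) (at t)" for t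
      using d has_vector_derivative_of_real by blast
    then show ?case using Suc.IH by (rule C_order_SucI)
  qed
  from this[of _ 0] show ?thesis using assms unfolding smooth_periodic_def smooth_on_circle_def by simp
qed

text \<open>The increment of a primitive \<open>A\<close> over one period has derivative zero by
  periodicity of \<open>b\<close>. Its constant value is the integral of \<open>b\<close> over a
  period, which vanishes since the mean was subtracted.\<close>

lemma phase_exists:
  assumes "smooth_on_circle a"
  shows "\<exists>A. phase A (\<lambda>t. a t - circle_mean a)"
proof -
  define b where "b t = a t - circle_mean a" for t
  note sa = smooth_on_circle_smooth_periodic[OF assms]
  have ac: "continuous_on S a" for S
    using smooth_periodic_continuous[OF sa, of S] continuous_on_Re[of S "\<lambda>t. complex_of_real (a t)"] by simp
  have bc: "isCont b t" for t
    using ac[of UNIV] unfolding b_def by (simp add: continuous_on_eq_continuous_at)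
  have "\<exists>F. \<forall>x. -\<infinity> < ereal x \<longrightarrow> ereal x < \<infinity> \<longrightarrow> (F has_vector_derivative b x) (at x)"
    by (rule einterval_antiderivative) (auto simp: bc)
  then obtain A where A: "\<And>t. (A has_real_derivative b t) (at t)"
    by (auto simp: has_real_derivative_iff_has_vector_derivative)
  have per: "b (t + 2 * pi) = b t" for t using assms unfolding b_def smooth_on_circle_def by simp
  have "((\<lambda>t. A (t + 2 * pi) - A t) has_real_derivative 0) (at t)" for t
    using DERIV_diff[OF DERIV_shift[THEN iffD1, OF A[of "t + 2 * pi"]] A[of t]] per[of t] by simp
  then have const: "A (t + 2 * pi) - A t = A (0 + 2 * pi) - A 0" for t
    using DERIV_isconst_all[of "\<lambda>t. A (t + 2 * pi) - A t"] by blast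
  have "(b has_integral A (2 * pi) - A 0) {0..2 * pi}"
    using A by (intro fundamental_theorem_of_calculus)
      (auto simp: has_real_derivative_iff_has_vector_derivative intro: has_vector_derivative_at_within)
  moreover have "(b has_integral (integral {0..2 * pi} a - 2 * pi * circle_mean a)) {0..2 * pi}"
    unfolding b_def
    using has_integral_diff[OF integrable_integral[OF integrable_continuous_interval[OF ac]] has_integral_const_real[of "circle_mean a" 0 "2 * pi"]]
    by simp
  ultimately have "A (2 * pi) - A 0 = integral {0..2 * pi} a - 2 * pi * circle_mean a"
    by (rule has_integral_unique)
  then have "A (t + 2 * pi) = A t" for t using const[of t] by (simp add: circle_mean_def)
  moreover have "smooth_periodic (\<lambda>t. complex_of_real (b t))"
    using smooth_periodic_add[OF sa smooth_periodic_const[of "- complex_of_real (circle_mean a)"]] by (simp add: b_def)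
  ultimately have "phase A b" using A by unfold_locales
  then show ?thesis unfolding b_def by blast
qed

section \<open>Removing the mean of a distribution\<close>

lemma vector_derivative_shift:
  fixes h :: "real \<Rightarrow> complex"
  shows "vector_derivative (\<lambda>t. h (t + c)) (at t) = vector_derivative h (at (t + c))"
proof -
  \<comment> \<open>Stated as an equivalence for every \<open>D\<close>, so that the choice operator
    in \<open>vector_derivative\<close> sees the same predicate on both sides and differentiability
    need not be assumed.\<close>
  have "((\<lambda>t. h (t + c)) has_vector_derivative D) (at t) \<longleftrightarrow> (h has_vector_derivative D) (at (t + c))" for D
    using has_vector_derivative_shift[of h D t c] has_vector_derivative_shift[of "\<lambda>t. h (t + c)" D "t + c" "-c"] by auto
  then show ?thesis unfolding vector_derivative_def by simp
qed

lemma test_functions_partial: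
  assumes "\<phi> \<in> test_functions"
  shows "partial_t \<phi> \<in> test_functions" "partial_x \<phi> \<in> test_functions"
proof -
  have C: "C_k k (partial_t \<phi>)" "C_k k (partial_x \<phi>)" for k
    using assms C_k.simps(2) unfolding test_functions_def by blast+
  have p: "\<phi> (t + 2 * pi, x) = \<phi> (t, x)" "\<phi> (t, x + 2 * pi) = \<phi> (t, x)" for t x
    using assms unfolding test_functions_def by auto
  have "partial_t \<phi> (t + 2 * pi, x) = partial_t \<phi> (t, x)" "partial_t \<phi> (t, x + 2 * pi) = partial_t \<phi> (t, x)"
    "partial_x \<phi> (t + 2 * pi, x) = partial_x \<phi> (t, x)" "partial_x \<phi> (t, x + 2 * pi) = partial_x \<phi> (t, x)" for t x
    unfolding partial_t_def partial_x_def
    using vector_derivative_shift[of "\<lambda>s. \<phi> (s, x)" "2 * pi" t] vector_derivative_shift[of "\<lambda>y. \<phi> (t, y)" "2 * pi" x]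
    by (simp_all add: p)
  with C show "partial_t \<phi> \<in> test_functions" "partial_x \<phi> \<in> test_functions"
    unfolding test_functions_def by blast+
qed

lemma test_functions_continuous: "\<phi> \<in> test_functions \<Longrightarrow> continuous_on S \<phi>"
  unfolding test_functions_def using C_k.simps(1) continuous_on_subset by blast

text \<open>The suprema in \<open>C_k_norm\<close> are over the whole plane and dominate pointwise
  values only for bounded families. Periodicity reduces boundedness to a compact square.\<close>

lemma test_functions_bdd:
  assumes \<phi>: "\<phi> \<in> test_functions"
  shows "bdd_above (range (\<lambda>z. norm (\<phi> z)))"
proof -
  have "compact (\<phi> ` cbox (0, 0) (2 * pi, 2 * pi))"
    by (intro compact_continuous_image test_functions_continuous \<phi> compact_cbox)
  then obtain B where B: "\<And>z. z \<in> cbox (0, 0) (2 * pi, 2 * pi) \<Longrightarrow> norm (\<phi> z) \<le> B"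
    by (metis bounded_iff compact_imp_bounded imageI)
  have "norm (\<phi> (t, x)) \<le> B" for t x
  proof -
    obtain k l :: int where kl: "t + of_int k * (2 * pi) \<in> {0..2 * pi}" "x + of_int l * (2 * pi) \<in> {0..2 * pi}"
      using exists_period_shift by blast
    have "\<phi> (t + of_int k * (2 * pi), x + of_int l * (2 * pi)) = \<phi> (t, x + of_int l * (2 * pi))"
      using \<phi> by (intro periodic_int[where f="\<lambda>t. \<phi> (t, _)"]) (auto simp: test_functions_def)
    also have "\<dots> = \<phi> (t, x)"
      using \<phi> by (intro periodic_int) (auto simp: test_functions_def)
    finally show ?thesis using B[of "(t + of_int k * (2 * pi), x + of_int l * (2 * pi))"] kl
      by (auto simp: cbox_Pair_eq)
  qed
  then show ?thesis by (intro bdd_aboveI[of _ B]) auto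
qed

lemma norm_le_C_k_norm:
  assumes \<phi>: "\<phi> \<in> test_functions"
  shows "norm (\<phi> z) \<le> C_k_norm N \<phi>"
proof -
  let ?S = "\<lambda>j k. SUP z. norm ((partial_t ^^ j) ((partial_x ^^ k) \<phi>) z)"
  have "(partial_x ^^ k) \<phi> \<in> test_functions" for k by (induction k) (auto intro: \<phi> test_functions_partial)
  then have t: "(partial_t ^^ j) ((partial_x ^^ k) \<phi>) \<in> test_functions" for j k
    by (induction j) (auto intro: test_functions_partial)
  have up: "norm ((partial_t ^^ j) ((partial_x ^^ k) \<phi>) z) \<le> ?S j k" for j k z
    by (intro cSUP_upper test_functions_bdd t) auto
  have S0: "?S j k \<ge> 0" for j k using up[of j k] norm_ge_zero order_trans by blast
  have "norm (\<phi> z) \<le> ?S 0 0" using up[of 0 0 z] by simp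
  also have "\<dots> \<le> (\<Sum>k\<le>N - 0. ?S 0 k)" by (rule member_le_sum[of 0 _ "?S 0"]) (simp, rule S0, simp)
  also have "\<dots> \<le> C_k_norm N \<phi>" unfolding C_k_norm_def
    using S0 by (intro member_le_sum[of 0 "{..N}" "\<lambda>j. \<Sum>k\<le>N - j. ?S j k"]) (auto intro: sum_nonneg)
  finally show ?thesis .
qed

text \<open>Membership in \<open>Hmix\<close> includes being a distribution. Integration against a
  constant is bounded by the sup norm, which every \<open>C_k_norm\<close> dominates, so the order
  \<open>N\<close> of \<open>u\<close> still works.\<close>

lemma minus_mean_distribution:
  assumes u: "u \<in> distributions"
  shows "minus_mean u \<in> distributions"
proof -
  define c where "c = fourier_coeff u 0 0"
  let ?Q = "cbox (0, 0) (2 * pi, 2 * pi) :: (real \<times> real) set"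
  have int: "(\<lambda>z. c * \<phi> z) integrable_on ?Q" if "\<phi> \<in> test_functions" for \<phi>
    using that by (intro integrable_continuous continuous_intros test_functions_continuous)
  have mm: "minus_mean u \<phi> = u \<phi> - integral ?Q (\<lambda>z. c * \<phi> z)" for \<phi>
    unfolding minus_mean_def dist_diff_def dist_of_fun_def c_def ..
  obtain C N where CN: "\<And>\<phi>. \<phi> \<in> test_functions \<Longrightarrow> norm (u \<phi>) \<le> C * C_k_norm N \<phi>"
    using u unfolding distributions_def by blast
  have "minus_mean u (\<lambda>z. \<phi> z + \<psi> z) = minus_mean u \<phi> + minus_mean u \<psi>"
    if "\<phi> \<in> test_functions" "\<psi> \<in> test_functions" for \<phi> \<psi>
    using Henstock_Kurzweil_Integration.integral_add[OF int[OF that(1)] int[OF that(2)]] that u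
    unfolding mm distributions_def by (simp add: distrib_left)
  moreover have "minus_mean u (\<lambda>z. d * \<phi> z) = d * minus_mean u \<phi>" if "\<phi> \<in> test_functions" for \<phi> d
  proof -
    have "u (\<lambda>z. d * \<phi> z) = d * u \<phi>" using that u unfolding distributions_def by blast
    moreover have "(\<lambda>z. c * (d * \<phi> z)) = (\<lambda>z. d * (c * \<phi> z))" by (simp add: mult_ac)
    then have "integral ?Q (\<lambda>z. c * (d * \<phi> z)) = d * integral ?Q (\<lambda>z. c * \<phi> z)"
      by (simp only: integral_mult_right)
    ultimately show ?thesis unfolding mm by (simp only: right_diff_distrib)
  qed
  moreover have "norm (minus_mean u \<phi>) \<le> (C + norm c * measure lborel ?Q) * C_k_norm N \<phi>" if \<phi>: "\<phi> \<in> test_functions" for \<phi>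
  proof -
    have "norm (integral ?Q (\<lambda>z. c * \<phi> z)) \<le> (norm c * C_k_norm N \<phi>) * measure lborel ?Q"
    proof (rule has_integral_bound[OF _ integrable_integral[OF int[OF \<phi>]]])
      show "0 \<le> norm c * C_k_norm N \<phi>"
        using order_trans[OF norm_ge_zero norm_le_C_k_norm[OF \<phi>]] by simp
      show "\<And>z. z \<in> ?Q \<Longrightarrow> norm (c * \<phi> z) \<le> norm c * C_k_norm N \<phi>"
        unfolding norm_mult by (intro mult_left_mono norm_le_C_k_norm \<phi>) auto
    qed
    then show ?thesis
      using CN[OF \<phi>] norm_triangle_ineq4[of "u \<phi>" "integral ?Q (\<lambda>z. c * \<phi> z)"] unfolding mm
      by (simp add: algebra_simps)
  qed
  ultimately show ?thesis unfolding distributions_def by blast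
qed

lemma fourier_coeff_minus_mean:
  "fourier_coeff (minus_mean u) \<tau> \<xi> = (if \<tau> = 0 \<and> \<xi> = 0 then 0 else fourier_coeff u \<tau> \<xi>)"
proof -
  define c where "c = fourier_coeff u 0 0"
  let ?Q = "cbox (0, 0) (2 * pi, 2 * pi) :: (real \<times> real) set"
  have "integral ?Q (\<lambda>z. c * tensor (character m) n z) = (if m = 0 \<and> n = 0 then c * (2 * pi)\<^sup>2 else 0)" for m n
  proof -
    have "integral ?Q (\<lambda>z. c * tensor (character m) n z) = integral (cbox 0 (2 * pi)) (\<lambda>t. integral (cbox 0 (2 * pi)) (\<lambda>x. c * tensor (character m) n (t, x)))"
      by (intro integral_prod_continuous continuous_intros test_functions_continuous tensor_test smooth_periodic_character)
    also have "\<dots> = integral {0..2 * pi} (\<lambda>t. integral {0..2 * pi} (\<lambda>x. (c * character m t) * character n x))"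
      by (simp add: tensor_def mult_ac)
    also have "\<dots> = integral {0..2 * pi} (\<lambda>t. (c * integral {0..2 * pi} (character n)) * character m t)"
    proof -
      have "x * y * z = x * z * y" for x y z :: complex by simp
      then have "integral {0..2 * pi} (\<lambda>x. (c * character m t) * character n x) = (c * integral {0..2 * pi} (character n)) * character m t" for t
        unfolding integral_mult_right .
      then show ?thesis by (simp only:)
    qed
    also have "\<dots> = (c * integral {0..2 * pi} (character n)) * integral {0..2 * pi} (character m)"
      by (rule integral_mult_right)
    finally have eq: "integral ?Q (\<lambda>z. c * tensor (character m) n z) = (c * integral {0..2 * pi} (character n)) * integral {0..2 * pi} (character m)" .
    show ?thesis unfolding eq integral_character by (simp add: power2_eq_square)
  qed
  note box = this[of "-\<tau>" "-\<xi>"]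
  have "u (tensor (character (-\<tau>)) (-\<xi>)) - integral ?Q (\<lambda>z. c * tensor (character (-\<tau>)) (-\<xi>) z)
      = u (tensor (character (-\<tau>)) (-\<xi>)) - (if \<tau> = 0 \<and> \<xi> = 0 then c * (2 * pi)\<^sup>2 else 0)" unfolding box by simp
  then have "fourier_coeff (minus_mean u) \<tau> \<xi> = fourier_coeff u \<tau> \<xi> - (if \<tau> = 0 \<and> \<xi> = 0 then c else 0)"
    unfolding fourier_coeff_tensor minus_mean_def dist_diff_def dist_of_fun_def c_def[unfolded fourier_coeff_tensor, symmetric]
    by (auto simp: diff_divide_distrib)
  then show ?thesis by (simp add: c_def)
qed

section \<open>Small divisors\<close>

text \<open>For each denominator \<open>q\<close>, rounding the multiple of \<alpha> down gives an
  error below \<open>1 / q\<close>. The consequence wanted is \<open>r > 1\<close>, so that powers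
  with exponent \<open>1 - r\<close> decrease.\<close>

lemma irrationality_measure_ge_1: "irrationality_measure \<alpha> \<ge> 1"
proof -
  let ?P = "{(p :: int, q :: nat). q > 0 \<and> \<bar>\<alpha> - of_int p / of_nat q\<bar> < of_nat q powr (- 1)}"
  have "inj (\<lambda>q::nat. (\<lfloor>\<alpha> * real (Suc q)\<rfloor>, Suc q))" by (auto intro: injI)
  moreover have "range (\<lambda>q::nat. (\<lfloor>\<alpha> * real (Suc q)\<rfloor>, Suc q)) \<subseteq> ?P"
  proof (rule image_subsetI)
    fix q :: nat
    let ?q = "real (Suc q)"
    have "\<bar>\<alpha> * ?q - of_int \<lfloor>\<alpha> * ?q\<rfloor>\<bar> < 1" by linarith
    then have "\<bar>\<alpha> - of_int \<lfloor>\<alpha> * ?q\<rfloor> / ?q\<bar> * ?q < 1"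
    proof -
      have "\<bar>\<alpha> - of_int \<lfloor>\<alpha> * ?q\<rfloor> / ?q\<bar> * ?q = \<bar>(\<alpha> - of_int \<lfloor>\<alpha> * ?q\<rfloor> / ?q) * ?q\<bar>"
        by (simp add: abs_mult)
      also have "(\<alpha> - of_int \<lfloor>\<alpha> * ?q\<rfloor> / ?q) * ?q = \<alpha> * ?q - of_int \<lfloor>\<alpha> * ?q\<rfloor>"
        by (simp add: left_diff_distrib)
      finally show ?thesis using \<open>\<bar>\<alpha> * ?q - of_int \<lfloor>\<alpha> * ?q\<rfloor>\<bar> < 1\<close> by linarith
    qed
    then have "\<bar>\<alpha> - of_int \<lfloor>\<alpha> * ?q\<rfloor> / ?q\<bar> < ?q powr - 1"
      by (simp add: powr_minus pos_less_divide_eq inverse_eq_divide del: of_nat_Suc)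
    then show "(\<lfloor>\<alpha> * ?q\<rfloor>, Suc q) \<in> ?P" by simp
  qed
  ultimately have "infinite ?P" using finite_subset range_inj_infinite by blast
  then have "ereal 1 \<in> ereal ` {\<nu>. \<nu> > 0 \<and> infinite {(p :: int, q :: nat). q > 0 \<and> \<bar>\<alpha> - of_int p / of_nat q\<bar> < of_nat q powr (- \<nu>)}}"
    by (intro imageI) auto
  then show ?thesis unfolding irrationality_measure_def one_ereal_def by (rule Sup_upper)
qed

text \<open>An exponent above the irrationality measure admits only finitely many exceptional
  fractions, and irrationality makes the error of each exceptional one positive.\<close>

lemma small_divisor_bound:
  assumes irr: "\<alpha> \<notin> \<rat>" and r: "ereal r > irrationality_measure \<alpha>"
  obtains c where "c > 0" "\<And>m n :: int. n \<noteq> 0 \<Longrightarrow> \<bar>of_int m - of_int n * \<alpha>\<bar> \<ge> c * \<bar>of_int n\<bar> powr (1 - r)"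
proof -
  have r1: "r > 1" using le_less_trans[OF irrationality_measure_ge_1 r] by (simp add: one_ereal_def)
  define P where "P = {(p :: int, q :: nat). q > 0 \<and> \<bar>\<alpha> - of_int p / of_nat q\<bar> < of_nat q powr (- r)}"
  have "finite P"
  proof (rule ccontr)
    assume "infinite P"
    then have "ereal r \<le> irrationality_measure \<alpha>"
      unfolding irrationality_measure_def P_def using r1 by (intro Sup_upper imageI) auto
    with r show False by simp
  qed
  define d where "d = (\<lambda>(p :: int, q :: nat). \<bar>\<alpha> - of_int p / of_nat q\<bar> * of_nat q powr r)"
  \<comment> \<open>The minimum settles the exceptional pairs; the inserted 1 settles all others and
    the case that there is no exception.\<close>
  define c where "c = Min (insert 1 (d ` P))"
  have ne: "\<alpha> \<noteq> of_int p / of_nat q" for p :: int and q :: nat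
    using irr Rats_divide[OF Rats_of_int Rats_of_nat] by metis
  have "c > 0"
    unfolding c_def using \<open>finite P\<close> ne by (subst Min_gr_iff) (auto simp: d_def P_def)
  have pos: "\<bar>\<alpha> - of_int p / of_nat q\<bar> \<ge> c * of_nat q powr (- r)" if q: "q > 0" for p :: int and q :: nat
  proof (cases "(p, q) \<in> P")
    case True
    then have "c \<le> d (p, q)" unfolding c_def using \<open>finite P\<close> by (intro Min_le) auto
    then have "c * of_nat q powr (-r) \<le> d (p, q) * of_nat q powr (-r)" by (intro mult_right_mono) auto
    also have "\<dots> = \<bar>\<alpha> - of_int p / of_nat q\<bar>" unfolding d_def using q by (simp add: mult.assoc powr_add[symmetric])
    finally show ?thesis .
  next
    case False
    have "c \<le> 1" unfolding c_def using \<open>finite P\<close> by (intro Min_le) auto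
    then have "c * of_nat q powr (-r) \<le> 1 * of_nat q powr (-r)" by (intro mult_right_mono) auto
    moreover have "of_nat q powr (-r) \<le> \<bar>\<alpha> - of_int p / of_nat q\<bar>" using False q by (auto simp: P_def)
    ultimately show ?thesis by linarith
  qed
  have "\<bar>of_int m - of_int n * \<alpha>\<bar> \<ge> c * \<bar>of_int n\<bar> powr (1 - r)" if "n \<noteq> 0" for m n :: int
  proof -
    define q where "q = nat \<bar>n\<bar>"
    \<comment> \<open>Moves the sign of \<open>n\<close> to the numerator, since the irrationality
      measure speaks of positive denominators.\<close>
    define p where "p = sgn n * m"
    have q: "q > 0" "real q = \<bar>of_int n\<bar>" using that by (auto simp: q_def)
    have "\<bar>of_int m - of_int n * \<alpha>\<bar> = real q * \<bar>\<alpha> - of_int p / of_nat q\<bar>"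
    proof -
      have "real q * \<bar>\<alpha> - of_int p / of_nat q\<bar> = \<bar>real q * \<alpha> - of_int p\<bar>"
      proof -
        have "real q * \<bar>\<alpha> - of_int p / of_nat q\<bar> = \<bar>real q * (\<alpha> - of_int p / of_nat q)\<bar>" by (simp add: abs_mult)
        also have "real q * (\<alpha> - of_int p / of_nat q) = real q * \<alpha> - of_int p" using q(1) by (simp add: right_diff_distrib)
        finally show ?thesis .
      qed
      also have "\<dots> = \<bar>of_int m - of_int n * \<alpha>\<bar>"
        unfolding q(2) p_def using that by (cases "n > 0") (auto simp: abs_if sgn_if)
      finally show ?thesis by simp
    qed
    also have "\<dots> \<ge> real q * (c * real q powr (-r))" using pos[OF q(1), of p] by (intro mult_left_mono) auto
    also have "real q * (c * real q powr (-r)) = c * real q powr (1 - r)"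
      using q(1) by (simp add: powr_diff powr_minus field_simps)
    finally show ?thesis by (simp only: q(2))
  qed
  with \<open>c > 0\<close> show ?thesis using that by blast
qed

section \<open>The estimate on each row of frequencies\<close>

abbreviation bracket_sq :: "int \<Rightarrow> real" where
  "bracket_sq n \<equiv> 1 + (of_int n)\<^sup>2"

lemma bracket_sq_ge_1: "bracket_sq n \<ge> 1" and bracket_sq_pos: "bracket_sq n > 0"
  by (simp, smt (verit) zero_le_power2)

lemma joint_weight_le_bracket_sq_mult: "joint_weight n m \<le> bracket_sq n * bracket_sq m"
  by (simp add: algebra_simps)

lemma bracket_sq_le_joint_weight: "bracket_sq m \<le> joint_weight n m"
  by simp

text \<open>The exchange for the data \<open>f\<close>. A power of \<open>bracket_sq n\<close> is
  paid only when \<open>q\<close> is positive; for negative \<open>q\<close> the joint weight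
  exceeds the bracket of \<open>m\<close> and the power reverses the inequality.\<close>

lemma joint_weight_powr_le: "joint_weight n m powr q \<le> bracket_sq n powr max q 0 * bracket_sq m powr q"
proof (cases "q \<ge> 0")
  case True
  then have "joint_weight n m powr q \<le> (bracket_sq n * bracket_sq m) powr q"
    by (intro powr_mono2 joint_weight_le_bracket_sq_mult less_imp_le[OF joint_weight_pos]) auto
  then show ?thesis using True by (simp add: powr_mult)
next
  case False
  then have "joint_weight n m powr q \<le> bracket_sq m powr q" by (intro powr_mono2' bracket_sq_pos bracket_sq_le_joint_weight) auto
  then show ?thesis using False bracket_sq_pos[of n] by simp
qed

text \<open>The exchange back, for the solution, paid only when \<open>q\<close> is negative. Since
  \<open>q + \<theta>\<close> may have either sign then, the exponents \<open>q\<close> and \<theta>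
  are treated separately, and the \<theta>-part is free.\<close>

lemma bracket_sq_powr_le:
  assumes "\<theta> \<ge> 0"
  shows "bracket_sq m powr (q + \<theta>) \<le> bracket_sq n powr max (-q) 0 * joint_weight n m powr (q + \<theta>)"
proof (cases "q \<ge> 0")
  case True
  then have "bracket_sq m powr (q + \<theta>) \<le> joint_weight n m powr (q + \<theta>)"
    using assms by (intro powr_mono2 bracket_sq_le_joint_weight less_imp_le[OF bracket_sq_pos]) auto
  then show ?thesis using True bracket_sq_pos[of n] by simp
next
  case False
  have 1: "bracket_sq m powr \<theta> \<le> joint_weight n m powr \<theta>"
    using assms by (intro powr_mono2 bracket_sq_le_joint_weight less_imp_le[OF bracket_sq_pos]) auto
  have "(bracket_sq n * bracket_sq m) powr q \<le> joint_weight n m powr q"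
    using False by (intro powr_mono2' joint_weight_le_bracket_sq_mult joint_weight_pos) auto
  then have "bracket_sq n powr (-q) * (bracket_sq n * bracket_sq m) powr q \<le> bracket_sq n powr (-q) * joint_weight n m powr q"
    by (intro mult_left_mono) auto
  moreover have "bracket_sq n powr (-q) * (bracket_sq n * bracket_sq m) powr q = bracket_sq m powr q"
    using bracket_sq_pos[of n] bracket_sq_pos[of m] by (simp add: powr_mult powr_minus)
  ultimately have "bracket_sq m powr q * bracket_sq m powr \<theta> \<le> (bracket_sq n powr (-q) * joint_weight n m powr q) * joint_weight n m powr \<theta>"
    using 1 by (intro mult_mono) auto
  then show ?thesis using False by (simp add: powr_add mult.assoc)
qed

text \<open>With \<open>X = bracket_sq n powr (r - 1) * d\<^sup>2\<close> the divisor bound says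
  \<open>X \<ge> c\<^sup>2\<close>, while \<open>m = d + n * \<alpha>\<close> bounds the joint
  weight by a multiple of \<open>X * bracket_sq n\<close>. Taking the power \<theta> of the latter
  leaves a power of \<open>X\<close>, which the former raises to \<open>X\<close> itself.\<close>

lemma weight_gain:
  fixes \<alpha> c r \<theta> :: real
  assumes c: "c > 0" and r: "r > 1" and \<theta>: "0 \<le> \<theta>" "\<theta> \<le> 1"
  shows "\<exists>D\<ge>0. \<forall>m n :: int. n \<noteq> 0 \<longrightarrow> \<bar>of_int m - of_int n * \<alpha>\<bar> \<ge> c * \<bar>of_int n\<bar> powr (1 - r) \<longrightarrow>
     joint_weight n m powr \<theta> \<le> D * (bracket_sq n powr (r - 1 + \<theta>) * (of_int m - of_int n * \<alpha>)\<^sup>2)"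
proof -
  \<comment> \<open>The numerator collects the terms in \<open>n\<close>, the 2 those in
    \<open>d\<close>, both from squaring \<open>m = d + n * \<alpha>\<close>. The division by
    \<open>c\<^sup>2\<close> comes from inserting \<open>1 \<le> X / c\<^sup>2\<close> to make the
    terms in \<open>n\<close> proportional to \<open>X\<close>.\<close>
  define E where "E = (1 + 2 * \<alpha>\<^sup>2) / c\<^sup>2 + 2"
  have E: "E > 0" unfolding E_def using c by (intro add_nonneg_pos) auto
  have "joint_weight n m powr \<theta> \<le> E powr \<theta> * (c\<^sup>2) powr (\<theta> - 1) * (bracket_sq n powr (r - 1 + \<theta>) * (of_int m - of_int n * \<alpha>)\<^sup>2)"
    if n: "n \<noteq> 0" and sd: "\<bar>of_int m - of_int n * \<alpha>\<bar> \<ge> c * \<bar>of_int n\<bar> powr (1 - r)" for m n :: int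
  proof -
    define d where "d = of_int m - of_int n * \<alpha>"
    define X where "X = bracket_sq n powr (r - 1) * d\<^sup>2"
    have n0: "(of_int n :: real)\<^sup>2 > 0" using n by simp
    have "c\<^sup>2 * bracket_sq n powr (1 - r) \<le> c\<^sup>2 * ((of_int n)\<^sup>2) powr (1 - r)"
      using r n0 by (intro mult_left_mono powr_mono2') auto
    also have "((of_int n)\<^sup>2) powr (1 - r) = (\<bar>of_int n\<bar> powr (1 - r))\<^sup>2"
      using n by (simp add: power2_eq_square powr_mult[symmetric] abs_mult_self_eq)
    also have "c\<^sup>2 * (\<bar>of_int n\<bar> powr (1 - r))\<^sup>2 = (c * \<bar>of_int n\<bar> powr (1 - r))\<^sup>2" by (simp add: power_mult_distrib)
    also have "\<dots> \<le> \<bar>d\<bar>\<^sup>2" using sd c unfolding d_def by (intro power_mono) auto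
    finally have "c\<^sup>2 * bracket_sq n powr (1 - r) \<le> d\<^sup>2" by simp
    then have "bracket_sq n powr (r - 1) * (c\<^sup>2 * bracket_sq n powr (1 - r)) \<le> X" unfolding X_def by (intro mult_left_mono) auto
    moreover have "bracket_sq n powr (r - 1) * (c\<^sup>2 * bracket_sq n powr (1 - r)) = c\<^sup>2"
      using bracket_sq_pos[of n] by (simp add: mult.left_commute powr_add[symmetric])
    ultimately have X: "X \<ge> c\<^sup>2" by simp
    have X0: "X > 0" using X c by (smt (verit) zero_less_power)
    have "1 \<le> bracket_sq n powr (r - 1)" using r bracket_sq_ge_1[of n] by (intro ge_one_powr_ge_zero) auto
    then have dX: "d\<^sup>2 \<le> X" unfolding X_def using mult_right_mono[of 1 _ "d\<^sup>2"] by fastforce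
    have "(of_int m)\<^sup>2 \<le> 2 * d\<^sup>2 + 2 * (of_int n * \<alpha>)\<^sup>2"
    proof -
      have "2 * d\<^sup>2 + 2 * (of_int n * \<alpha>)\<^sup>2 - (of_int m)\<^sup>2 = (d - of_int n * \<alpha>)\<^sup>2"
        by (simp add: d_def power2_eq_square algebra_simps)
      then show ?thesis using zero_le_power2[of "d - of_int n * \<alpha>"] by linarith
    qed
    also have "\<dots> = 2 * d\<^sup>2 + 2 * \<alpha>\<^sup>2 * (of_int n)\<^sup>2" by (simp add: power_mult_distrib)
    finally have m2: "(of_int m)\<^sup>2 \<le> 2 * d\<^sup>2 + 2 * \<alpha>\<^sup>2 * (of_int n)\<^sup>2" .
    have "joint_weight n m \<le> (1 + 2 * \<alpha>\<^sup>2) * bracket_sq n + 2 * d\<^sup>2"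
    proof -
      have "(1 + 2 * \<alpha>\<^sup>2) * bracket_sq n = bracket_sq n + 2 * \<alpha>\<^sup>2 + 2 * \<alpha>\<^sup>2 * (of_int n)\<^sup>2" by (simp add: algebra_simps)
      then show ?thesis using m2 zero_le_power2[of \<alpha>] by linarith
    qed
    also have "\<dots> \<le> (1 + 2 * \<alpha>\<^sup>2) * bracket_sq n * (X / c\<^sup>2) + 2 * (X * bracket_sq n)"
    proof (intro add_mono mult_left_mono)
      have "(1 + 2 * \<alpha>\<^sup>2) * bracket_sq n * 1 \<le> (1 + 2 * \<alpha>\<^sup>2) * bracket_sq n * (X / c\<^sup>2)"
        using X c bracket_sq_pos[of n] by (intro mult_left_mono) (auto simp: less_imp_le)
      then show "(1 + 2 * \<alpha>\<^sup>2) * bracket_sq n \<le> (1 + 2 * \<alpha>\<^sup>2) * bracket_sq n * (X / c\<^sup>2)" by simp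
      have "X * 1 \<le> X * bracket_sq n" using X0 bracket_sq_ge_1[of n] by (intro mult_left_mono) auto
      with dX show "d\<^sup>2 \<le> X * bracket_sq n" by simp
    qed auto
    also have "\<dots> = E * (X * bracket_sq n)" by (simp add: E_def algebra_simps add_divide_distrib)
    finally have "joint_weight n m powr \<theta> \<le> (E * (X * bracket_sq n)) powr \<theta>"
      using \<theta> by (intro powr_mono2 less_imp_le[OF joint_weight_pos])
    also have "\<dots> = E powr \<theta> * (X powr \<theta> * bracket_sq n powr \<theta>)"
      using E X0 bracket_sq_pos[of n] by (simp add: powr_mult)
    also have "X powr \<theta> = X * X powr (\<theta> - 1)"
      using X0 powr_add[of X 1 "\<theta> - 1"] by simp
    \<comment> \<open>As \<open>\<theta> - 1 \<le> 0\<close>, the lower bound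
      \<open>c\<^sup>2\<close> for \<open>X\<close> becomes an upper bound for this power.\<close>
    also have "E powr \<theta> * (X * X powr (\<theta> - 1) * bracket_sq n powr \<theta>) \<le> E powr \<theta> * (X * (c\<^sup>2) powr (\<theta> - 1) * bracket_sq n powr \<theta>)"
      using X X0 c \<theta> by (intro mult_left_mono mult_right_mono powr_mono2') auto
    also have "\<dots> = E powr \<theta> * (c\<^sup>2) powr (\<theta> - 1) * (bracket_sq n powr (r - 1 + \<theta>) * d\<^sup>2)"
      unfolding X_def powr_add by (simp add: mult_ac)
    finally show ?thesis unfolding d_def .
  qed
  then show ?thesis by (intro exI[of _ "E powr \<theta> * (c\<^sup>2) powr (\<theta> - 1)"]) auto
qed

section \<open>Division by the small divisors on one row\<close>

context phase
begin

definition wave :: "int \<Rightarrow> int \<Rightarrow> real \<times> real \<Rightarrow> complex" where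
  "wave n m = tensor (\<lambda>t. phase_factor n t * character m t) n"

lemma transport_wave:
  assumes u: "u \<in> distributions" and Lu: "dist_eq (transport_op a u) f" and a: "\<And>t. a t = b t + \<alpha>"
  shows "f (wave n m) = - \<i> * (of_int m - of_int n * of_real \<alpha>) * u (wave n m)"
proof -
  define h where "h t = phase_factor n t * character m t" for t
  have h: "smooth_periodic h" unfolding h_def[abs_def] by (intro smooth_periodic_mult smooth_periodic_phase_factor smooth_periodic_character)
  have bh: "smooth_periodic (\<lambda>t. of_real (b t) * h t)" by (intro smooth_periodic_mult b_smooth h)
  have vdh: "vderiv h = (\<lambda>t. (\<i> * of_int m) * h t + (\<i> * of_int n) * (of_real (b t) * h t))"
    unfolding h_def[abs_def] vderiv_mult[OF smooth_periodic_phase_factor smooth_periodic_character] vderiv_phase_factor vderiv_character by (simp add: algebra_simps)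
  have w: "wave n m = tensor h n" by (simp add: wave_def h_def[abs_def])
  have "f (tensor h n) = transport_op a u (tensor h n)"
    using Lu tensor_test[OF h] unfolding dist_eq_def by auto
  also have "\<dots> = - u (partial_t (tensor h n)) + u (partial_x (\<lambda>z. (case z of (t, x) \<Rightarrow> complex_of_real (a t)) * tensor h n z))"
    by (simp add: transport_op_def dist_diff_def dist_dt_def dist_mult_def dist_dx_def)
  also have "(\<lambda>z. (case z of (t, x) \<Rightarrow> complex_of_real (a t)) * tensor h n z) = tensor (\<lambda>t. of_real (a t) * h t) n"
    by (auto simp: tensor_def)
  also have "partial_x (tensor (\<lambda>t. of_real (a t) * h t) n) = tensor (\<lambda>t. (\<i> * of_int n) * (of_real (b t) * h t) + (\<i> * of_int n * of_real \<alpha>) * h t) n"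
    unfolding partial_x_tensor a by (simp add: algebra_simps)
  also have "u (tensor (\<lambda>t. (\<i> * of_int n) * (of_real (b t) * h t) + (\<i> * of_int n * of_real \<alpha>) * h t) n)
      = (\<i> * of_int n) * u (tensor (\<lambda>t. of_real (b t) * h t) n) + (\<i> * of_int n * of_real \<alpha>) * u (tensor h n)"
    by (simp only: dist_tensor_add[OF u smooth_periodic_cmult[OF bh] smooth_periodic_cmult[OF h]] dist_tensor_scale[OF u bh] dist_tensor_scale[OF u h])
  also have "u (partial_t (tensor h n)) = (\<i> * of_int m) * u (tensor h n) + (\<i> * of_int n) * u (tensor (\<lambda>t. of_real (b t) * h t) n)"
    unfolding partial_t_tensor[OF h] vdh
    by (simp only: dist_tensor_add[OF u smooth_periodic_cmult[OF h] smooth_periodic_cmult[OF bh]] dist_tensor_scale[OF u bh] dist_tensor_scale[OF u h])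
  \<comment> \<open>The pairings with \<open>of_real (b t) * h t\<close> enter from both derivatives
    with opposite signs and cancel; only the mean \<alpha> of the coefficient survives.\<close>
  finally show ?thesis unfolding w by (simp add: algebra_simps)
qed

lemma wave_from_exponentials:
  assumes "f \<in> distributions"
  shows "(\<lambda>M. \<Sum>k\<in>{-int M..int M}. circle_coeff (phase_factor n) (k - m) * f (tensor (character k) n)) \<longlonglongrightarrow> f (wave n m)"
  using dist_tensor_fourier[OF assms smooth_periodic_const[of 1] smooth_periodic_mult[OF smooth_periodic_phase_factor smooth_periodic_character], of n m n]
  unfolding circle_coeff_mult_character by (simp add: wave_def)

text \<open>The opposite phase undoes the one contained in the waves. The conjugation bound is
  therefore used for \<open>-n\<close> on the way back, where the joint weight is the same.\<close>

lemma exponential_from_waves: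
  assumes "u \<in> distributions"
  shows "(\<lambda>M. \<Sum>k\<in>{-int M..int M}. circle_coeff (phase_factor (-n)) (k - m) * u (wave n k)) \<longlonglongrightarrow> u (tensor (character m) n)"
proof -
  have "(\<lambda>t. phase_factor n t * (phase_factor (-n) t * character m t)) = character m"
    using phase_factor_mult_inverse[of "n"] by (metis (no_types, opaque_lifting) mult.assoc mult.commute mult_1)
  then show ?thesis
    using dist_tensor_fourier[OF assms smooth_periodic_phase_factor[of n] smooth_periodic_mult[OF smooth_periodic_phase_factor[of "-n"] smooth_periodic_character[of m]], of n]
    unfolding circle_coeff_mult_character by (simp add: wave_def)
qed

text \<open>Exponentials to waves for \<open>f\<close> with exponent \<open>q\<close>, division by
  the divisor, waves to exponentials for \<open>u\<close> with exponent \<open>q + \<theta>\<close>.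
  The gain \<theta> is taken while the weight is still joint, so it is bought by
  \<open>weight_gain\<close> alone.\<close>

lemma row_bound:
  fixes \<alpha> c r \<theta> q :: real
  assumes c: "c > 0" and r: "r > 1" and \<theta>: "0 \<le> \<theta>" "\<theta> \<le> 1"
    and sd: "\<And>m n :: int. n \<noteq> 0 \<Longrightarrow> \<bar>of_int m - of_int n * \<alpha>\<bar> \<ge> c * \<bar>of_int n\<bar> powr (1 - r)"
  obtains C where "C \<ge> 0"
    "\<And>u f n K S. u \<in> distributions \<Longrightarrow> f \<in> distributions \<Longrightarrow>
     (\<And>m. f (wave n m) = - \<i> * (of_int m - of_int n * of_real \<alpha>) * u (wave n m)) \<Longrightarrow> n \<noteq> 0 \<Longrightarrow> finite K \<Longrightarrow>
     (\<And>L. finite L \<Longrightarrow> (\<Sum>m\<in>L. bracket_sq m powr q * (norm (f (tensor (character m) n)))\<^sup>2) \<le> S) \<Longrightarrow>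
     (\<Sum>m\<in>K. bracket_sq m powr (q + \<theta>) * (norm (u (tensor (character m) n)))\<^sup>2) \<le> C * (bracket_sq n powr (r - 1 + \<theta> + \<bar>q\<bar>) * S)"
proof -
  obtain C1 where C1: "C1 \<ge> 0" "\<And>n U V S K. (\<And>m. (\<lambda>M. \<Sum>k\<in>{-int M..int M}. circle_coeff (phase_factor n) (k - m) * U k) \<longlonglongrightarrow> V m) \<Longrightarrow>
     (\<And>L. finite L \<Longrightarrow> (\<Sum>k\<in>L. joint_weight n k powr q * (norm (U k))\<^sup>2) \<le> S) \<Longrightarrow> finite K \<Longrightarrow>
     (\<Sum>m\<in>K. joint_weight n m powr q * (norm (V m))\<^sup>2) \<le> C1 * S"
  proof (rule conjugation_bound[of q], goal_cases)
    case (1 C)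
    show ?case by (rule 1(1)[OF 1(2)]) (fact 1(3))
  qed
  obtain C3 where C3: "C3 \<ge> 0" "\<And>n U V S K. (\<And>m. (\<lambda>M. \<Sum>k\<in>{-int M..int M}. circle_coeff (phase_factor n) (k - m) * U k) \<longlonglongrightarrow> V m) \<Longrightarrow>
     (\<And>L. finite L \<Longrightarrow> (\<Sum>k\<in>L. joint_weight n k powr (q + \<theta>) * (norm (U k))\<^sup>2) \<le> S) \<Longrightarrow> finite K \<Longrightarrow>
     (\<Sum>m\<in>K. joint_weight n m powr (q + \<theta>) * (norm (V m))\<^sup>2) \<le> C3 * S"
  proof (rule conjugation_bound[of "q + \<theta>"], goal_cases)
    case (1 C)
    show ?case by (rule 1(1)[OF 1(2)]) (fact 1(3))
  qed
  obtain D where D: "D \<ge> 0" "\<And>m n :: int. n \<noteq> 0 \<Longrightarrow> joint_weight n m powr \<theta> \<le> D * (bracket_sq n powr (r - 1 + \<theta>) * (of_int m - of_int n * \<alpha>)\<^sup>2)"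
    using weight_gain[OF c r \<theta>, of \<alpha>] sd by blast
  have "C3 * D * C1 \<ge> 0" using C1(1) C3(1) D(1) by simp
  then show thesis
  proof (rule that)
    fix u f :: functional and n and K :: "int set" and S
    assume u: "u \<in> distributions" and f: "f \<in> distributions"
      and eq: "\<And>m. f (wave n m) = - \<i> * (of_int m - of_int n * of_real \<alpha>) * u (wave n m)"
      and n: "n \<noteq> 0" and K: "finite K"
      and S: "\<And>L. finite L \<Longrightarrow> (\<Sum>m\<in>L. bracket_sq m powr q * (norm (f (tensor (character m) n)))\<^sup>2) \<le> S"
    \<comment> \<open>\<open>S1\<close> bounds the data in the joint weight, \<open>S2\<close> the
      pairings of \<open>u\<close> with waves after the division.\<close>
    define S1 where "S1 = bracket_sq n powr max q 0 * S"
    define S2 where "S2 = D * bracket_sq n powr (r - 1 + \<theta>) * (C1 * S1)"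
    have "(\<Sum>m\<in>L. joint_weight n m powr q * (norm (f (tensor (character m) n)))\<^sup>2) \<le> S1" if "finite L" for L
    proof -
      have "(\<Sum>m\<in>L. joint_weight n m powr q * (norm (f (tensor (character m) n)))\<^sup>2) \<le> (\<Sum>m\<in>L. (bracket_sq n powr max q 0 * bracket_sq m powr q) * (norm (f (tensor (character m) n)))\<^sup>2)"
        by (intro sum_mono mult_right_mono joint_weight_powr_le) auto
      also have "\<dots> = bracket_sq n powr max q 0 * (\<Sum>m\<in>L. bracket_sq m powr q * (norm (f (tensor (character m) n)))\<^sup>2)"
        by (simp add: sum_distrib_left mult.assoc)
      also have "\<dots> \<le> S1" unfolding S1_def by (intro mult_left_mono S that) auto
      finally show ?thesis .
    qed
    then have VF: "(\<Sum>m\<in>L. joint_weight n m powr q * (norm (f (wave n m)))\<^sup>2) \<le> C1 * S1" if "finite L" for L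
      using C1(2)[OF wave_from_exponentials[OF f] _ that] by blast
    have VU: "(\<Sum>m\<in>L. joint_weight (-n) m powr (q + \<theta>) * (norm (u (wave n m)))\<^sup>2) \<le> S2" if "finite L" for L
    proof -
      have "joint_weight (-n) m powr (q + \<theta>) * (norm (u (wave n m)))\<^sup>2 \<le> D * bracket_sq n powr (r - 1 + \<theta>) * (joint_weight n m powr q * (norm (f (wave n m)))\<^sup>2)" for m
      proof -
        have "(norm (f (wave n m)))\<^sup>2 = (of_int m - of_int n * \<alpha>)\<^sup>2 * (norm (u (wave n m)))\<^sup>2"
        proof -
          have "norm (- \<i> * (of_int m - of_int n * complex_of_real \<alpha>)) = \<bar>of_int m - of_int n * \<alpha>\<bar>"
            using norm_of_real[of "of_int m - of_int n * \<alpha>", where ?'a=complex] by (simp add: norm_mult)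
          then show ?thesis unfolding eq[of m] norm_mult[of _ "u (wave n m)"] by (simp add: power_mult_distrib)
        qed
        then have "D * bracket_sq n powr (r - 1 + \<theta>) * (joint_weight n m powr q * (norm (f (wave n m)))\<^sup>2)
            = joint_weight n m powr q * (D * (bracket_sq n powr (r - 1 + \<theta>) * (of_int m - of_int n * \<alpha>)\<^sup>2)) * (norm (u (wave n m)))\<^sup>2"
          by (simp add: mult_ac)
        also have "\<dots> \<ge> joint_weight n m powr q * joint_weight n m powr \<theta> * (norm (u (wave n m)))\<^sup>2"
          by (intro mult_right_mono mult_left_mono D(2) n) auto
        finally show ?thesis by (simp add: powr_add)
      qed
      then have "(\<Sum>m\<in>L. joint_weight (-n) m powr (q + \<theta>) * (norm (u (wave n m)))\<^sup>2) \<le> (\<Sum>m\<in>L. D * bracket_sq n powr (r - 1 + \<theta>) * (joint_weight n m powr q * (norm (f (wave n m)))\<^sup>2))"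
        by (intro sum_mono)
      also have "\<dots> = D * bracket_sq n powr (r - 1 + \<theta>) * (\<Sum>m\<in>L. joint_weight n m powr q * (norm (f (wave n m)))\<^sup>2)"
        by (simp add: sum_distrib_left)
      also have "\<dots> \<le> S2" unfolding S2_def using D(1) by (intro mult_left_mono VF that) auto
      finally show ?thesis .
    qed
    have "(\<Sum>m\<in>K. bracket_sq m powr (q + \<theta>) * (norm (u (tensor (character m) n)))\<^sup>2)
        \<le> (\<Sum>m\<in>K. (bracket_sq n powr max (-q) 0 * joint_weight n m powr (q + \<theta>)) * (norm (u (tensor (character m) n)))\<^sup>2)"
      by (intro sum_mono mult_right_mono bracket_sq_powr_le \<theta>) auto
    also have "\<dots> = bracket_sq n powr max (-q) 0 * (\<Sum>m\<in>K. joint_weight (-n) m powr (q + \<theta>) * (norm (u (tensor (character m) n)))\<^sup>2)"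
      by (simp add: sum_distrib_left mult.assoc)
    also have "\<dots> \<le> bracket_sq n powr max (-q) 0 * (C3 * S2)"
      by (intro mult_left_mono C3(2)[OF exponential_from_waves[OF u] VU K]) auto
    also have "\<dots> = C3 * D * C1 * ((bracket_sq n powr max (-q) 0 * bracket_sq n powr (r - 1 + \<theta>) * bracket_sq n powr max q 0) * S)"
      unfolding S2_def S1_def by (simp add: mult_ac)
    \<comment> \<open>One of the two maxima vanishes, and their sum is
      \<open>\<bar>q\<bar>\<close>.\<close>
    also have "bracket_sq n powr max (-q) 0 * bracket_sq n powr (r - 1 + \<theta>) * bracket_sq n powr max q 0 = bracket_sq n powr (r - 1 + \<theta> + \<bar>q\<bar>)"
      unfolding powr_add[symmetric] by (rule arg_cong[where f="(powr) _"]) auto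
    finally show "(\<Sum>m\<in>K. bracket_sq m powr (q + \<theta>) * (norm (u (tensor (character m) n)))\<^sup>2) \<le> C3 * D * C1 * (bracket_sq n powr (r - 1 + \<theta> + \<bar>q\<bar>) * S)" .
  qed
qed

text \<open>For \<open>n = 0\<close> waves are exponentials and the divisor is \<open>m\<close>.
  Away from \<open>m = 0\<close> the bracket of \<open>m\<close> is at most twice its square, whence
  the factor 2, and \<theta> \<le> 1 keeps the gained power below the bracket.\<close>

lemma zero_row_bound:
  assumes \<theta>: "0 \<le> \<theta>" "\<theta> \<le> (1::real)"
    and eq: "\<And>m. f (wave 0 m) = - \<i> * (of_int m - of_int 0 * of_real \<alpha>) * u (wave 0 m)"
    and K: "finite K" "0 \<notin> K"
    and S: "\<And>L. finite L \<Longrightarrow> (\<Sum>m\<in>L. bracket_sq m powr q * (norm (f (tensor (character m) 0)))\<^sup>2) \<le> S"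
  shows "(\<Sum>m\<in>K. bracket_sq m powr (q + \<theta>) * (norm (u (tensor (character m) 0)))\<^sup>2) \<le> 2 * S"
proof -
  have w: "wave 0 m = tensor (character m) 0" for m by (simp add: wave_def phase_factor_def)
  have "bracket_sq m powr (q + \<theta>) * (norm (u (tensor (character m) 0)))\<^sup>2 \<le> 2 * (bracket_sq m powr q * (norm (f (tensor (character m) 0)))\<^sup>2)" if "m \<in> K" for m
  proof -
    have "m \<noteq> 0" using that K by auto
    then have "1 \<le> \<bar>m\<bar>" by simp
    then have "1 \<le> (of_int m :: real)\<^sup>2" by (metis one_le_power of_int_1_le_iff of_int_abs power2_abs)
    then have "bracket_sq m \<le> 2 * (of_int m)\<^sup>2" by simp
    moreover have "bracket_sq m powr \<theta> \<le> bracket_sq m" using powr_mono[OF \<theta>(2) bracket_sq_ge_1[of m]] bracket_sq_pos[of m] by simp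
    ultimately have "bracket_sq m powr \<theta> \<le> 2 * (of_int m)\<^sup>2" by simp
    then have "bracket_sq m powr q * bracket_sq m powr \<theta> * (norm (u (tensor (character m) 0)))\<^sup>2 \<le> bracket_sq m powr q * (2 * (of_int m)\<^sup>2) * (norm (u (tensor (character m) 0)))\<^sup>2"
      by (intro mult_right_mono mult_left_mono) auto
    also have "\<dots> = 2 * (bracket_sq m powr q * (norm (f (tensor (character m) 0)))\<^sup>2)"
      using eq[of m] by (simp add: w norm_mult power_mult_distrib)
    finally show ?thesis by (simp add: powr_add)
  qed
  then have "(\<Sum>m\<in>K. bracket_sq m powr (q + \<theta>) * (norm (u (tensor (character m) 0)))\<^sup>2) \<le> (\<Sum>m\<in>K. 2 * (bracket_sq m powr q * (norm (f (tensor (character m) 0)))\<^sup>2))"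
    by (rule sum_mono)
  also have "\<dots> \<le> 2 * S" unfolding sum_distrib_left[symmetric] by (intro mult_left_mono S K) auto
  finally show ?thesis .
qed

end

section \<open>Summation over the rows and conclusion\<close>

text \<open>A finite set of frequencies lies in a rectangle, hence in finitely many rows. On each
  the arbitrary \<open>S\<close> is specialised to the full row sum of \<open>Q\<close>, and one
  constant for all rows lets these be added.\<close>

lemma summable_rows:
  fixes P Q :: "int \<times> int \<Rightarrow> real"
  assumes P: "\<And>z. P z \<ge> 0" and Q: "\<And>z. Q z \<ge> 0" and sQ: "Q summable_on UNIV" and C: "C \<ge> 0"
    and rows: "\<And>\<xi> K S. finite K \<Longrightarrow> (\<And>L. finite L \<Longrightarrow> (\<Sum>\<tau>\<in>L. Q (\<tau>, \<xi>)) \<le> S) \<Longrightarrow> (\<Sum>\<tau>\<in>K. P (\<tau>, \<xi>)) \<le> C * S"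
  shows "P summable_on UNIV" "infsum P UNIV \<le> C * infsum Q UNIV"
proof -
  have sub: "Q summable_on A" for A using sQ summable_on_subset_banach by blast
  have strip: "(\<Sum>\<xi>\<in>B. infsum Q (UNIV \<times> {\<xi>})) = infsum Q (UNIV \<times> B)" if "finite B" for B :: "int set"
    using that
  proof (induction B rule: finite_induct)
    case (insert \<xi> B)
    have "infsum Q (UNIV \<times> {\<xi>} \<union> UNIV \<times> B) = infsum Q (UNIV \<times> {\<xi>}) + infsum Q (UNIV \<times> B)"
      using insert by (intro infsum_Un_disjoint sub) auto
    moreover have "UNIV \<times> insert \<xi> B = UNIV \<times> {\<xi>} \<union> (UNIV \<times> B :: (int \<times> int) set)" by auto
    ultimately show ?case using insert by simp
  qed simp
  have bound: "sum P F \<le> C * infsum Q UNIV" if F: "finite F" for F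
  proof -
    let ?A = "fst ` F" and ?B = "snd ` F"
    have fin: "finite ?A" "finite ?B" using F by auto
    have "sum P F \<le> sum P (?A \<times> ?B)"
      using fin P by (intro sum_mono2) (auto intro: rev_image_eqI)
    also have "\<dots> = (\<Sum>\<xi>\<in>?B. \<Sum>\<tau>\<in>?A. P (\<tau>, \<xi>))"
      by (subst sum.swap) (simp add: sum.cartesian_product)
    also have "\<dots> \<le> (\<Sum>\<xi>\<in>?B. C * infsum Q (UNIV \<times> {\<xi>}))"
    proof (intro sum_mono rows fin)
      fix \<xi> and L :: "int set" assume L: "finite L"
      have "(\<Sum>\<tau>\<in>L. Q (\<tau>, \<xi>)) = sum Q ((\<lambda>\<tau>. (\<tau>, \<xi>)) ` L)"
        by (subst sum.reindex) (auto intro: inj_onI)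
      also have "\<dots> \<le> infsum Q (UNIV \<times> {\<xi>})"
        using L Q by (intro finite_sum_le_infsum sub) auto
      finally show "(\<Sum>\<tau>\<in>L. Q (\<tau>, \<xi>)) \<le> infsum Q (UNIV \<times> {\<xi>})" .
    qed
    also have "\<dots> = C * infsum Q (UNIV \<times> ?B)" unfolding sum_distrib_left[symmetric] strip[OF fin(2)] ..
    also have "\<dots> \<le> C * infsum Q UNIV"
      using C Q by (intro mult_left_mono infsum_mono_neutral sub) auto
    finally show ?thesis .
  qed
  show s: "P summable_on UNIV"
    using bound P by (intro nonneg_bdd_above_summable_on bdd_aboveI[of _ "C * infsum Q UNIV"]) auto
  show "infsum P UNIV \<le> C * infsum Q UNIV"
    using bound by (intro infsum_le_finite_sums s) auto
qed

lemma Hmix_term_bracket_sq: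
  "Hmix_term s1 s2 f (\<tau>, \<xi>) = bracket_sq \<tau> powr s1 * bracket_sq \<xi> powr s2 * (norm (fourier_coeff f \<tau> \<xi>))\<^sup>2"
  unfolding Hmix_term_def japanese_bracket_def prod.case by (simp add: powr_half_sqrt[symmetric] powr_powr)

lemma Hmix_term_nonneg: "Hmix_term s1 s2 f z \<ge> 0"
  by (cases z) (simp add: Hmix_term_bracket_sq)

text \<open>The weight in \<xi> is a common factor on each row, so the constant is fixed before
  \<open>k2\<close>. The hypothesis \<open>q \<le> k1\<close> is used to lower the weight of
  \<open>f\<close> in \<tau> from \<open>k1\<close> to \<open>q\<close>.\<close>

lemma transport_estimate:
  fixes a :: "real \<Rightarrow> real" and q r \<theta> k1 :: real
  assumes a: "smooth_on_circle a" and irr: "circle_mean a \<notin> \<rat>"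
    and r: "ereal r > irrationality_measure (circle_mean a)" and q: "q \<le> k1" and \<theta>: "0 \<le> \<theta>" "\<theta> \<le> 1"
  shows "\<exists>C>0. \<forall>(k2 :: real) u f. u \<in> distributions \<and> f \<in> Hmix k1 k2 \<and> dist_eq (transport_op a u) f \<longrightarrow>
      minus_mean u \<in> Hmix (q + \<theta>) (k2 + 1 - r - \<bar>q\<bar> - \<theta>) \<and>
      Hmix_norm (q + \<theta>) (k2 + 1 - r - \<bar>q\<bar> - \<theta>) (minus_mean u) \<le> C * Hmix_norm k1 k2 f"
proof -
  have r1: "r > 1" using le_less_trans[OF irrationality_measure_ge_1 r] by (simp add: one_ereal_def)
  obtain A where "phase A (\<lambda>t. a t - circle_mean a)" using phase_exists[OF a] by blast
  then interpret phase A "\<lambda>t. a t - circle_mean a" .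
  obtain c where c: "c > 0" "\<And>m n :: int. n \<noteq> 0 \<Longrightarrow> \<bar>of_int m - of_int n * circle_mean a\<bar> \<ge> c * \<bar>of_int n\<bar> powr (1 - r)"
    using small_divisor_bound[OF irr r] by blast
  obtain C0 where C0: "C0 \<ge> 0" "\<And>u f n K S. u \<in> distributions \<Longrightarrow> f \<in> distributions \<Longrightarrow>
     (\<And>m. f (wave n m) = - \<i> * (of_int m - of_int n * of_real (circle_mean a)) * u (wave n m)) \<Longrightarrow> n \<noteq> 0 \<Longrightarrow> finite K \<Longrightarrow>
     (\<And>L. finite L \<Longrightarrow> (\<Sum>m\<in>L. bracket_sq m powr q * (norm (f (tensor (character m) n)))\<^sup>2) \<le> S) \<Longrightarrow>
     (\<Sum>m\<in>K. bracket_sq m powr (q + \<theta>) * (norm (u (tensor (character m) n)))\<^sup>2) \<le> C0 * (bracket_sq n powr (r - 1 + \<theta> + \<bar>q\<bar>) * S)"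
  proof (rule row_bound[OF c(1) r1 \<theta> c(2), where q = q], goal_cases)
    case (2 C)
    show ?case by (rule 2(1)[OF 2(2)]) (fact 2(3))
  qed
  \<comment> \<open>Covers the rows \<xi> \<noteq> 0 by \<open>C0\<close> and the row \<xi> = 0 by
    2.\<close>
  define C where "C = max C0 2"
  have C: "C > 0" unfolding C_def by simp
  have main: "minus_mean u \<in> Hmix (q + \<theta>) (k2 + 1 - r - \<bar>q\<bar> - \<theta>)"
    "Hmix_norm (q + \<theta>) (k2 + 1 - r - \<bar>q\<bar> - \<theta>) (minus_mean u) \<le> sqrt C * Hmix_norm k1 k2 f"
    if u: "u \<in> distributions" and f: "f \<in> Hmix k1 k2" and Lu: "dist_eq (transport_op a u) f" for k2 u f
  proof -
    have fd: "f \<in> distributions" and fs: "Hmix_term k1 k2 f summable_on UNIV" using f by (auto simp: Hmix_def)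
    have eq: "f (wave n m) = - \<i> * (of_int m - of_int n * of_real (circle_mean a)) * u (wave n m)" for m n
      by (rule transport_wave[OF u Lu]) simp
    \<comment> \<open>The normalisation of \<open>fourier_coeff\<close>, squared; it enters for
      \<open>f\<close> and for \<open>u\<close> and cancels at the end.\<close>
    let ?e = "(norm (complex_of_real ((2 * pi)\<^sup>2)))\<^sup>2"
    have e: "?e > 0" by simp
    have fcn: "(norm (fourier_coeff v \<tau> \<xi>))\<^sup>2 = (norm (v (tensor (character (-\<tau>)) (-\<xi>))))\<^sup>2 / ?e" for v \<tau> \<xi>
      unfolding fourier_coeff_tensor norm_divide power_divide ..
    let ?P = "Hmix_term (q + \<theta>) (k2 + 1 - r - \<bar>q\<bar> - \<theta>) (minus_mean u)"
    have rows: "(\<Sum>\<tau>\<in>K. ?P (\<tau>, \<xi>)) \<le> C * S"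
      if K: "finite K" and S: "\<And>L. finite L \<Longrightarrow> (\<Sum>\<tau>\<in>L. Hmix_term k1 k2 f (\<tau>, \<xi>)) \<le> S" for \<xi> K S
    proof -
      define S' where "S' = ?e * bracket_sq \<xi> powr (-k2) * S"
      have S0: "S \<ge> 0" using S[of "{}"] by simp
      \<comment> \<open>Reflects the frequencies: the row bounds are indexed by exponentials, the
        terms of \<open>Hmix_term\<close> by the opposite frequencies.\<close>
      have neg: "(\<Sum>m\<in>L. g m) = (\<Sum>\<tau>\<in>uminus ` L. g (-\<tau>))" for g :: "int \<Rightarrow> real" and L
        by (subst sum.reindex) (auto intro: inj_onI)
      have S': "(\<Sum>m\<in>L. bracket_sq m powr q * (norm (f (tensor (character m) (-\<xi>))))\<^sup>2) \<le> S'" if L: "finite L" for L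
      proof -
        have "(\<Sum>m\<in>L. bracket_sq m powr q * (norm (f (tensor (character m) (-\<xi>))))\<^sup>2) = (\<Sum>\<tau>\<in>uminus ` L. bracket_sq \<tau> powr q * (norm (f (tensor (character (-\<tau>)) (-\<xi>))))\<^sup>2)"
          by (subst neg) simp
        also have "\<dots> \<le> (\<Sum>\<tau>\<in>uminus ` L. ?e * bracket_sq \<xi> powr (-k2) * Hmix_term k1 k2 f (\<tau>, \<xi>))"
        proof (rule sum_mono)
          fix \<tau>
          have "bracket_sq \<tau> powr q * (norm (f (tensor (character (-\<tau>)) (-\<xi>))))\<^sup>2 \<le> bracket_sq \<tau> powr k1 * (norm (f (tensor (character (-\<tau>)) (-\<xi>))))\<^sup>2"
            using q by (intro mult_right_mono powr_mono) auto
          also have "\<dots> = ?e * bracket_sq \<xi> powr (-k2) * Hmix_term k1 k2 f (\<tau>, \<xi>)"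
          proof -
            have "bracket_sq \<xi> powr (-k2) * bracket_sq \<xi> powr k2 = 1" using bracket_sq_pos[of \<xi>] by (simp add: powr_add[symmetric])
            moreover have "?e * bracket_sq \<xi> powr (-k2) * Hmix_term k1 k2 f (\<tau>, \<xi>) = (bracket_sq \<xi> powr (-k2) * bracket_sq \<xi> powr k2) * (bracket_sq \<tau> powr k1 * (norm (f (tensor (character (-\<tau>)) (-\<xi>))))\<^sup>2) * (?e / ?e)"
              unfolding Hmix_term_bracket_sq fcn by (simp only: mult_ac times_divide_eq_left times_divide_eq_right)
            ultimately show ?thesis using e by (simp only: divide_self[OF less_imp_neq[OF e, symmetric]] mult_1 mult_1_right)
          qed
          finally show "bracket_sq \<tau> powr q * (norm (f (tensor (character (-\<tau>)) (-\<xi>))))\<^sup>2 \<le> ?e * bracket_sq \<xi> powr (-k2) * Hmix_term k1 k2 f (\<tau>, \<xi>)" .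
        qed
        also have "\<dots> \<le> S'"
          unfolding S'_def sum_distrib_left[symmetric] by (intro mult_left_mono S) (auto simp: L)
        finally show ?thesis .
      qed
      have S'0: "S' \<ge> 0" unfolding S'_def using S0 by simp
      \<comment> \<open>Only on the row \<xi> = 0 is the frequency 0 dropped, where the coefficient
        of \<open>minus_mean u\<close> is zero and the equation gives no control of
        \<open>u\<close>.\<close>
      define K' where "K' = (if \<xi> = 0 then uminus ` K - {0} else uminus ` K)"
      have K': "finite K'" using K by (simp add: K'_def)
      have U: "(\<Sum>m\<in>K'. bracket_sq m powr (q + \<theta>) * (norm (u (tensor (character m) (-\<xi>))))\<^sup>2) \<le> C * (bracket_sq \<xi> powr (r - 1 + \<theta> + \<bar>q\<bar>) * S')"
      proof (cases "\<xi> = 0")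
        case True
        then have "(\<Sum>m\<in>K'. bracket_sq m powr (q + \<theta>) * (norm (u (tensor (character m) (-\<xi>))))\<^sup>2) \<le> 2 * S'"
          using zero_row_bound[OF \<theta> eq K', of q S'] S' by (simp add: K'_def)
        also have "\<dots> \<le> C * S'" unfolding C_def using S'0 by (intro mult_right_mono) auto
        finally show ?thesis using True by simp
      next
        case False
        then have "(\<Sum>m\<in>K'. bracket_sq m powr (q + \<theta>) * (norm (u (tensor (character m) (-\<xi>))))\<^sup>2) \<le> C0 * (bracket_sq (-\<xi>) powr (r - 1 + \<theta> + \<bar>q\<bar>) * S')"
          by (intro C0(2)[OF u fd eq _ K' S']) auto
        also have "\<dots> \<le> C * (bracket_sq (-\<xi>) powr (r - 1 + \<theta> + \<bar>q\<bar>) * S')"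
          unfolding C_def using S'0 by (intro mult_right_mono) auto
        finally show ?thesis by simp
      qed
      have "(\<Sum>\<tau>\<in>K. ?P (\<tau>, \<xi>)) = (\<Sum>\<tau>\<in>uminus ` K'. ?P (\<tau>, \<xi>))"
        using K by (intro sum.mono_neutral_right)
          (auto simp: K'_def Hmix_term_bracket_sq fourier_coeff_minus_mean image_image split: if_splits intro: rev_image_eqI)
      also have "\<dots> = (\<Sum>m\<in>K'. ?P (-m, \<xi>))"
        by (subst sum.reindex) (auto intro: inj_onI)
      also have "\<dots> = (\<Sum>m\<in>K'. bracket_sq \<xi> powr (k2 + 1 - r - \<bar>q\<bar> - \<theta>) / ?e * (bracket_sq m powr (q + \<theta>) * (norm (u (tensor (character m) (-\<xi>))))\<^sup>2))"
      proof (rule sum.cong[OF refl])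
        fix m assume "m \<in> K'"
        then have "\<not> (-m = 0 \<and> \<xi> = 0)" by (auto simp: K'_def)
        then have "?P (-m, \<xi>) = bracket_sq (-m) powr (q + \<theta>) * bracket_sq \<xi> powr (k2 + 1 - r - \<bar>q\<bar> - \<theta>) * ((norm (u (tensor (character (-(-m))) (-\<xi>))))\<^sup>2 / ?e)"
          unfolding Hmix_term_bracket_sq fourier_coeff_minus_mean fcn[symmetric] by (simp only: if_False)
        then show "?P (-m, \<xi>) = bracket_sq \<xi> powr (k2 + 1 - r - \<bar>q\<bar> - \<theta>) / ?e * (bracket_sq m powr (q + \<theta>) * (norm (u (tensor (character m) (-\<xi>))))\<^sup>2)"
          by simp
      qed
      also have "\<dots> = bracket_sq \<xi> powr (k2 + 1 - r - \<bar>q\<bar> - \<theta>) / ?e * (\<Sum>m\<in>K'. bracket_sq m powr (q + \<theta>) * (norm (u (tensor (character m) (-\<xi>))))\<^sup>2)"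
        by (simp only: sum_distrib_left)
      also have "\<dots> \<le> bracket_sq \<xi> powr (k2 + 1 - r - \<bar>q\<bar> - \<theta>) / ?e * (C * (bracket_sq \<xi> powr (r - 1 + \<theta> + \<bar>q\<bar>) * S'))"
        by (intro mult_left_mono U) auto
      also have "\<dots> = C * S * (bracket_sq \<xi> powr (k2 + 1 - r - \<bar>q\<bar> - \<theta>) * bracket_sq \<xi> powr (r - 1 + \<theta> + \<bar>q\<bar>) * bracket_sq \<xi> powr (-k2)) * (?e / ?e)"
        unfolding S'_def by (simp only: mult_ac times_divide_eq_left times_divide_eq_right)
      also have "bracket_sq \<xi> powr (k2 + 1 - r - \<bar>q\<bar> - \<theta>) * bracket_sq \<xi> powr (r - 1 + \<theta> + \<bar>q\<bar>) * bracket_sq \<xi> powr (-k2) = 1"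
        \<comment> \<open>The three exponents sum to zero: the \<xi>-exponent in the theorem is
          exactly \<open>k2\<close> minus the loss on a row.\<close>
        unfolding powr_add[symmetric] using bracket_sq_pos[of \<xi>] by simp
      also have "?e / ?e = 1" using e by (intro divide_self) auto
      finally show ?thesis by simp
    qed
    have sr: "?P summable_on UNIV" "infsum ?P UNIV \<le> C * infsum (Hmix_term k1 k2 f) UNIV"
      by (rule summable_rows[OF Hmix_term_nonneg Hmix_term_nonneg fs less_imp_le[OF C]], fact rows)+
    show "minus_mean u \<in> Hmix (q + \<theta>) (k2 + 1 - r - \<bar>q\<bar> - \<theta>)"
      using sr(1) minus_mean_distribution[OF u] by (simp add: Hmix_def)
    show "Hmix_norm (q + \<theta>) (k2 + 1 - r - \<bar>q\<bar> - \<theta>) (minus_mean u) \<le> sqrt C * Hmix_norm k1 k2 f"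
      unfolding Hmix_norm_def real_sqrt_mult[symmetric] using sr(2) by simp
  qed
  \<comment> \<open>The square root appears because \<open>Hmix_norm\<close> is the root of the sum
    that was estimated.\<close>
  show ?thesis using main C by (intro exI[of _ "sqrt C"]) auto
qed

text \<open>The two families differ only in the term at \<open>(0, 0)\<close>, and adding one term
  preserves summability.\<close>

lemma Hmix_minus_meanD:
  assumes "u \<in> distributions" "minus_mean u \<in> Hmix s1 s2"
  shows "u \<in> Hmix s1 s2"
proof -
  let ?d = "\<lambda>z. if z = (0, 0) then Hmix_term s1 s2 u z else 0"
  have "?d summable_on UNIV"
    by (rule finite_nonzero_values_imp_summable_on) (auto intro: finite_subset[of _ "{(0, 0)}"])
  with assms(2) have "(\<lambda>z. Hmix_term s1 s2 (minus_mean u) z + ?d z) summable_on UNIV"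
    by (intro summable_on_add) (auto simp: Hmix_def)
  moreover have "Hmix_term s1 s2 (minus_mean u) z + ?d z = Hmix_term s1 s2 u z" for z
    by (cases z) (auto simp: Hmix_term_bracket_sq fourier_coeff_minus_mean)
  ultimately show ?thesis using assms(1) by (simp add: Hmix_def)
qed

theorem theorem5p2:
  fixes a :: "real \<Rightarrow> real" and k1 :: real
  assumes "smooth_on_circle a"
    and "circle_mean a \<notin> \<rat>"
    and "irrationality_measure (circle_mean a) < \<infinity>"
  shows "(\<forall>r q \<theta> :: real.
            ereal r > irrationality_measure (circle_mean a) \<and> q \<le> k1 \<and> 0 \<le> \<theta> \<and> \<theta> \<le> 1 \<longrightarrow>
            (\<exists>C>0. \<forall>(k2 :: real) u f.
               u \<in> distributions \<and> f \<in> Hmix k1 k2 \<and> dist_eq (transport_op a u) f \<longrightarrow>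
               u \<in> Hmix (q + \<theta>) (k2 + 1 - r - \<bar>q\<bar> - \<theta>) \<and>
               minus_mean u \<in> Hmix (q + \<theta>) (k2 + 1 - r - \<bar>q\<bar> - \<theta>) \<and>
               Hmix_norm (q + \<theta>) (k2 + 1 - r - \<bar>q\<bar> - \<theta>) (minus_mean u)
                 \<le> C * Hmix_norm k1 k2 f)) \<and>
         (k1 \<ge> 0 \<longrightarrow>
            (\<forall>(k2 :: real) u f. \<forall>r \<sigma> :: real.
               u \<in> distributions \<and> f \<in> Hmix k1 k2 \<and> dist_eq (transport_op a u) f \<and>
               ereal r > irrationality_measure (circle_mean a) \<and> 0 \<le> \<sigma> \<and> \<sigma> \<le> k1 + 1 \<longrightarrow>
               u \<in> Hmix \<sigma> (k2 + 1 - r - \<sigma>)))"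
proof (intro conjI allI impI)
  fix r q \<theta> :: real
  assume "ereal r > irrationality_measure (circle_mean a) \<and> q \<le> k1 \<and> 0 \<le> \<theta> \<and> \<theta> \<le> 1"
  then show "\<exists>C>0. \<forall>(k2 :: real) u f.
               u \<in> distributions \<and> f \<in> Hmix k1 k2 \<and> dist_eq (transport_op a u) f \<longrightarrow>
               u \<in> Hmix (q + \<theta>) (k2 + 1 - r - \<bar>q\<bar> - \<theta>) \<and>
               minus_mean u \<in> Hmix (q + \<theta>) (k2 + 1 - r - \<bar>q\<bar> - \<theta>) \<and>
               Hmix_norm (q + \<theta>) (k2 + 1 - r - \<bar>q\<bar> - \<theta>) (minus_mean u)
                 \<le> C * Hmix_norm k1 k2 f"
    using transport_estimate[OF assms(1,2), of r q k1 \<theta>] Hmix_minus_meanD by meson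
next
  fix k2 r \<sigma> :: real and u f
  assume k1: "k1 \<ge> 0"
    and *: "u \<in> distributions \<and> f \<in> Hmix k1 k2 \<and> dist_eq (transport_op a u) f \<and>
            ereal r > irrationality_measure (circle_mean a) \<and> 0 \<le> \<sigma> \<and> \<sigma> \<le> k1 + 1"
  \<comment> \<open>As much of \<sigma> as \<open>k1\<close> allows goes into \<open>q\<close>, the
    remainder, at most 1, into \<theta>. Both are nonnegative, so
    \<open>\<bar>q\<bar> + \<theta>\<close> is again \<sigma>.\<close>
  define q where "q = min \<sigma> k1"
  define \<theta> where "\<theta> = \<sigma> - q"
  have q: "q \<le> k1" "q \<ge> 0" "0 \<le> \<theta>" "\<theta> \<le> 1" using * k1 by (auto simp: q_def \<theta>_def)
  then have "minus_mean u \<in> Hmix (q + \<theta>) (k2 + 1 - r - \<bar>q\<bar> - \<theta>)"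
    using transport_estimate[OF assms(1,2), of r q k1 \<theta>] * by blast
  moreover have "q + \<theta> = \<sigma>" "k2 + 1 - r - \<bar>q\<bar> - \<theta> = k2 + 1 - r - \<sigma>" using q by (auto simp: \<theta>_def)
  ultimately have "minus_mean u \<in> Hmix \<sigma> (k2 + 1 - r - \<sigma>)" by (simp only:)
  with * show "u \<in> Hmix \<sigma> (k2 + 1 - r - \<sigma>)" using Hmix_minus_meanD by blast
qed

end
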